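(* Let $H_0$ be a separable Hilbert space, $m$ a bounded operator on $H_0$ with $m\ge\delta I$ for some $\delta>0$, $A$ self-adjoint on $H_0$, and $a(t)=\alpha_\infty\delta(t)+\alpha(t)$ a friction function with $\alpha_\infty$ bounded non-negative and $\alpha:[0,\infty)\to\mathcal B(H_0)$ strongly continuous and bounded. Let $\hat a(\zeta)=\alpha_\infty+\int_0^\infty e^{\mathrm i\zeta t}\alpha(t)\,dt$ for $\operatorname{Im}\zeta>0$, and assume $\operatorname{Re}\hat a(\zeta):=\frac12(\hat a(\zeta)+\hat a(\zeta)^\dagger)\ge0$ for all $\operatorname{Im}\zeta>0$. Assume moreover there are measurable functions $\theta:\mathbb R\to(0,\pi)$ and $\gamma:\mathbb R\to(0,\infty)$ with $\gamma\in L^1_{loc}(\mathbb R)$ such that for almost every $\omega\in\mathbb R$ $$\operatorname{Re}(v,\hat a(\zeta)v)\ge\frac{1}{\gamma(\omega)}\|v\|^2\quad\text{for all }\zeta\in\Gamma_{\theta(\omega)}(\omega),\ v\in H_0.$$ Let $\mathfrak A(\zeta)=\mathrm i[\zeta m-A+\mathrm i\hat a(\zeta)]^{-1}$. Then for every compactly supported $f\in L^1(\mathbb R;H_0)$ with support in $[0,\infty)$, the causal solution $v_f$ of $m\partial_tv(t)=-\mathrm iAv(t)-\int_0^\infty a(\tau)v(t-\tau)\,d\tau+f(t)$ (i.e. the function $v_f$ on $[0,\infty)$ with Laplace transform $\int_0^\infty e^{\mathrm i\zeta t}v_f(t)\,dt=\mathfrak A(\zeta)\int_0^\infty e^{\mathrm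 i\zeta t}f(t)\,dt$ for $\operatorname{Im}\zeta>0$) satisfies $$\lim_{t\to\infty}\|v_f(t)\|=0.$$
   Context: For $\omega_0\in\mathbb R$ and $\theta\in(0,\pi)$, the cone $\Gamma_\theta(\omega_0)=\{\omega+\mathrm i\eta: 0<\eta<1,\ |\omega-\omega_0|<\eta\tan\frac\theta2\}$. $\mathcal B(H_0)$ denotes bounded operators, $X^\dagger$ the adjoint, $\int_0^\infty a(\tau)v(t-\tau)d\tau:=\alpha_\infty v(t)+\int_0^\infty\alpha(\tau)v(t-\tau)d\tau$. *)

theory Defs
  imports "HOL-Analysis.Analysis"
begin

(* A complex Hilbert space is modelled as a real Hilbert space 'h together with
 a complex structure J (multiplication by the imaginary unit): a real-linear map
 with J (J x) = - x that preserves the real inner product.  The real inner product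
 is the real part of the complex one. *)

definition complex_structure :: "('h::real_inner \<Rightarrow> 'h) \<Rightarrow> bool" where
  "complex_structure J \<longleftrightarrow> linear J \<and> (\<forall>x. J (J x) = - x) \<and>
     (\<forall>x y. inner (J x) (J y) = inner x y)"

definition cscale :: "('h::real_vector \<Rightarrow> 'h) \<Rightarrow> complex \<Rightarrow> 'h \<Rightarrow> 'h" where
  "cscale J c x = Re c *\<^sub>R x + Im c *\<^sub>R J x"

(* Complex inner product (antilinear in the first, linear in the second argument). *)
definition cinner :: "('h::real_inner \<Rightarrow> 'h) \<Rightarrow> 'h \<Rightarrow> 'h \<Rightarrow> complex" where
  "cinner J x y = Complex (inner x y) (- inner x (J y))"

definition bounded_clinear_op :: "('h::real_normed_vector \<Rightarrow> 'h) \<Rightarrow> ('h \<Rightarrow> 'h) \<Rightarrow> bool" where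
  "bounded_clinear_op J T \<longleftrightarrow> bounded_linear T \<and> (\<forall>x. T (J x) = J (T x))"

definition nonneg_op :: "('h::real_inner \<Rightarrow> 'h) \<Rightarrow> ('h \<Rightarrow> 'h) \<Rightarrow> bool" where
  "nonneg_op J T \<longleftrightarrow> (\<forall>x. Im (cinner J x (T x)) = 0 \<and> Re (cinner J x (T x)) \<ge> 0)"

definition self_adjoint_op ::
  "('h::real_inner \<Rightarrow> 'h) \<Rightarrow> 'h set \<Rightarrow> ('h \<Rightarrow> 'h) \<Rightarrow> bool" where
  "self_adjoint_op J D A \<longleftrightarrow>
     subspace D \<and> (\<forall>x\<in>D. J x \<in> D) \<and> closure D = UNIV \<and>
     (\<forall>x\<in>D. \<forall>y\<in>D. A (x + y) = A x + A y) \<and>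
     (\<forall>x\<in>D. \<forall>c. A (c *\<^sub>R x) = c *\<^sub>R A x) \<and>
     (\<forall>x\<in>D. A (J x) = J (A x)) \<and>
     (\<forall>y z. (\<forall>x\<in>D. cinner J (A x) y = cinner J x z) \<longleftrightarrow> (y \<in> D \<and> z = A y))"

definition laplace_int ::
  "('h::{banach,second_countable_topology} \<Rightarrow> 'h) \<Rightarrow> (real \<Rightarrow> 'h) \<Rightarrow> complex \<Rightarrow> 'h" where
  "laplace_int J v \<zeta> =
     set_lebesgue_integral lborel {0..} (\<lambda>t. cscale J (exp (\<i> * \<zeta> * of_real t)) (v t))"

definition laplace_exists ::
  "('h::{banach,second_countable_topology} \<Rightarrow> 'h) \<Rightarrow> (real \<Rightarrow> 'h) \<Rightarrow> complex \<Rightarrow> bool" where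
  "laplace_exists J v \<zeta> \<longleftrightarrow>
     set_integrable lborel {0..} (\<lambda>t. cscale J (exp (\<i> * \<zeta> * of_real t)) (v t))"

definition ahat ::
  "('h::{real_inner,banach,second_countable_topology} \<Rightarrow> 'h) \<Rightarrow> ('h \<Rightarrow> 'h) \<Rightarrow>
   (real \<Rightarrow> 'h \<Rightarrow> 'h) \<Rightarrow> complex \<Rightarrow> 'h \<Rightarrow> 'h" where
  "ahat J ainf \<alpha> \<zeta> v = ainf v + laplace_int J (\<lambda>t. \<alpha> t v) \<zeta>"

definition Gamma_cone :: "real \<Rightarrow> real \<Rightarrow> complex set" where
  "Gamma_cone \<theta> \<omega> = {z. 0 < Im z \<and> Im z < 1 \<and> \<bar>Re z - \<omega>\<bar> < Im z * tan (\<theta> / 2)}"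

definition Lop ::
  "('h::{real_inner,banach,second_countable_topology} \<Rightarrow> 'h) \<Rightarrow> ('h \<Rightarrow> 'h) \<Rightarrow> ('h \<Rightarrow> 'h) \<Rightarrow>
   ('h \<Rightarrow> 'h) \<Rightarrow> (real \<Rightarrow> 'h \<Rightarrow> 'h) \<Rightarrow> complex \<Rightarrow> 'h \<Rightarrow> 'h" where
  "Lop J m A ainf \<alpha> \<zeta> y = cscale J \<zeta> (m y) - A y + cscale J \<i> (ahat J ainf \<alpha> \<zeta> y)"

(* y = \<AA>(\<zeta>) x  where  \<AA>(\<zeta>) = i L(\<zeta>)^{-1}: the unique y in dom A with L(\<zeta>) y = i x. *)
definition frakA ::
  "('h::{real_inner,banach,second_countable_topology} \<Rightarrow> 'h) \<Rightarrow> 'h set \<Rightarrow> ('h \<Rightarrow> 'h) \<Rightarrow>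
   ('h \<Rightarrow> 'h) \<Rightarrow> ('h \<Rightarrow> 'h) \<Rightarrow> (real \<Rightarrow> 'h \<Rightarrow> 'h) \<Rightarrow> complex \<Rightarrow> 'h \<Rightarrow> 'h" where
  "frakA J D m A ainf \<alpha> \<zeta> x =
     (THE y. y \<in> D \<and> Lop J m A ainf \<alpha> \<zeta> y = cscale J \<i> x)"

end

theory Submission
  imports Defs "HOL-Probability.Sinc_Integral"
begin

text \<open>
  Testing the equation against its solution and using passivity of the friction
  (Re a-hat \<open>\<ge>\<close> 0) gives the energy estimate
  \<open>\<delta>\<close> |v(t)| \<open>\<le>\<close> 2 |f|, the right-hand side being the L1 norm. By time invariance the
  estimate also applies to v - v(. - h) with source f - f(. - h), so v is bounded and uniformly
  continuous up to the jump at 0, and convolution with a narrow Fejer kernel changes v by a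
  uniformly small amount. The Fourier transform of the smoothed solution lives on a compact
  interval, where coercivity bounds the Laplace transform of v by |f| \<open>\<gamma>\<close>(\<open>\<omega>\<close>) on the whole
  segment above almost every \<open>\<omega>\<close>, uniformly up to the real axis. Pairing with a
  sum of exponentials exp(i \<open>\<omega>\<close> t_k) times unit vectors, with widely spaced t_k, almost orthogonal in
  L2(\<open>\<gamma>\<close> d\<open>\<omega>\<close>) by the Riemann-Lebesgue lemma, shows that the smoothed solution
  cannot stay away from 0 along t_k. No boundary values of the Laplace transform are needed.
\<close>

section \<open>Translations in L1, Riemann-Lebesgue and the Fejer kernel\<close>

text \<open>The first obstacle is low regularity: \<open>v\<close> is given only by its Laplace
  transform and \<open>f\<close> is merely L1, so \<open>v\<close> need not be differentiable or
  take values in \<open>D\<close>, and the energy identity makes no sense for it. It is proved for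
  the double primitive \<open>V2\<close>, which is C1 with values in \<open>D\<close>, and carried
  back through scaled second differences. These are averages of \<open>v\<close> against narrow
  causal tents whose L1 mass does not depend on their width, so the source is still measured in L1.
  The second obstacle is that \<gamma> is only locally integrable: the Laplace transform of
  \<open>v\<close> has an integrable majorant on compact frequency intervals, but is not known to
  have limits on the real axis, so Riemann-Lebesgue cannot be applied to it. It is applied to the
  scalar majorant instead: the Gram entries of the exponentials in L2(\<gamma> d\<omega>) are
  trigonometric integrals of \<gamma>. The frequency cutoff is a triangle because its transform is
  nonnegative and integrable, so that smoothing is, up to a factor, an average of
  translates.\<close>

lemma lborel_translate:
  fixes f :: "real \<Rightarrow> 'a::{banach, second_countable_topology}"
  shows "(\<integral>x. f (x - h) \<partial>lborel) = (\<integral>x. f x \<partial>lborel)"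
    and "integrable lborel f \<Longrightarrow> integrable lborel (\<lambda>x. f (x - h))"
    and "(\<integral>x. f (h - x) \<partial>lborel) = (\<integral>x. f x \<partial>lborel)"
    and "integrable lborel f \<Longrightarrow> integrable lborel (\<lambda>x. f (h - x))"
  using lborel_integral_real_affine[of 1 f "-h"] lborel_integrable_real_affine[of f 1 "-h"]
    lborel_integral_real_affine[of "-1" f "h"] lborel_integrable_real_affine[of f "-1" h]
  by (simp_all add: algebra_simps)

definition L1_cont :: "(real \<Rightarrow> 'a::{banach, second_countable_topology}) \<Rightarrow> bool" where
  "L1_cont f \<longleftrightarrow> ((\<lambda>h. \<integral>x. norm (f (x - h) - f x) \<partial>lborel) \<longlongrightarrow> 0) (at 0)"

text \<open>Three-epsilon argument: by translation invariance the L1 error between \<open>f\<close>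
  and \<open>g\<close> is the same for the shifted pair.\<close>

lemma L1_cont_approx:
  fixes f :: "real \<Rightarrow> 'a::{banach, second_countable_topology}"
  assumes f: "integrable lborel f"
    and g: "\<And>e. e > 0 \<Longrightarrow> \<exists>g. integrable lborel g \<and> L1_cont g \<and> (\<integral>x. norm (f x - g x) \<partial>lborel) < e"
  shows "L1_cont f"
  unfolding L1_cont_def
proof (rule tendstoI)
  fix e :: real assume "e > 0"
  then obtain g where gi: "integrable lborel g" and gc: "L1_cont g"
    and ge: "(\<integral>x. norm (f x - g x) \<partial>lborel) < e/3"
    using g[of "e/3"] by auto
  have "eventually (\<lambda>h. dist (\<integral>x. norm (g (x - h) - g x) \<partial>lborel) 0 < e/3) (at 0)"
    using gc \<open>e > 0\<close> unfolding L1_cont_def by (intro tendstoD) auto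
  then show "eventually (\<lambda>h. dist (\<integral>x. norm (f (x - h) - f x) \<partial>lborel) 0 < e) (at 0)"
  proof eventually_elim
    case (elim h)
    note i = f gi lborel_translate(2)[OF f] lborel_translate(2)[OF gi]
    have fg: "integrable lborel (\<lambda>x. norm (f x - g x))" using i by auto
    have fgh: "integrable lborel (\<lambda>x. norm (f (x-h) - g (x-h)))" using i by auto
    have eq: "(\<integral>x. norm (f (x - h) - g (x - h)) \<partial>lborel) = (\<integral>x. norm (f x - g x) \<partial>lborel)"
      using lborel_translate(1)[of "\<lambda>x. norm (f x - g x)" h] by simp
    have "(\<integral>x. norm (f (x - h) - f x) \<partial>lborel)
        \<le> (\<integral>x. (norm (f (x - h) - g (x-h)) + norm (g (x - h) - g x)) + norm (f x - g x) \<partial>lborel)"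
    proof (rule integral_mono)
      fix x
      have "f (x-h) - f x = (f (x - h) - g (x-h)) + (g (x - h) - g x) - (f x - g x)" by simp
      then show "norm (f (x - h) - f x) \<le> (norm (f (x - h) - g (x-h)) + norm (g (x - h) - g x)) + norm (f x - g x)"
        by (metis norm_triangle_le norm_triangle_le_diff add_mono order_refl norm_triangle_ineq)
    qed (use i in auto)
    also have "\<dots> = (\<integral>x. norm (f (x - h) - g (x-h)) \<partial>lborel) + (\<integral>x. norm (g (x - h) - g x) \<partial>lborel)
       + (\<integral>x. norm (f x - g x) \<partial>lborel)"
      using i by (subst Bochner_Integration.integral_add Bochner_Integration.integral_add; simp)+
    also have "\<dots> < e" using elim ge eq by (auto simp: dist_norm)
    finally show ?case by (simp add: dist_norm)
  qed
qed

text \<open>Openness replaces any condition on the boundary of \<open>U\<close>, which may have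
  positive measure: for x in \<open>U\<close> the shifted point eventually lies in \<open>U\<close>,
  and off \<open>U\<close> the product of the indicators is 0. So the overlap integral tends to the
  mass of \<open>U\<close>, and the L1 distance is twice the mass minus twice the overlap.\<close>

lemma L1_cont_open:
  fixes U :: "real set"
  assumes U: "open U" "emeasure lborel U < \<infinity>"
  shows "L1_cont (indicat_real U)"
  unfolding L1_cont_def tendsto_at_iff_sequentially
proof (intro allI impI)
  fix X :: "nat \<Rightarrow> real" assume X: "\<forall>i. X i \<in> UNIV - {0}" "X \<longlonglongrightarrow> 0"
  have [measurable]: "U \<in> sets lborel" using U by auto
  have iU: "integrable lborel (indicat_real U)" using U by simp
  have iUh: "integrable lborel (\<lambda>x. indicat_real U (x - h))" for h
    by (rule lborel_translate(2)[OF iU])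
  have ip: "integrable lborel (\<lambda>x. indicat_real U (x - h) * indicat_real U x)" for h
    by (rule Bochner_Integration.integrable_bound[OF iU]) (auto simp: indicator_def)
  have eq: "(\<integral>x. norm (indicat_real U (x - h) - indicat_real U x) \<partial>lborel)
     = 2 * (\<integral>x. indicat_real U x \<partial>lborel) - 2 * (\<integral>x. indicat_real U (x - h) * indicat_real U x \<partial>lborel)" for h
  proof -
    have "(\<integral>x. norm (indicat_real U (x - h) - indicat_real U x) \<partial>lborel)
      = (\<integral>x. (indicat_real U (x - h) + indicat_real U x) - 2 * (indicat_real U (x - h) * indicat_real U x) \<partial>lborel)"
      by (rule Bochner_Integration.integral_cong) (auto simp: indicator_def)
    also have "\<dots> = (\<integral>x. indicat_real U (x - h) \<partial>lborel) + (\<integral>x. indicat_real U x \<partial>lborel) - 2 * (\<integral>x. indicat_real U (x - h) * indicat_real U x \<partial>lborel)"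
      using iU iUh ip by (subst Bochner_Integration.integral_diff) auto
    also have "(\<integral>x. indicat_real U (x - h) \<partial>lborel) = (\<integral>x. indicat_real U x \<partial>lborel)"
      by (rule lborel_translate(1))
    finally show ?thesis by simp
  qed
  have "(\<lambda>n. \<integral>x. indicat_real U (x - X n) * indicat_real U x \<partial>lborel) \<longlonglongrightarrow> (\<integral>x. indicat_real U x \<partial>lborel)"
  proof (rule integral_dominated_convergence[where w="indicat_real U"])
    show "AE x in lborel. (\<lambda>i. indicat_real U (x - X i) * indicat_real U x) \<longlonglongrightarrow> indicat_real U x"
    proof (rule AE_I2)
      fix x :: real
      show "(\<lambda>i. indicat_real U (x - X i) * indicat_real U x) \<longlonglongrightarrow> indicat_real U x"
      proof (cases "x \<in> U")
        case True
        have "(\<lambda>i. x - X i) \<longlonglongrightarrow> x - 0" by (intro tendsto_intros X)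
        then have "eventually (\<lambda>i. x - X i \<in> U) sequentially"
          using True U(1) by (intro topological_tendstoD) auto
        then have "eventually (\<lambda>i. indicat_real U (x - X i) * indicat_real U x = indicat_real U x) sequentially"
          by eventually_elim (auto simp: True)
        then show ?thesis by (rule tendsto_eventually)
      qed simp
    qed
  qed (use iU in \<open>auto simp: indicator_def\<close>)
  then have "(\<lambda>n. 2 * (\<integral>x. indicat_real U x \<partial>lborel) - 2 * (\<integral>x. indicat_real U (x - X n) * indicat_real U x \<partial>lborel))
      \<longlonglongrightarrow> 2 * (\<integral>x. indicat_real U x \<partial>lborel) - 2 * (\<integral>x. indicat_real U x \<partial>lborel)"
    by (intro tendsto_intros)
  then show "((\<lambda>h. \<integral>x. norm (indicat_real U (x - h) - indicat_real U x) \<partial>lborel) \<circ> X) \<longlonglongrightarrow> 0"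
    unfolding o_def eq by simp
qed

lemma L1_cont_scaleR:
  fixes c :: "'a::{banach, second_countable_topology}" and g :: "real \<Rightarrow> real"
  assumes "L1_cont g" shows "L1_cont (\<lambda>x. g x *\<^sub>R c)"
proof -
  have "(\<integral>x. norm (g (x - h) *\<^sub>R c - g x *\<^sub>R c) \<partial>lborel) = (\<integral>x. norm (g (x - h) - g x) \<partial>lborel) * norm c" for h
    by (simp flip: scaleR_diff_left)
  then show ?thesis
    using tendsto_mult_left_zero[OF assms[unfolded L1_cont_def], of "norm c"] by (simp add: L1_cont_def)
qed

lemma L1_cont_add:
  fixes f g :: "real \<Rightarrow> 'a::{banach, second_countable_topology}"
  assumes i: "integrable lborel f" "integrable lborel g" and "L1_cont f" "L1_cont g"
  shows "L1_cont (\<lambda>x. f x + g x)"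
proof -
  note i = i lborel_translate(2)[OF i(1)] lborel_translate(2)[OF i(2)]
  have le: "(\<integral>x. norm ((f (x - h) + g (x - h)) - (f x + g x)) \<partial>lborel)
     \<le> (\<integral>x. norm (f (x - h) - f x) \<partial>lborel) + (\<integral>x. norm (g (x - h) - g x) \<partial>lborel)" for h
  proof -
    have "(\<integral>x. norm ((f (x - h) + g (x - h)) - (f x + g x)) \<partial>lborel)
      \<le> (\<integral>x. norm (f (x - h) - f x) + norm (g (x - h) - g x) \<partial>lborel)"
    proof (rule integral_mono)
      fix x show "norm ((f (x - h) + g (x - h)) - (f x + g x)) \<le> norm (f (x - h) - f x) + norm (g (x - h) - g x)"
        by (rule norm_diff_triangle_ineq)
    qed (use i in auto)
    then show ?thesis using i by (subst (asm) Bochner_Integration.integral_add) auto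
  qed
  show ?thesis unfolding L1_cont_def
    by (rule tendsto_sandwich[OF _ _ tendsto_const tendsto_add_zero[OF assms(3,4)[unfolded L1_cont_def]]])
       (auto simp: le)
qed

text \<open>Induction along simple functions. Outer regularity passes from open sets to measurable
  sets of finite measure, and \<open>L1_cont_approx\<close> handles the limits.\<close>

theorem L1_translation_continuous:
  fixes f :: "real \<Rightarrow> 'a::{banach, second_countable_topology}"
  assumes "integrable lborel f"
  shows "((\<lambda>h. \<integral>x. norm (f (x - h) - f x) \<partial>lborel) \<longlongrightarrow> 0) (at 0)"
proof -
  have "L1_cont f" using assms
  proof induction
    case (base A c)
    have [measurable]: "A \<in> sets lborel" by fact
    have iA: "integrable lborel (indicat_real A)" using base by simp
    have "L1_cont (indicat_real A)"
    proof (rule L1_cont_approx[OF iA])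
      fix e :: real assume "e > 0"
      obtain U where U: "open U" "A \<subseteq> U" "emeasure lborel (U - A) < ennreal e"
        using outer_regular_lborel[of A e] base \<open>e > 0\<close> by auto
      have "emeasure lborel U \<le> emeasure lborel A + emeasure lborel (U - A)"
        using U base by (metis Diff_partition emeasure_subadditive borel_open sets_lborel sets.Diff)
      also have "\<dots> < \<infinity>" using base U by (auto simp: less_top[symmetric] ennreal_add_eq_top)
      finally have fU: "emeasure lborel U < \<infinity>" .
      have "(\<integral>x. norm (indicat_real A x - indicat_real U x) \<partial>lborel) = (\<integral>x. indicat_real (U - A) x \<partial>lborel)"
        using U by (intro Bochner_Integration.integral_cong) (auto simp: indicator_def)
      also have "\<dots> = measure lborel (U - A)" by simp
      also have "\<dots> < e" using U(3) \<open>e > 0\<close> by (metis emeasure_eq_ennreal_measure ennreal_less_iff top.not_eq_extremum measure_nonneg order_less_trans ennreal_less_top)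
      finally show "\<exists>g. integrable lborel g \<and> L1_cont g \<and> (\<integral>x. norm (indicat_real A x - g x) \<partial>lborel) < e"
        using L1_cont_open[OF U(1) fU] U(1) fU by (intro exI[of _ "indicat_real U"]) auto
    qed
    then show ?case by (rule L1_cont_scaleR)
  next
    case (add f g)
    then show ?case by (intro L1_cont_add)
  next
    case (lim f s)
    have fi: "integrable lborel f" and si: "integrable lborel (s i)" and sc: "L1_cont (s i)"
      and ptw: "(\<lambda>i. s i x) \<longlonglongrightarrow> f x" and bd: "norm (s i x) \<le> 2 * norm (f x)" for i x
      using lim by auto
    show ?case
    proof (rule L1_cont_approx[OF fi])
      fix e :: real assume "e > 0"
      have [measurable]: "s i \<in> borel_measurable lborel" "f \<in> borel_measurable lborel" for i using fi si by auto
      have "(\<lambda>i. \<integral>x. norm (f x - s i x) \<partial>lborel) \<longlonglongrightarrow> (\<integral>x. 0 \<partial>(lborel::real measure))"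
      proof (rule integral_dominated_convergence[where w="\<lambda>x. 3 * norm (f x)"])
        show "AE x in lborel. (\<lambda>i. norm (f x - s i x)) \<longlonglongrightarrow> 0"
        proof (rule AE_I2)
          fix x :: real
          have "(\<lambda>i. norm (f x - s i x)) \<longlonglongrightarrow> norm (f x - f x)" 
            using ptw[of x] by (intro tendsto_intros) auto
          then show "(\<lambda>i. norm (f x - s i x)) \<longlonglongrightarrow> 0" by simp
        qed
        show "AE x in lborel. norm (norm (f x - s i x)) \<le> 3 * norm (f x)" for i
        proof (rule AE_I2)
          fix x :: real
          have "norm (f x - s i x) \<le> norm (f x) + norm (s i x)" by (rule norm_triangle_ineq4)
          then show "norm (norm (f x - s i x)) \<le> 3 * norm (f x)" using bd[of i x] by simp
        qed
      qed (use fi in auto)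
      then have "eventually (\<lambda>i. (\<integral>x. norm (f x - s i x) \<partial>lborel) < e) sequentially"
        using \<open>e > 0\<close> by (intro order_tendstoD(2)) auto
      then obtain i where "(\<integral>x. norm (f x - s i x) \<partial>lborel) < e" by (auto simp: eventually_sequentially)
      then show "\<exists>g. integrable lborel g \<and> L1_cont g \<and> (\<integral>x. norm (f x - g x) \<partial>lborel) < e"
        using si sc by auto
    qed
  qed
  then show ?thesis by (simp add: L1_cont_def)
qed

lemma approx_identity:
  fixes k :: "real \<Rightarrow> real" and g :: "real \<Rightarrow> 'a::{banach, second_countable_topology}"
  assumes k: "integrable lborel k" and g: "g \<in> borel_measurable borel"
    and B: "\<And>s. norm (g s) \<le> B" and c: "isCont g t"
  shows "(\<lambda>n. \<integral>q. k q *\<^sub>R g (t - q / real (Suc n)) \<partial>lborel) \<longlonglongrightarrow> (\<integral>q. k q \<partial>lborel) *\<^sub>R g t"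
proof -
  have [measurable]: "g \<in> borel_measurable borel" "k \<in> borel_measurable borel" using g k by auto
  have "(\<lambda>n. \<integral>q. k q *\<^sub>R g (t - q / real (Suc n)) \<partial>lborel) \<longlonglongrightarrow> (\<integral>q. k q *\<^sub>R g t \<partial>lborel)"
  proof (rule integral_dominated_convergence[where w="\<lambda>q. norm (k q) * B"])
    show "AE q in lborel. (\<lambda>n. k q *\<^sub>R g (t - q / real (Suc n))) \<longlonglongrightarrow> k q *\<^sub>R g t"
    proof (rule AE_I2, intro tendsto_intros)
      fix q :: real
      have "(\<lambda>n. t - q * inverse (real (Suc n))) \<longlonglongrightarrow> t - q * 0"
        by (intro tendsto_intros LIMSEQ_inverse_real_of_nat)
      then have "(\<lambda>n. t - q / real (Suc n)) \<longlonglongrightarrow> t" by (simp add: divide_inverse)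
      then show "(\<lambda>n. g (t - q / real (Suc n))) \<longlonglongrightarrow> g t"
        using c isCont_tendsto_compose by blast
    qed
    show "AE q in lborel. norm (k q *\<^sub>R g (t - q / real (Suc n))) \<le> norm (k q) * B" for n
      using B by (auto intro!: mult_left_mono)
  qed (use k in auto)
  then show ?thesis by (simp only: integral_scaleR_left[OF k])
qed

lemma integrable_product_bound:
  fixes f :: "real \<Rightarrow> real \<Rightarrow> 'a::{banach, second_countable_topology}"
  assumes m: "case_prod f \<in> borel_measurable (lborel \<Otimes>\<^sub>M lborel)"
    and a: "integrable lborel a" and b: "integrable lborel b"
    and le: "\<And>x y. norm (f x y) \<le> a x * b y"
  shows "integrable (lborel \<Otimes>\<^sub>M lborel) (case_prod f)"
proof (rule lborel_pair.Fubini_integrable[OF m])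
  have [measurable]: "case_prod f \<in> borel_measurable (lborel \<Otimes>\<^sub>M lborel)" by fact
  have i: "integrable lborel (\<lambda>y. f x y)" for x
    by (rule Bochner_Integration.integrable_bound[of _ "\<lambda>y. a x * b y"])
       (use b le[of x] in \<open>auto intro!: AE_I2 order_trans[OF le]\<close>)
  show "AE x in lborel. integrable lborel (\<lambda>y. case_prod f (x, y))" using i by simp
  have "integrable lborel (\<lambda>x. \<integral>y. norm (f x y) \<partial>lborel)"
  proof (rule Bochner_Integration.integrable_bound[of _ "\<lambda>x. a x * (\<integral>y. b y \<partial>lborel)"])
    show "AE x in lborel. norm (\<integral>y. norm (f x y) \<partial>lborel) \<le> norm (a x * (\<integral>y. b y \<partial>lborel))"
    proof (rule AE_I2)
      fix x
      have "(\<integral>y. norm (f x y) \<partial>lborel) \<le> (\<integral>y. a x * b y \<partial>lborel)"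
        using i b le by (intro integral_mono) auto
      then show "norm (\<integral>y. norm (f x y) \<partial>lborel) \<le> norm (a x * (\<integral>y. b y \<partial>lborel))" by simp
    qed
  qed (use a in auto)
  then show "integrable lborel (\<lambda>x. \<integral>y. norm (case_prod f (x, y)) \<partial>lborel)" by simp
qed

lemma norm_integral_le:
  fixes f :: "'b \<Rightarrow> 'a::{banach, second_countable_topology}"
  assumes "integrable M g" "\<And>x. norm (f x) \<le> g x"
  shows "norm (integral\<^sup>L M f) \<le> integral\<^sup>L M g"
proof (cases "integrable M f")
  case True
  have "norm (integral\<^sup>L M f) \<le> (\<integral>x. norm (f x) \<partial>M)" by (rule integral_norm_bound)
  also have "\<dots> \<le> integral\<^sup>L M g" using True assms by (intro integral_mono) auto
  finally show ?thesis .
next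
  \<comment> \<open>A non-integrable function has integral 0 by convention, so only nonnegativity of
    the bound remains to be shown.\<close>
  case False
  have "0 \<le> integral\<^sup>L M g" using assms(2) by (intro integral_nonneg_AE AE_I2) (meson norm_ge_zero order_trans)
  then show ?thesis using False by (simp add: not_integrable_integral_eq)
qed

text \<open>A shift by pi / t flips the sign of the sine and cosine factors. Twice the integral is
  therefore an integral of \<open>g\<close> minus its translate, which is small by L1 continuity of
  translations.\<close>

lemma Riemann_Lebesgue:
  fixes g :: "real \<Rightarrow> real"
  assumes g: "integrable lborel g" and e: "e > 0"
  obtains T where "T > 0" "\<And>t. \<bar>t\<bar> \<ge> T \<Longrightarrow> \<bar>\<integral>\<omega>. g \<omega> * cos (\<omega> * t) \<partial>lborel\<bar> \<le> e"
    "\<And>t. \<bar>t\<bar> \<ge> T \<Longrightarrow> \<bar>\<integral>\<omega>. g \<omega> * sin (\<omega> * t) \<partial>lborel\<bar> \<le> e"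
proof -
  have key: "2 * \<bar>\<integral>\<omega>. g \<omega> * c (\<omega> * t) \<partial>lborel\<bar> \<le> (\<integral>x. norm (g (x - pi / t) - g x) \<partial>lborel)"
    if t: "t \<noteq> 0" and c: "\<And>x. c (x - pi) = - c x" "\<And>x. \<bar>c x\<bar> \<le> 1" "c \<in> borel_measurable borel" for t and c :: "real \<Rightarrow> real"
  proof -
    have [measurable]: "c \<in> borel_measurable borel" "g \<in> borel_measurable borel" using c g by auto
    have gc: "integrable lborel (\<lambda>\<omega>. g \<omega> * c (\<omega> * t))"
      using c by (intro Bochner_Integration.integrable_bound[OF g]) (auto simp: abs_mult intro!: mult_left_le)
    have gh: "integrable lborel (\<lambda>\<omega>. g (\<omega> - pi/t))" by (rule lborel_translate(2)[OF g])
    have ghc: "integrable lborel (\<lambda>\<omega>. g (\<omega> - pi/t) * c (\<omega> * t))"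
      using c by (intro Bochner_Integration.integrable_bound[OF gh]) (auto simp: abs_mult intro!: mult_left_le)
    have "(\<integral>\<omega>. g \<omega> * c (\<omega> * t) \<partial>lborel) = (\<integral>\<omega>. g (\<omega> - pi/t) * c ((\<omega> - pi/t) * t) \<partial>lborel)"
      by (rule lborel_translate(1)[symmetric, of _ "pi/t"])
    also have "\<dots> = - (\<integral>\<omega>. g (\<omega> - pi/t) * c (\<omega> * t) \<partial>lborel)"
      using t c(1) by (subst integral_minus[symmetric], intro Bochner_Integration.integral_cong) (auto simp: left_diff_distrib)
    finally have "2 * (\<integral>\<omega>. g \<omega> * c (\<omega> * t) \<partial>lborel)
        = (\<integral>\<omega>. g \<omega> * c (\<omega> * t) \<partial>lborel) - (\<integral>\<omega>. g (\<omega> - pi/t) * c (\<omega> * t) \<partial>lborel)" by simp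
    also have "\<dots> = (\<integral>\<omega>. g \<omega> * c (\<omega> * t) - g (\<omega> - pi/t) * c (\<omega> * t) \<partial>lborel)"
      using gc ghc by simp
    finally have "norm (2 * (\<integral>\<omega>. g \<omega> * c (\<omega> * t) \<partial>lborel)) = norm (\<integral>\<omega>. g \<omega> * c (\<omega> * t) - g (\<omega> - pi/t) * c (\<omega> * t) \<partial>lborel)"
      by simp
    also have "\<dots> \<le> (\<integral>x. norm (g (x - pi / t) - g x) \<partial>lborel)"
    proof (rule norm_integral_le)
      fix x
      have "norm (g x * c (x * t) - g (x - pi / t) * c (x * t)) = \<bar>g (x - pi / t) - g x\<bar> * \<bar>c (x * t)\<bar>"
        by (simp add: abs_mult[symmetric] algebra_simps abs_minus_commute)
      also have "\<dots> \<le> \<bar>g (x - pi / t) - g x\<bar>" using c(2) by (intro mult_left_le) auto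
      finally show "norm (g x * c (x * t) - g (x - pi / t) * c (x * t)) \<le> norm (g (x - pi / t) - g x)" by simp
    qed (use g gh in auto)
    finally show ?thesis by (simp add: abs_mult)
  qed
  have "eventually (\<lambda>h. (\<integral>x. norm (g (x - h) - g x) \<partial>lborel) < e) (at 0)"
    using L1_translation_continuous[OF g] e by (intro order_tendstoD(2)) auto
  then obtain d where d: "d > 0" "\<And>h. h \<noteq> 0 \<Longrightarrow> \<bar>h\<bar> < d \<Longrightarrow> (\<integral>x. norm (g (x - h) - g x) \<partial>lborel) < e"
    by (auto simp: eventually_at dist_norm)
  show ?thesis
  \<comment> \<open>The summand 1 makes |t| > pi / d strict, hence |pi / t| < d.\<close>
  proof (rule that[of "pi / d + 1"])
    have pd: "pi / d > 0" using d by simp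
    then show "pi / d + 1 > 0" by simp
    have small: "(\<integral>x. norm (g (x - pi / t) - g x) \<partial>lborel) < e \<and> t \<noteq> 0" if "\<bar>t\<bar> \<ge> pi / d + 1" for t
    proof -
      have "\<bar>t\<bar> > pi / d" "t \<noteq> 0" using that pd by auto
      then have "\<bar>pi / t\<bar> < d" using d by (simp add: field_simps)
      then show ?thesis using d(2)[of "pi/t"] \<open>t \<noteq> 0\<close> by simp
    qed
    show "\<bar>\<integral>\<omega>. g \<omega> * cos (\<omega> * t) \<partial>lborel\<bar> \<le> e" if "\<bar>t\<bar> \<ge> pi / d + 1" for t
      using key[of t cos] small[OF that] e by auto
    show "\<bar>\<integral>\<omega>. g \<omega> * sin (\<omega> * t) \<partial>lborel\<bar> \<le> e" if "\<bar>t\<bar> \<ge> pi / d + 1" for t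
      using key[of t sin] small[OF that] e by auto
  qed
qed

section \<open>The triangle function and the Fejer kernel\<close>

definition tri :: "real \<Rightarrow> real" where "tri \<omega> = max 0 (1 - \<bar>\<omega>\<bar>)"

text \<open>Neither normalised by \<open>2\<pi>\<close> nor in mass: the total mass is \<open>fejer_mass\<close>.\<close>

definition fejer :: "real \<Rightarrow> real" where "fejer s = (\<integral>\<omega>. tri \<omega> * cos (\<omega> * s) \<partial>lborel)"

lemma tri_measurable [measurable]: "tri \<in> borel_measurable borel"
  unfolding tri_def by measurable

lemma tri_nonneg: "0 \<le> tri \<omega>" and tri_le: "tri \<omega> \<le> indicator {-1..1} \<omega>" and tri_minus: "tri (-\<omega>) = tri \<omega>"
  by (auto simp: tri_def indicator_def)

lemma tri_integrable: "integrable lborel tri"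
  by (rule Bochner_Integration.integrable_bound[of _ "indicat_real {-1..1}"])
     (auto simp: tri_nonneg tri_le)

lemma tri_scaled_integrable: "R > 0 \<Longrightarrow> integrable lborel (\<lambda>\<omega>. tri (\<omega> / R))"
  using lborel_integrable_real_affine[OF tri_integrable, of "1/R" 0] by simp

lemma tri_sin: "(\<integral>\<omega>. tri (\<omega> / R) * sin (\<omega> * s) \<partial>lborel) = 0"
  using lborel_translate(3)[of "\<lambda>\<omega>. tri (\<omega> / R) * sin (\<omega> * s)" 0]
  by (simp add: tri_minus integral_minus)

lemma fejer_scale:
  assumes "R > 0"
  shows "(\<integral>\<omega>. tri (\<omega> / R) * cos (\<omega> * s) \<partial>lborel) = R * fejer (R * s)"
  using lborel_integral_real_affine[of R "\<lambda>\<omega>. tri (\<omega> / R) * cos (\<omega> * s)" 0] assms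
  by (simp add: fejer_def mult_ac)

lemma fejer_measurable [measurable]: "fejer \<in> borel_measurable borel"
proof -
  have "(\<lambda>s. \<integral>\<omega>. tri \<omega> * cos (\<omega> * s) \<partial>lborel) \<in> borel_measurable borel"
    by measurable
  then show ?thesis by (simp add: fejer_def[abs_def])
qed

text \<open>Source of both the sign and the quadratic decay of the kernel. Each half of the triangle
  has an explicit antiderivative, whose end values are written out in \<open>L\<close> and
  \<open>R\<close>.\<close>

lemma fejer_closed:
  assumes s: "s \<noteq> 0"
  shows "fejer s = 2 * (1 - cos s) / s\<^sup>2"
proof -
  have iL: "integrable lborel (\<lambda>x. indicator {-1..0} x *\<^sub>R ((1 + x) * cos (x * s)))"
   and iR: "integrable lborel (\<lambda>x. indicator {0..1} x *\<^sub>R ((1 - x) * cos (x * s)))"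
    by (rule borel_integrable_compact; auto intro!: continuous_intros)+
  have L: "(\<integral>x. indicator {-1..0} x *\<^sub>R ((1 + x) * cos (x * s)) \<partial>lborel)
     = ((1 + 0) * sin (0 * s) / s + cos (0 * s) / s^2) - ((1 + -1) * sin (-1 * s) / s + cos (-1 * s) / s^2)"
    using s by (intro integral_FTC_atLeastAtMost)
      (auto intro!: continuous_intros derivative_eq_intros simp: has_real_derivative_iff_has_vector_derivative[symmetric] field_simps power2_eq_square)
  have R: "(\<integral>x. indicator {0..1} x *\<^sub>R ((1 - x) * cos (x * s)) \<partial>lborel)
     = ((1 - 1) * sin (1 * s) / s - cos (1 * s) / s^2) - ((1 - 0) * sin (0 * s) / s - cos (0 * s) / s^2)"
    using s by (intro integral_FTC_atLeastAtMost)
      (auto intro!: continuous_intros derivative_eq_intros simp: has_real_derivative_iff_has_vector_derivative[symmetric] field_simps power2_eq_square)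
  have "fejer s = (\<integral>x. indicator {-1..0} x *\<^sub>R ((1 + x) * cos (x * s)) + indicator {0..1} x *\<^sub>R ((1 - x) * cos (x * s)) \<partial>lborel)"
    unfolding fejer_def
  proof (rule integral_cong_AE)
    show "AE x in lborel. tri x * cos (x * s) = indicator {-1..0} x *\<^sub>R ((1 + x) * cos (x * s)) + indicator {0..1} x *\<^sub>R ((1 - x) * cos (x * s))"
      using AE_lborel_singleton[of 0]
      by eventually_elim (auto simp: tri_def indicator_def)
  qed auto
  also have "\<dots> = 2 * (1 - cos s) / s\<^sup>2"
    using L R iL iR by (simp add: diff_divide_distrib)
  finally show ?thesis .
qed

lemma fejer_nonneg: "0 \<le> fejer s"
proof (cases "s = 0")
  case True
  then show ?thesis unfolding fejer_def by (auto intro!: Bochner_Integration.integral_nonneg simp: tri_nonneg)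
qed (simp add: fejer_closed)

text \<open>The constant is 2 + 4: the kernel is at most the length of [-1,1], and s^2 times the
  kernel is 2 (1 - cos s), at most 4.\<close>

lemma fejer_bound: "fejer s \<le> 6 * inverse (1 + s\<^sup>2)"
proof -
  have f2: "fejer s \<le> 2"
  proof -
    have "norm (fejer s) \<le> (\<integral>x. indicat_real {-1..1::real} x \<partial>lborel)"
      unfolding fejer_def
    proof (rule norm_integral_le)
      show "norm (tri x * cos (x * s)) \<le> indicat_real {-1..1} x" for x
        using mult_left_le[of "\<bar>cos (x * s)\<bar>" "tri x"] tri_nonneg[of x] tri_le[of x] by (simp add: abs_mult)
    qed simp
    then show ?thesis by simp
  qed
  have "fejer s * s\<^sup>2 \<le> 4"
  proof (cases "s = 0")
    case False
    then have "fejer s * s\<^sup>2 = 2 * (1 - cos s)" by (simp add: fejer_closed)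
    moreover have "2 * (1 - cos s) \<le> 2 * 2" using cos_ge_minus_one[of s] by (intro mult_left_mono) auto
    ultimately show ?thesis by simp
  qed simp
  with f2 have "fejer s * (1 + s\<^sup>2) \<le> 6" by (simp add: algebra_simps)
  moreover have "1 + s\<^sup>2 > 0" by (simp add: add_pos_nonneg)
  ultimately show ?thesis by (simp add: field_simps)
qed

lemma fejer_integrable: "integrable lborel fejer"
proof (rule Bochner_Integration.integrable_bound)
  show "integrable lborel (\<lambda>s::real. 6 * inverse (1 + s\<^sup>2))"
    using integrable_inverse_1_plus_square by (simp add: set_integrable_def einterval_def)
  show "AE s in lborel. norm (fejer s) \<le> norm (6 * inverse (1 + s\<^sup>2))"
    using fejer_bound fejer_nonneg by (auto intro!: AE_I2 order_trans[OF fejer_bound])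
qed simp

definition fejer_mass :: real where "fejer_mass = (\<integral>s. fejer s \<partial>lborel)"

text \<open>The mass enters the later arguments only as a factor to be divided out, so its sign is
  what matters. The closed form is positive on (0,1), a set of positive measure.\<close>

lemma fejer_mass_pos: "fejer_mass > 0"
proof -
  have "fejer_mass \<ge> 0" unfolding fejer_mass_def by (simp add: fejer_nonneg Bochner_Integration.integral_nonneg)
  moreover have "fejer_mass \<noteq> 0"
  proof
    assume "fejer_mass = 0"
    then have "AE s in lborel. fejer s = 0"
      unfolding fejer_mass_def
      by (subst (asm) integral_nonneg_eq_0_iff_AE) (auto simp: fejer_integrable fejer_nonneg)
    then have "AE s in lborel. \<not> (s \<in> {0<..<1::real})"
    proof eventually_elim
      case (elim s)
      show ?case
      proof
        assume s: "s \<in> {0<..<1}"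
        then have "cos s < cos 0" using pi_gt3 by (intro cos_monotone_0_pi) auto
        then show False using elim s by (simp add: fejer_closed)
      qed
    qed
    then have "emeasure lborel {0<..<1::real} = 0"
      by (subst (asm) AE_iff_measurable[of "{0<..<1}"]) auto
    then show False by simp
  qed
  ultimately show ?thesis by simp
qed

lemma fejer_subst:
  fixes z :: "real \<Rightarrow> 'a::{banach, second_countable_topology}"
  assumes R: "R > 0"
  shows "(\<integral>s. (R * fejer (R * (t - s))) *\<^sub>R z s \<partial>lborel) = (\<integral>q. fejer q *\<^sub>R z (t - q / R) \<partial>lborel)"
proof -
  have "(R * fejer (R * (t - (t + (-1/R) * q)))) *\<^sub>R z (t + (-1/R) * q) = R *\<^sub>R (fejer q *\<^sub>R z (t - q / R))" for q
    using R by simp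
  then show ?thesis
    using R by (subst lborel_integral_real_affine[of "-1/R" _ t])
      (simp_all flip: integral_scaleR_right)
qed

section \<open>Fourier transform in a Hilbert space with complex structure\<close>

lemma cis_measurable [measurable]: "cis \<in> borel_measurable borel"
  by (intro borel_measurable_continuous_onI continuous_intros)

locale complex_hilbert =
  fixes J :: "'h::{real_inner, banach, second_countable_topology} \<Rightarrow> 'h"
  assumes complex_structure: "complex_structure J"
begin

lemma linear_J: "linear J" and J_J [simp]: "J (J x) = - x" and inner_J_J [simp]: "inner (J x) (J y) = inner x y"
  using complex_structure by (auto simp: complex_structure_def)

lemma norm_J [simp]: "norm (J x) = norm x"
  by (simp add: norm_eq_sqrt_inner)

lemma bounded_linear_J: "bounded_linear J"
  using linear_J by (intro bounded_linear_intro[where K=1]) (auto simp: linear_add linear_scale)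

sublocale J: bounded_linear J by (rule bounded_linear_J)

lemma J_measurable [measurable]: "J \<in> borel_measurable borel"
  by (intro borel_measurable_continuous_onI J.continuous_on continuous_intros)

lemma inner_J_left: "inner (J x) y = - inner x (J y)"
  using inner_J_J[of x "J y"] by simp

lemma inner_J_self [simp]: "inner x (J x) = 0"
  using inner_J_left[of x x] by (simp add: inner_commute)

lemma bounded_bilinear_cscale: "bounded_bilinear (cscale J)"
proof (rule bounded_bilinear.intro)
  show "\<exists>K. \<forall>a b. norm (cscale J a b) \<le> norm a * norm b * K"
  proof (intro exI allI)
    fix a b
    have "norm (cscale J a b) \<le> \<bar>Re a\<bar> * norm b + \<bar>Im a\<bar> * norm b"
      unfolding cscale_def by (rule norm_triangle_le) simp
    also have "\<dots> \<le> norm a * norm b + norm a * norm b"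
      by (intro add_mono mult_right_mono abs_Re_le_cmod abs_Im_le_cmod) auto
    finally show "norm (cscale J a b) \<le> norm a * norm b * 2" by (simp add: mult_ac)
  qed
qed (auto simp: cscale_def algebra_simps J.add J.scaleR)

sublocale cscale: bounded_bilinear "cscale J" by (rule bounded_bilinear_cscale)

lemma cscale_mult: "cscale J a (cscale J b x) = cscale J (a * b) x"
  by (simp add: cscale_def J.add J.scaleR algebra_simps)

lemma cscale_ii [simp]: "cscale J \<i> x = J x"
  by (simp add: cscale_def)

lemma cscale_of_real [simp]: "cscale J (of_real r) x = r *\<^sub>R x"
  by (simp add: cscale_def)

lemma inner_cscale: "inner (cscale J a x) (cscale J b y) = Re (cnj a * b) * inner x y + Im (cnj a * b) * inner x (J y)"
  by (simp add: cscale_def inner_add_left inner_add_right inner_J_left algebra_simps)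

lemma norm_cscale [simp]: "norm (cscale J c x) = cmod c * norm x"
proof -
  have "inner (cscale J c x) (cscale J c x) = (cmod c)\<^sup>2 * inner x x"
    by (simp add: inner_cscale cmod_power2) (simp add: power2_eq_square)
  then show ?thesis by (simp add: norm_eq_sqrt_inner real_sqrt_mult)
qed

lemma inner_cscale_cis:
  "inner (cscale J (cis a) x) (cscale J (cis b) y) = cos (b - a) * inner x y + sin (b - a) * inner x (J y)"
  by (simp add: inner_cscale cis_cnj cis_mult)

lemma cscale_measurable [measurable (raw)]:
  assumes [measurable]: "f \<in> borel_measurable M" "g \<in> borel_measurable M"
  shows "(\<lambda>x. cscale J (f x) (g x)) \<in> borel_measurable M"
  unfolding cscale_def by measurable

text \<open>The exponent has a plus sign so that the Laplace transform on a horizontal line is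
  \<open>ft\<close> of an exponentially damped causal function. There is no normalising factor;
  constants are absorbed in \<open>fejer_mass\<close>.\<close>

definition ft :: "(real \<Rightarrow> 'h) \<Rightarrow> real \<Rightarrow> 'h" where
  "ft w \<omega> = (\<integral>t. cscale J (cis (\<omega> * t)) (w t) \<partial>lborel)"

lemma ft_measurable [measurable]:
  assumes [measurable]: "w \<in> borel_measurable borel"
  shows "ft w \<in> borel_measurable borel"
  unfolding ft_def[abs_def] by measurable

lemma ft_integrable:
  "integrable lborel w \<Longrightarrow> integrable lborel (\<lambda>t. cscale J (cis (\<omega> * t)) (w t))"
  by (rule Bochner_Integration.integrable_bound[where f=w]) auto

lemma ft_bound: "integrable lborel w \<Longrightarrow> norm (ft w \<omega>) \<le> (\<integral>t. norm (w t) \<partial>lborel)"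
  unfolding ft_def by (rule norm_integral_le) auto

lemma ft_add: "integrable lborel w \<Longrightarrow> integrable lborel z \<Longrightarrow> ft (\<lambda>t. w t + z t) \<omega> = ft w \<omega> + ft z \<omega>"
  unfolding ft_def by (simp add: cscale.add_right ft_integrable)

lemma ft_diff: "integrable lborel w \<Longrightarrow> integrable lborel z \<Longrightarrow> ft (\<lambda>t. w t - z t) \<omega> = ft w \<omega> - ft z \<omega>"
  unfolding ft_def by (simp add: cscale.diff_right ft_integrable)

lemma ft_bounded_linear:
  assumes w: "integrable lborel w" and T: "bounded_linear T" "\<And>x. T (J x) = J (T x)"
  shows "ft (\<lambda>t. T (w t)) \<omega> = T (ft w \<omega>)"
proof -
  interpret T: bounded_linear T by fact
  have "T (ft w \<omega>) = (\<integral>t. T (cscale J (cis (\<omega> * t)) (w t)) \<partial>lborel)"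
    unfolding ft_def by (rule integral_bounded_linear[OF T(1) ft_integrable[OF w], symmetric])
  also have "\<dots> = ft (\<lambda>t. T (w t)) \<omega>"
    unfolding ft_def by (simp add: cscale_def T.add T.scaleR T(2))
  finally show ?thesis by simp
qed

text \<open>Fubini. The sine part of the phase difference integrates to 0 because \<open>tri\<close>
  is even, and the cosine part gives the kernel. Thus a Fejer mean at time \<open>t\<close> sees
  only frequencies in [-R,R], with the phase of \<open>t\<close> attached to the test
  vector.\<close>

lemma fejer_representation:
  assumes z: "integrable lborel z" and R: "R > 0"
  shows "inner x (\<integral>s. (R * fejer (R * (t - s))) *\<^sub>R z s \<partial>lborel)
     = (\<integral>\<omega>. tri (\<omega> / R) * inner (cscale J (cis (\<omega> * t)) x) (ft z \<omega>) \<partial>lborel)"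
proof -
  have zm [measurable]: "z \<in> borel_measurable borel" using z by auto
  define F where "F \<omega> s = tri (\<omega> / R) * inner (cscale J (cis (\<omega> * t)) x) (cscale J (cis (\<omega> * s)) (z s))" for \<omega> s
  have Fi: "integrable (lborel \<Otimes>\<^sub>M lborel) (case_prod F)"
  proof (rule integrable_product_bound)
    show "case_prod F \<in> borel_measurable (lborel \<Otimes>\<^sub>M lborel)" unfolding F_def by measurable
    show "integrable lborel (\<lambda>\<omega>. tri (\<omega> / R))" by (rule tri_scaled_integrable[OF R])
    show "integrable lborel (\<lambda>s. norm x * norm (z s))" using z by auto
    fix \<omega> s
    have "\<bar>inner (cscale J (cis (\<omega> * t)) x) (cscale J (cis (\<omega> * s)) (z s))\<bar> \<le> norm x * norm (z s)"
      using Cauchy_Schwarz_ineq2[of "cscale J (cis (\<omega> * t)) x" "cscale J (cis (\<omega> * s)) (z s)"] by simp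
    then show "norm (F \<omega> s) \<le> tri (\<omega> / R) * (norm x * norm (z s))"
      unfolding F_def by (simp add: abs_mult tri_nonneg mult_left_mono)
  qed
  have inner_int: "(\<integral>\<omega>. F \<omega> s \<partial>lborel) = inner x ((R * fejer (R * (t - s))) *\<^sub>R z s)" for s
  proof -
    have Fe: "F \<omega> s = (tri (\<omega> / R) * cos (\<omega> * (t - s))) * inner x (z s) - (tri (\<omega> / R) * sin (\<omega> * (t - s))) * inner x (J (z s))" for \<omega>
      using cos_minus[of "\<omega> * (t - s)"] sin_minus[of "\<omega> * (t - s)"]
      by (simp add: F_def inner_cscale_cis algebra_simps)
    have i: "integrable lborel (\<lambda>\<omega>. tri (\<omega> / R) * cos (\<omega> * (t - s)))" "integrable lborel (\<lambda>\<omega>. tri (\<omega> / R) * sin (\<omega> * (t - s)))"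
      by (rule Bochner_Integration.integrable_bound[OF tri_scaled_integrable[OF R]];
          auto simp: abs_mult tri_nonneg intro!: mult_left_le)+
    show ?thesis unfolding Fe using i by (simp add: fejer_scale[OF R] tri_sin)
  qed
  have zi: "integrable lborel (\<lambda>s. (R * fejer (R * (t - s))) *\<^sub>R z s)"
  proof (rule Bochner_Integration.integrable_bound[where f="\<lambda>s. R * 6 * norm (z s)"])
    show "AE s in lborel. norm ((R * fejer (R * (t - s))) *\<^sub>R z s) \<le> norm (R * 6 * norm (z s))"
    proof (rule AE_I2)
      fix s
      \<comment> \<open>Crude consequence of \<open>fejer_bound\<close>, enough for a
        majorant.\<close>
      have "fejer (R * (t - s)) \<le> 6" 
        using fejer_bound[of "R * (t-s)"] by (smt (verit) le_imp_inverse_le inverse_1 zero_le_power2)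
      then show "norm ((R * fejer (R * (t - s))) *\<^sub>R z s) \<le> norm (R * 6 * norm (z s))"
        using R fejer_nonneg[of "R * (t-s)"] by (auto simp: abs_mult intro!: mult_right_mono)
    qed
  qed (use z in auto)
  have "inner x (\<integral>s. (R * fejer (R * (t - s))) *\<^sub>R z s \<partial>lborel) = (\<integral>s. (\<integral>\<omega>. F \<omega> s \<partial>lborel) \<partial>lborel)"
    unfolding inner_int using zi by (rule integral_inner_right[symmetric])
  also have "\<dots> = (\<integral>\<omega>. (\<integral>s. F \<omega> s \<partial>lborel) \<partial>lborel)"
    by (rule lborel_pair.Fubini_integral[OF Fi])
  also have "\<dots> = (\<integral>\<omega>. tri (\<omega> / R) * inner (cscale J (cis (\<omega> * t)) x) (ft z \<omega>) \<partial>lborel)"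
    unfolding F_def ft_def by (simp add: integral_inner_right ft_integrable[OF z])
  finally show ?thesis .
qed

text \<open>Integrating the representation with test vector \<open>w t\<close> over t. Keeping the
  triangular weight avoids any L2 theory of the transform.\<close>

lemma parseval_fejer:
  assumes w: "integrable lborel w" and z: "integrable lborel z" and R: "R > 0"
  shows "(\<integral>\<omega>. tri (\<omega> / R) * inner (ft w \<omega>) (ft z \<omega>) \<partial>lborel)
    = (\<integral>t. inner (w t) (\<integral>q. fejer q *\<^sub>R z (t - q / R) \<partial>lborel) \<partial>lborel)"
proof -
  have [measurable]: "w \<in> borel_measurable borel" "z \<in> borel_measurable borel" using w z by auto
  define F where "F \<omega> t = tri (\<omega> / R) * inner (cscale J (cis (\<omega> * t)) (w t)) (ft z \<omega>)" for \<omega> t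
  have Fi: "integrable (lborel \<Otimes>\<^sub>M lborel) (case_prod F)"
  proof (rule integrable_product_bound)
    show "case_prod F \<in> borel_measurable (lborel \<Otimes>\<^sub>M lborel)" unfolding F_def by measurable
    show "integrable lborel (\<lambda>\<omega>. tri (\<omega> / R))" by (rule tri_scaled_integrable[OF R])
    show "integrable lborel (\<lambda>t. norm (w t) * (\<integral>t. norm (z t) \<partial>lborel))" using w by auto
    fix \<omega> t
    have "\<bar>inner (cscale J (cis (\<omega> * t)) (w t)) (ft z \<omega>)\<bar> \<le> norm (w t) * norm (ft z \<omega>)"
      using Cauchy_Schwarz_ineq2[of "cscale J (cis (\<omega> * t)) (w t)"] by simp
    also have "\<dots> \<le> norm (w t) * (\<integral>t. norm (z t) \<partial>lborel)"
      by (intro mult_left_mono ft_bound z) auto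
    finally show "norm (F \<omega> t) \<le> tri (\<omega> / R) * (norm (w t) * (\<integral>t. norm (z t) \<partial>lborel))"
      unfolding F_def by (simp add: abs_mult tri_nonneg mult_left_mono)
  qed
  have "(\<integral>t. inner (w t) (\<integral>q. fejer q *\<^sub>R z (t - q / R) \<partial>lborel) \<partial>lborel) = (\<integral>t. (\<integral>\<omega>. F \<omega> t \<partial>lborel) \<partial>lborel)"
    unfolding F_def fejer_subst[OF R, symmetric] by (simp only: fejer_representation[OF z R])
  also have "\<dots> = (\<integral>\<omega>. (\<integral>t. F \<omega> t \<partial>lborel) \<partial>lborel)"
    by (rule lborel_pair.Fubini_integral[OF Fi])
  also have "\<dots> = (\<integral>\<omega>. tri (\<omega> / R) * inner (ft w \<omega>) (ft z \<omega>) \<partial>lborel)"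
    unfolding F_def ft_def[of w] by (simp add: integral_inner_left ft_integrable[OF w])
  finally show ?thesis by simp
qed

text \<open>As the triangle widens, the Fejer means converge at every continuity point of
  \<open>z\<close>. Almost everywhere continuity is assumed because truncations to [0,T] jump at the
  end points.\<close>

lemma parseval_limit:
  assumes w: "integrable lborel w" and z: "integrable lborel z"
    and B: "\<And>t. norm (z t) \<le> B" and c: "AE t in lborel. isCont z t"
  shows "(\<lambda>n. \<integral>\<omega>. tri (\<omega> / real (Suc n)) * inner (ft w \<omega>) (ft z \<omega>) \<partial>lborel)
     \<longlonglongrightarrow> fejer_mass * (\<integral>t. inner (w t) (z t) \<partial>lborel)"
proof -
  have [measurable]: "w \<in> borel_measurable borel" "z \<in> borel_measurable borel" using w z by auto
  have "(\<lambda>n. \<integral>t. inner (w t) (\<integral>q. fejer q *\<^sub>R z (t - q / real (Suc n)) \<partial>lborel) \<partial>lborel)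
     \<longlonglongrightarrow> (\<integral>t. inner (w t) (fejer_mass *\<^sub>R z t) \<partial>lborel)"
  proof (rule integral_dominated_convergence[where w="\<lambda>t. norm (w t) * (fejer_mass * B)"])
    show "AE t in lborel. (\<lambda>n. inner (w t) (\<integral>q. fejer q *\<^sub>R z (t - q / real (Suc n)) \<partial>lborel)) \<longlonglongrightarrow> inner (w t) (fejer_mass *\<^sub>R z t)"
      using c
    proof eventually_elim
      case (elim t)
      show ?case unfolding fejer_mass_def
        by (intro tendsto_intros approx_identity[OF fejer_integrable _ B elim]) simp
    qed
    show "AE t in lborel. norm (inner (w t) (\<integral>q. fejer q *\<^sub>R z (t - q / real (Suc n)) \<partial>lborel)) \<le> norm (w t) * (fejer_mass * B)" for n
    proof (rule AE_I2)
      fix t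
      have "norm (\<integral>q. fejer q *\<^sub>R z (t - q / real (Suc n)) \<partial>lborel) \<le> (\<integral>q. fejer q * B \<partial>lborel)"
        by (rule norm_integral_le)
           (use fejer_integrable B in \<open>auto simp: fejer_nonneg intro!: mult_left_mono\<close>)
      also have "\<dots> = fejer_mass * B" by (simp add: fejer_mass_def)
      finally have "norm (w t) * norm (\<integral>q. fejer q *\<^sub>R z (t - q / real (Suc n)) \<partial>lborel) \<le> norm (w t) * (fejer_mass * B)"
        by (intro mult_left_mono) auto
      then show "norm (inner (w t) (\<integral>q. fejer q *\<^sub>R z (t - q / real (Suc n)) \<partial>lborel)) \<le> norm (w t) * (fejer_mass * B)"
        using Cauchy_Schwarz_ineq2 order_trans by (metis real_norm_def)
    qed
  qed (use w in auto)
  moreover have "(\<integral>\<omega>. tri (\<omega> / real (Suc n)) * inner (ft w \<omega>) (ft z \<omega>) \<partial>lborel)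
     = (\<integral>t. inner (w t) (\<integral>q. fejer q *\<^sub>R z (t - q / real (Suc n)) \<partial>lborel) \<partial>lborel)" for n
    by (rule parseval_fejer[OF w z]) simp
  ultimately show ?thesis by simp
qed

text \<open>Transfers passivity from frequency to time: \<open>w\<close> will be a damped truncated
  solution and \<open>z\<close> the friction force it causes.\<close>

lemma ft_positive:
  assumes w: "integrable lborel w" and z: "integrable lborel z"
    and B: "\<And>t. norm (z t) \<le> B" and c: "AE t in lborel. isCont z t"
    and pos: "\<And>\<omega>. inner (ft w \<omega>) (ft z \<omega>) \<ge> 0"
  shows "(\<integral>t. inner (w t) (z t) \<partial>lborel) \<ge> 0"
proof -
  have "fejer_mass * (\<integral>t. inner (w t) (z t) \<partial>lborel) \<ge> 0"
    by (rule LIMSEQ_le_const[OF parseval_limit[OF w z B c]])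
       (auto intro!: Bochner_Integration.integral_nonneg mult_nonneg_nonneg pos tri_nonneg simp del: of_nat_Suc)
  then show ?thesis using fejer_mass_pos by (simp add: zero_le_mult_iff)
qed

text \<open>Parseval for \<open>z\<close> with itself makes the integral of |z|^2 vanish. The set
  where \<open>z\<close> is nonzero is then open and null, hence empty.\<close>

lemma ft_unique:
  assumes z: "integrable lborel z" and B: "\<And>t. norm (z t) \<le> B" and c: "\<And>t. isCont z t"
    and ft0: "\<And>\<omega>. ft z \<omega> = 0"
  shows "z t = 0"
proof -
  have [measurable]: "z \<in> borel_measurable borel" using z by auto
  have i: "integrable lborel (\<lambda>t. inner (z t) (z t))"
  proof (rule Bochner_Integration.integrable_bound[where f="\<lambda>t. norm (z t) * B"])
    show "AE t in lborel. norm (inner (z t) (z t)) \<le> norm (norm (z t) * B)"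
      using B by (auto simp: dot_square_norm power2_eq_square abs_mult intro!: mult_left_mono AE_I2 order_trans[OF B abs_ge_self])
  qed (use z in auto)
  have "(\<integral>t. inner (z t) (z t) \<partial>lborel) = 0"
    using parseval_limit[OF z z B] c ft0 fejer_mass_pos by (simp add: LIMSEQ_const_iff)
  then have "AE t in lborel. z t = 0"
    using i by (subst (asm) integral_nonneg_eq_0_iff_AE) auto
  then have "emeasure lborel {t. z t \<noteq> 0} = 0"
    by (subst (asm) AE_iff_measurable[of "{t. z t \<noteq> 0}"]) auto
  moreover have "open {t. z t \<noteq> 0}"
    using c by (intro open_Collect_neq continuous_intros) (auto simp: continuous_on_eq_continuous_at)
  moreover from calculation have "negligible {t. z t \<noteq> 0}"
    by (simp add: negligible_iff_emeasure0 emeasure_completion)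
  ultimately have "{t. z t \<noteq> 0} = {}"
    using open_not_negligible by blast
  then show ?thesis by auto
qed

end

section \<open>Convolution with operator-valued kernels\<close>

definition conv :: "(real \<Rightarrow> 'a \<Rightarrow> 'a) \<Rightarrow> (real \<Rightarrow> 'a) \<Rightarrow> real \<Rightarrow> 'a::{banach, second_countable_topology}" where
  "conv k w t = (\<integral>s. k (t - s) (w s) \<partial>lborel)"

text \<open>The scalar majorant plays two roles: its bound \<open>M\<close> gives bounded continuous
  convolutions with L1 functions, its integrability gives L1 estimates. Continuity is not asked for
  at 0, where causal kernels jump.\<close>

locale conv_kernel = complex_hilbert J for J :: "'h::{real_inner, banach, second_countable_topology} \<Rightarrow> 'h" +
  fixes k :: "real \<Rightarrow> 'h \<Rightarrow> 'h" and \<kappa> :: "real \<Rightarrow> real" and M :: real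
  assumes km: "case_prod k \<in> borel_measurable (borel \<Otimes>\<^sub>M borel)"
    and kl: "\<And>r. bounded_linear (k r)"
    and kJ: "\<And>r x. k r (J x) = J (k r x)"
    and kb: "\<And>r x. norm (k r x) \<le> \<kappa> r * norm x"
    and kM: "\<And>r. 0 \<le> \<kappa> r" "\<And>r. \<kappa> r \<le> M"
    and ki: "integrable lborel \<kappa>"
    and kc: "\<And>r x. r \<noteq> 0 \<Longrightarrow> isCont (\<lambda>r. k r x) r"
begin

lemma k_measurable [measurable (raw)]:
  assumes [measurable]: "f \<in> borel_measurable N" "g \<in> borel_measurable N"
  shows "(\<lambda>x. k (f x) (g x)) \<in> borel_measurable N"
proof -
  have "(\<lambda>x. (f x, g x)) \<in> N \<rightarrow>\<^sub>M borel \<Otimes>\<^sub>M borel" by measurable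
  from measurable_compose[OF this km] show ?thesis by simp
qed

lemma k_bound_M: "norm (k r x) \<le> M * norm x"
  using kb[of r x] kM(2)[of r] by (meson mult_right_mono norm_ge_zero order_trans)

lemma k_cscale: "k r (cscale J c x) = cscale J c (k r x)"
proof -
  interpret bounded_linear "k r" by (rule kl)
  show ?thesis by (simp add: cscale_def add scaleR kJ)
qed

context
  fixes w :: "real \<Rightarrow> 'h"
  assumes w: "integrable lborel w"
begin

lemma w_measurable [measurable]: "w \<in> borel_measurable borel"
  using w by auto

lemma conv_integrand: "integrable lborel (\<lambda>s. k (t - s) (w s))"
  by (rule Bochner_Integration.integrable_bound[where f="\<lambda>s. M * norm (w s)"])
     (use w in \<open>auto intro!: AE_I2 order_trans[OF k_bound_M]\<close>)

lemma conv_bound: "norm (conv k w t) \<le> M * (\<integral>s. norm (w s) \<partial>lborel)"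
proof -
  have "norm (conv k w t) \<le> (\<integral>s. M * norm (w s) \<partial>lborel)"
    unfolding conv_def by (rule norm_integral_le) (use w k_bound_M in auto)
  then show ?thesis by simp
qed

text \<open>Dominated convergence; the jump of the kernel is met only at s = t, a null set.\<close>

lemma conv_isCont: "isCont (conv k w) t"
  unfolding continuous_at_sequentially
proof (intro allI impI)
  fix X :: "nat \<Rightarrow> real" assume X: "X \<longlonglongrightarrow> t"
  have "(\<lambda>n. \<integral>s. k (X n - s) (w s) \<partial>lborel) \<longlonglongrightarrow> (\<integral>s. k (t - s) (w s) \<partial>lborel)"
  proof (rule integral_dominated_convergence[where w="\<lambda>s. M * norm (w s)"])
    show "AE s in lborel. (\<lambda>n. k (X n - s) (w s)) \<longlonglongrightarrow> k (t - s) (w s)"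
      using AE_lborel_singleton[of t]
    proof eventually_elim
      case (elim s)
      have "(\<lambda>n. X n - s) \<longlonglongrightarrow> t - s" by (intro tendsto_intros X)
      then show ?case using kc[of "t - s" "w s"] elim by (intro isCont_tendsto_compose[of "t - s" "\<lambda>r. k r (w s)"]) auto
    qed
  qed (use w k_bound_M in auto)
  then show "(conv k w \<circ> X) \<longlonglongrightarrow> conv k w t" by (simp add: conv_def o_def)
qed

lemma conv_pair_integrable: "integrable (lborel \<Otimes>\<^sub>M lborel) (\<lambda>(s, t). k (t - s) (w s))"
proof (rule lborel_pair.Fubini_integrable)
  have i1: "integrable lborel (\<lambda>t. \<kappa> (t - s))" for s by (rule lborel_translate(2)[OF ki])
  have i: "integrable lborel (\<lambda>t. k (t - s) (w s))" for s
    by (rule Bochner_Integration.integrable_bound[where f="\<lambda>t. \<kappa> (t - s) * norm (w s)"])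
      (use i1 kb in \<open>auto intro!: AE_I2 order_trans[OF kb]\<close>)
  then show "AE x in lborel. integrable lborel (\<lambda>y. case (x, y) of (s, t) \<Rightarrow> k (t - s) (w s))" by simp
  have "integrable lborel (\<lambda>s. \<integral>t. norm (k (t - s) (w s)) \<partial>lborel)"
  proof (rule Bochner_Integration.integrable_bound[where f="\<lambda>s. (\<integral>t. \<kappa> t \<partial>lborel) * norm (w s)"])
    show "AE s in lborel. norm (\<integral>t. norm (k (t - s) (w s)) \<partial>lborel) \<le> norm ((\<integral>t. \<kappa> t \<partial>lborel) * norm (w s))"
    proof (rule AE_I2)
      fix s
      have "norm (\<integral>t. norm (k (t - s) (w s)) \<partial>lborel) \<le> (\<integral>t. \<kappa> (t - s) * norm (w s) \<partial>lborel)"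
        by (rule norm_integral_le) (use i1 kb in auto)
      also have "\<dots> = (\<integral>t. \<kappa> t \<partial>lborel) * norm (w s)" by (simp add: lborel_translate(1))
      finally show "norm (\<integral>t. norm (k (t - s) (w s)) \<partial>lborel) \<le> norm ((\<integral>t. \<kappa> t \<partial>lborel) * norm (w s))" by simp
    qed
  qed (use w in auto)
  then show "integrable lborel (\<lambda>x. \<integral>y. norm (case (x, y) of (s, t) \<Rightarrow> k (t - s) (w s)) \<partial>lborel)" by simp
qed measurable

lemma conv_integrable: "integrable lborel (conv k w)"
  using lborel_pair.integrable_snd[OF conv_pair_integrable] by (simp add: conv_def[abs_def])

text \<open>Young's inequality. Fubini also supplies, for almost every t, the integrability of the
  majorant that the pointwise bound relies on.\<close>

lemma conv_L1_bound: "(\<integral>t. norm (conv k w t) \<partial>lborel) \<le> (\<integral>r. \<kappa> r \<partial>lborel) * (\<integral>s. norm (w s) \<partial>lborel)"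
proof -
  have i: "integrable (lborel \<Otimes>\<^sub>M lborel) (\<lambda>(s, t). \<kappa> (t - s) * norm (w s))"
  proof (rule lborel_pair.Fubini_integrable)
    have "integrable lborel (\<lambda>t. \<kappa> (t - s) * norm (w s))" for s
      using lborel_translate(2)[OF ki] by simp
    then show "AE x in lborel. integrable lborel (\<lambda>y. case (x, y) of (s, t) \<Rightarrow> \<kappa> (t - s) * norm (w s))" by simp
    have [measurable]: "\<kappa> \<in> borel_measurable borel" using ki by auto
    show "(\<lambda>(s, t). \<kappa> (t - s) * norm (w s)) \<in> borel_measurable (lborel \<Otimes>\<^sub>M lborel)" by measurable
    have "(\<integral>t. norm (\<kappa> (t - s) * norm (w s)) \<partial>lborel) = (\<integral>r. \<kappa> r \<partial>lborel) * norm (w s)" for s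
      using lborel_translate(1)[of \<kappa> s] kM(1) by (simp add: abs_mult)
    then show "integrable lborel (\<lambda>x. \<integral>y. norm (case (x, y) of (s, t) \<Rightarrow> \<kappa> (t - s) * norm (w s)) \<partial>lborel)"
      using w by simp
  qed
  have "(\<integral>t. norm (conv k w t) \<partial>lborel) \<le> (\<integral>t. (\<integral>s. \<kappa> (t - s) * norm (w s) \<partial>lborel) \<partial>lborel)"
  proof (rule integral_mono_AE)
    show "integrable lborel (\<lambda>t. norm (conv k w t))" using conv_integrable by simp
    show "integrable lborel (\<lambda>t. \<integral>s. \<kappa> (t - s) * norm (w s) \<partial>lborel)"
      by (rule lborel_pair.integrable_snd[OF i])
    show "AE t in lborel. norm (conv k w t) \<le> (\<integral>s. \<kappa> (t - s) * norm (w s) \<partial>lborel)"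
      using lborel_pair.AE_integrable_snd[OF i]
    proof eventually_elim
      case (elim t)
      show ?case unfolding conv_def by (rule norm_integral_le[OF elim]) (rule kb)
    qed
  qed
  also have "\<dots> = (\<integral>s. (\<integral>t. \<kappa> (t - s) * norm (w s) \<partial>lborel) \<partial>lborel)"
    by (rule lborel_pair.Fubini_integral[OF i])
  also have "\<dots> = (\<integral>r. \<kappa> r \<partial>lborel) * (\<integral>s. norm (w s) \<partial>lborel)"
    by (simp add: lborel_translate(1))
  finally show ?thesis .
qed

text \<open>Convolution theorem for operator kernels: substitute t = r + s, split the phase, and
  pull the factor in s through \<open>k r\<close>, which commutes with \<open>J\<close>. Fubini is
  used once before and once after the substitution, with different majorants.\<close>

lemma ft_conv: "ft (conv k w) \<omega> = (\<integral>r. cscale J (cis (\<omega> * r)) (k r (ft w \<omega>)) \<partial>lborel)"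
proof -
  have i1: "integrable (lborel \<Otimes>\<^sub>M lborel) (\<lambda>(s, t). cscale J (cis (\<omega> * t)) (k (t - s) (w s)))"
    by (rule Bochner_Integration.integrable_bound[OF conv_pair_integrable]) (measurable, auto)
  have i2: "integrable (lborel \<Otimes>\<^sub>M lborel) (\<lambda>(r, s). cscale J (cis (\<omega> * r)) (k r (cscale J (cis (\<omega> * s)) (w s))))"
    by (rule integrable_product_bound[where a=\<kappa> and b="\<lambda>s. norm (w s)"])
       (use ki w in \<open>auto intro: order_trans[OF kb]\<close>)
  have "ft (conv k w) \<omega> = (\<integral>t. (\<integral>s. cscale J (cis (\<omega> * t)) (k (t - s) (w s)) \<partial>lborel) \<partial>lborel)"
    unfolding ft_def conv_def
    by (simp add: integral_bounded_linear[OF cscale.bounded_linear_right conv_integrand])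
  also have "\<dots> = (\<integral>s. (\<integral>t. cscale J (cis (\<omega> * t)) (k (t - s) (w s)) \<partial>lborel) \<partial>lborel)"
    by (rule lborel_pair.Fubini_integral[OF i1])
  also have "\<dots> = (\<integral>s. (\<integral>r. cscale J (cis (\<omega> * r)) (k r (cscale J (cis (\<omega> * s)) (w s))) \<partial>lborel) \<partial>lborel)"
  proof (rule Bochner_Integration.integral_cong[OF refl])
    fix s
    have "(\<integral>t. cscale J (cis (\<omega> * t)) (k (t - s) (w s)) \<partial>lborel)
        = (\<integral>t. cscale J (cis (\<omega> * (t - - s))) (k ((t - - s) - s) (w s)) \<partial>lborel)"
      by (rule lborel_translate(1)[symmetric, of _ "-s"])
    then show "(\<integral>t. cscale J (cis (\<omega> * t)) (k (t - s) (w s)) \<partial>lborel)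
        = (\<integral>r. cscale J (cis (\<omega> * r)) (k r (cscale J (cis (\<omega> * s)) (w s))) \<partial>lborel)"
      by (simp add: k_cscale cscale_mult cis_mult algebra_simps)
  qed
  also have "\<dots> = (\<integral>r. (\<integral>s. cscale J (cis (\<omega> * r)) (k r (cscale J (cis (\<omega> * s)) (w s))) \<partial>lborel) \<partial>lborel)"
    by (rule lborel_pair.Fubini_integral[OF i2])
  also have "\<dots> = (\<integral>r. cscale J (cis (\<omega> * r)) (k r (ft w \<omega>)) \<partial>lborel)"
  proof (rule Bochner_Integration.integral_cong[OF refl])
    fix r
    have "bounded_linear (\<lambda>x. cscale J (cis (\<omega> * r)) (k r x))"
      by (rule bounded_linear_compose[OF cscale.bounded_linear_right kl])
    from integral_bounded_linear[OF this ft_integrable[OF w]]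
    show "(\<integral>s. cscale J (cis (\<omega> * r)) (k r (cscale J (cis (\<omega> * s)) (w s))) \<partial>lborel) = cscale J (cis (\<omega> * r)) (k r (ft w \<omega>))"
      by (simp add: ft_def)
  qed
  finally show ?thesis .
qed

end

end

text \<open>Differentiation under the integral: for s \<noteq> t the function max 0 (t - s) is
  differentiable in t with derivative the indicator of s \<le> t, and the kink at s = t is a null
  set. Hence \<open>v\<close> need not be continuous.\<close>

lemma ramp_has_vector_derivative:
  fixes v :: "real \<Rightarrow> 'a::{banach, second_countable_topology}"
  assumes vm [measurable]: "v \<in> borel_measurable borel"
    and v: "\<And>T. integrable lborel (\<lambda>s. indicat_real {0..T} s *\<^sub>R v s)" and v0: "\<And>s. s < 0 \<Longrightarrow> v s = 0"
  shows "((\<lambda>t. \<integral>s. max 0 (t - s) *\<^sub>R v s \<partial>lborel) has_vector_derivative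
           (\<integral>s. indicat_real {..t} s *\<^sub>R v s \<partial>lborel)) (at t)"
proof -
  have bd: "integrable lborel (\<lambda>s. g s *\<^sub>R v s)"
    if "g \<in> borel_measurable borel" "\<And>s. 0 \<le> s \<Longrightarrow> s \<le> T \<Longrightarrow> \<bar>g s\<bar> \<le> B" "\<And>s. s > T \<Longrightarrow> g s = 0" for g :: "real \<Rightarrow> real" and T B
  proof (rule Bochner_Integration.integrable_bound[where f="\<lambda>s. B * norm (indicat_real {0..T} s *\<^sub>R v s)"])
    show "AE s in lborel. norm (g s *\<^sub>R v s) \<le> norm (B * norm (indicat_real {0..T} s *\<^sub>R v s))"
      using that(2,3) v0 by (intro AE_I2) (force simp: indicator_def abs_mult intro!: mult_right_mono)
    show "(\<lambda>s. g s *\<^sub>R v s) \<in> borel_measurable lborel" using vm that by simp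
  qed (intro integrable_mult_right integrable_norm v)
  have iV: "integrable lborel (\<lambda>s. indicat_real {..t} s *\<^sub>R v s)" for t
    by (rule bd[where B=1 and T=t]) (auto simp: indicator_def)
  have iW: "integrable lborel (\<lambda>s. max 0 (t - s) *\<^sub>R v s)" for t
    by (rule bd[where B="\<bar>t\<bar>" and T=t]) auto
  show ?thesis
    unfolding has_vector_derivative_def has_derivative_at tendsto_at_iff_sequentially
  proof (intro conjI allI impI)
    show "bounded_linear (\<lambda>h. h *\<^sub>R (\<integral>s. indicat_real {..t} s *\<^sub>R v s \<partial>lborel))"
      by (rule bounded_linear_scaleR_left)
    fix X :: "nat \<Rightarrow> real" assume Xn: "\<forall>i. X i \<in> UNIV - {0}" and X: "X \<longlonglongrightarrow> 0"
    \<comment> \<open>Error of the difference quotient of the ramp: bounded by 2, and equal to 0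
      once |h| < |t - s|.\<close>
    define Q where "Q h s = (max 0 (t + h - s) - max 0 (t - s) - h * indicat_real {..t} s) / h" for h s
    have Qb: "\<bar>Q h s\<bar> \<le> 2" for h s
    proof (cases "h = 0")
      case False
      have "\<bar>max 0 (t + h - s) - max 0 (t - s) - h * indicat_real {..t} s\<bar> \<le> 2 * \<bar>h\<bar>"
        by (auto simp: indicator_def abs_if max_def)
      then show ?thesis using False by (simp add: Q_def field_simps)
    qed (simp add: Q_def)
    have eq: "(\<integral>s. max 0 (t + h - s) *\<^sub>R v s \<partial>lborel) - (\<integral>s. max 0 (t - s) *\<^sub>R v s \<partial>lborel)
        - h *\<^sub>R (\<integral>s. indicat_real {..t} s *\<^sub>R v s \<partial>lborel) = h *\<^sub>R (\<integral>s. Q h s *\<^sub>R v s \<partial>lborel)" if "h \<noteq> 0" for h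
    proof -
      have "(\<integral>s. max 0 (t + h - s) *\<^sub>R v s \<partial>lborel) - (\<integral>s. max 0 (t - s) *\<^sub>R v s \<partial>lborel)
        - h *\<^sub>R (\<integral>s. indicat_real {..t} s *\<^sub>R v s \<partial>lborel)
        = (\<integral>s. max 0 (t + h - s) *\<^sub>R v s - max 0 (t - s) *\<^sub>R v s - h *\<^sub>R (indicat_real {..t} s *\<^sub>R v s) \<partial>lborel)"
        using iW iV by (simp del: scaleR_scaleR)
      also have "\<dots> = (\<integral>s. h *\<^sub>R (Q h s *\<^sub>R v s) \<partial>lborel)"
        using that by (simp add: Q_def scaleR_diff_left)
      finally show ?thesis by (simp only: integral_scaleR_right)
    qed
    \<comment> \<open>Dropping the first N terms keeps the increments below 1, so all integrands are
      supported in [0,t+1] and have a common majorant.\<close>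
    have "eventually (\<lambda>n. \<bar>X n\<bar> < 1) sequentially"
      using X tendsto_rabs_zero[OF X] by (auto intro: order_tendstoD(2))
    then obtain N where N: "\<And>n. n \<ge> N \<Longrightarrow> \<bar>X n\<bar> < 1" by (auto simp: eventually_sequentially)
    have "(\<lambda>n. \<integral>s. Q (X (n + N)) s *\<^sub>R v s \<partial>lborel) \<longlonglongrightarrow> (\<integral>s. 0 \<partial>(lborel::real measure))"
    proof (rule integral_dominated_convergence[where w="\<lambda>s. 2 * norm (indicat_real {0..t+1} s *\<^sub>R v s)"])
      show "AE s in lborel. (\<lambda>n. Q (X (n + N)) s *\<^sub>R v s) \<longlonglongrightarrow> 0"
        using AE_lborel_singleton[of t]
      proof eventually_elim
        case (elim s)
        have "eventually (\<lambda>n. \<bar>X n\<bar> < \<bar>t - s\<bar>) sequentially"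
          using elim tendsto_rabs_zero[OF X] by (intro order_tendstoD(2)) auto
        then have "eventually (\<lambda>n. Q (X n) s = 0) sequentially"
          by eventually_elim (auto simp: Q_def indicator_def max_def)
        then have "eventually (\<lambda>n. Q (X n) s *\<^sub>R v s = 0) sequentially"
          by eventually_elim simp
        then show ?case by (intro LIMSEQ_ignore_initial_segment tendsto_eventually)
      qed
      show "AE s in lborel. norm (Q (X (n + N)) s *\<^sub>R v s) \<le> 2 * norm (indicat_real {0..t+1} s *\<^sub>R v s)" for n
      proof (rule AE_I2)
        fix s
        show "norm (Q (X (n + N)) s *\<^sub>R v s) \<le> 2 * norm (indicat_real {0..t+1} s *\<^sub>R v s)"
        proof (cases "s \<in> {0..t+1}")
          case True
          then show ?thesis using Qb by (auto intro!: mult_right_mono)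
        next
          case False
          then have "s < 0 \<or> s > t + 1" by auto
          then have "Q (X (n + N)) s *\<^sub>R v s = 0"
            using v0 N[of "n + N"] by (auto simp: Q_def max_def)
          then show ?thesis by (simp only: norm_zero) simp
        qed
      qed
    next
      show "integrable lborel (\<lambda>s. 2 * norm (indicat_real {0..t + 1} s *\<^sub>R v s))"
        by (intro integrable_mult_right integrable_norm v)
    qed (auto simp: Q_def)
    then have "(\<lambda>n. \<integral>s. Q (X n) s *\<^sub>R v s \<partial>lborel) \<longlonglongrightarrow> 0" using LIMSEQ_offset[where k=N and f="\<lambda>n. \<integral>s. Q (X n) s *\<^sub>R v s \<partial>lborel"] by simp
    then have "(\<lambda>n. norm (\<integral>s. Q (X n) s *\<^sub>R v s \<partial>lborel)) \<longlonglongrightarrow> 0" by (rule tendsto_norm_zero)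
    then show "((\<lambda>h. norm ((\<integral>s. max 0 (t + h - s) *\<^sub>R v s \<partial>lborel) - (\<integral>s. max 0 (t - s) *\<^sub>R v s \<partial>lborel)
        - h *\<^sub>R (\<integral>s. indicat_real {..t} s *\<^sub>R v s \<partial>lborel)) / norm h) \<circ> X) \<longlonglongrightarrow> 0"
      using Xn by (simp add: o_def eq)
  qed
qed

section \<open>Accretive perturbations of a skew-adjoint operator\<close>

text \<open>Projection theorem: a minimising sequence is Cauchy, and the difference between
  \<open>x\<close> and its limit is orthogonal to \<open>S\<close>.\<close>

lemma closed_subspace_orthogonal:
  fixes S :: "'a::{real_inner, banach} set"
  assumes S: "subspace S" "closed S" and x: "x \<notin> S"
  obtains z where "z \<noteq> 0" "\<And>y. y \<in> S \<Longrightarrow> inner z y = 0"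
proof -
  have ne: "S \<noteq> {}" using subspace_0[OF S(1)] by auto
  define d where "d = infdist x S"
  have dle: "d \<le> norm (x - y)" if "y \<in> S" for y
    using infdist_le[OF that, of x] by (simp add: d_def dist_norm)
  have d0: "d \<ge> 0" by (simp add: d_def infdist_nonneg)
  have "\<exists>y\<in>S. norm (x - y) < d + inverse (real (Suc n))" for n
  proof (rule ccontr)
    assume "\<not> (\<exists>y\<in>S. norm (x - y) < d + inverse (real (Suc n)))"
    then have "d + inverse (real (Suc n)) \<le> (INF a\<in>S. dist x a)"
      by (intro cINF_greatest ne) (auto simp: dist_norm not_less simp del: of_nat_Suc)
    also have "\<dots> = d" using ne by (simp add: d_def infdist_def)
    finally show False by simp
  qed
  then obtain Y where YS: "\<And>n. Y n \<in> S" and Yd: "\<And>n. norm (x - Y n) < d + inverse (real (Suc n))"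
    by metis
  define c where "c n = (norm (x - Y n))\<^sup>2 - d\<^sup>2" for n
  have nlim: "(\<lambda>n. norm (x - Y n)) \<longlonglongrightarrow> d"
  proof (rule tendsto_sandwich[of "\<lambda>_. d" _ _ "\<lambda>n. d + inverse (real (Suc n))"])
    show "(\<lambda>n. d + inverse (real (Suc n))) \<longlonglongrightarrow> d"
      using tendsto_add[OF tendsto_const LIMSEQ_inverse_real_of_nat, of d] by simp
  qed (auto intro!: always_eventually dle YS less_imp_le[OF Yd] simp del: of_nat_Suc)
  then have clim: "c \<longlonglongrightarrow> 0"
    unfolding c_def[abs_def] using tendsto_diff[OF tendsto_power[OF nlim, of 2] tendsto_const[of "d\<^sup>2"]] by simp
  \<comment> \<open>Parallelogram identity; the midpoint lies in \<open>S\<close>, so its distance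
    from x is at least d.\<close>
  have par: "(norm (Y m - Y n))\<^sup>2 \<le> 2 * c m + 2 * c n" for m n
  proof -
    have "(1/2) *\<^sub>R (Y m + Y n) \<in> S" by (intro subspace_scale subspace_add S YS)
    from dle[OF this] have "d\<^sup>2 \<le> (norm (x - (1/2) *\<^sub>R (Y m + Y n)))\<^sup>2" using d0 by (intro power_mono) auto
    moreover have "(norm (Y m - Y n))\<^sup>2 = 2 * (norm (x - Y m))\<^sup>2 + 2 * (norm (x - Y n))\<^sup>2 - 4 * (norm (x - (1/2) *\<^sub>R (Y m + Y n)))\<^sup>2"
      by (simp add: power2_norm_eq_inner inner_diff_left inner_diff_right inner_add_left inner_add_right algebra_simps inner_commute)
    ultimately show ?thesis by (simp add: c_def)
  qed
  have "Cauchy Y"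
  proof (rule CauchyI)
    fix e :: real assume e: "e > 0"
    then have "eventually (\<lambda>n. c n < e\<^sup>2 / 4) sequentially" using clim by (intro order_tendstoD(2)) auto
    then obtain N where N: "\<And>n. n \<ge> N \<Longrightarrow> c n < e\<^sup>2 / 4" by (auto simp: eventually_sequentially)
    show "\<exists>M. \<forall>m\<ge>M. \<forall>n\<ge>M. norm (Y m - Y n) < e"
    proof (intro exI[of _ N] allI impI)
      fix m n assume "N \<le> m" "N \<le> n"
      then have "(norm (Y m - Y n))\<^sup>2 < e\<^sup>2" using par[of m n] N[of m] N[of n] by linarith
      then show "norm (Y m - Y n) < e" using e by (simp add: power_less_imp_less_base)
    qed
  qed
  then obtain y where y: "Y \<longlonglongrightarrow> y" using Cauchy_convergent convergent_def by blast
  have yS: "y \<in> S" using closed_sequentially[OF S(2) YS y] .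
  have yd: "norm (x - y) = d"
    by (rule LIMSEQ_unique[OF _ nlim]) (intro tendsto_intros y)
  show ?thesis
  proof (rule that[of "x - y"])
    show "x - y \<noteq> 0" using yS x by auto
    fix w assume w: "w \<in> S"
    show "inner (x - y) w = 0"
    proof (cases "w = 0")
      case False
      \<comment> \<open>The coefficient minimising the distance along the line through
        \<open>y\<close> in direction \<open>w\<close>.\<close>
      define a where "a = inner (x - y) w / inner w w"
      have ww: "inner w w > 0" using False by simp
      have "y + a *\<^sub>R w \<in> S" by (intro subspace_add subspace_scale S yS w)
      then have "d \<le> norm (x - (y + a *\<^sub>R w))" by (rule dle)
      then have "(norm (x - y))\<^sup>2 \<le> (norm ((x - y) - a *\<^sub>R w))\<^sup>2" using yd d0 by (intro power_mono) (auto simp: algebra_simps)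
      also have "\<dots> = (norm (x - y))\<^sup>2 - 2 * a * inner (x - y) w + a * a * inner w w"
        by (simp add: power2_norm_eq_inner inner_diff_left inner_diff_right inner_commute algebra_simps)
      also have "\<dots> = (norm (x - y))\<^sup>2 - (inner (x - y) w)\<^sup>2 / inner w w"
        using ww by (simp add: a_def field_simps power2_eq_square)
      finally have "(inner (x - y) w)\<^sup>2 / inner w w \<le> 0" by simp
      then show ?thesis using ww by (simp add: divide_le_0_iff)
    qed simp
  qed
qed

locale self_adjoint = complex_hilbert J for J :: "'h::{real_inner, banach, second_countable_topology} \<Rightarrow> 'h" +
  fixes D :: "'h set" and A :: "'h \<Rightarrow> 'h"
  assumes self_adjoint: "self_adjoint_op J D A"
begin

lemma subspace_D: "subspace D" and J_D: "x \<in> D \<Longrightarrow> J x \<in> D"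
  and A_add: "x \<in> D \<Longrightarrow> y \<in> D \<Longrightarrow> A (x + y) = A x + A y"
  and A_scaleR: "x \<in> D \<Longrightarrow> A (c *\<^sub>R x) = c *\<^sub>R A x"
  and A_J: "x \<in> D \<Longrightarrow> A (J x) = J (A x)"
  and A_char: "(\<forall>x\<in>D. cinner J (A x) y = cinner J x z) \<longleftrightarrow> (y \<in> D \<and> z = A y)"
  using self_adjoint by (auto simp: self_adjoint_op_def)

lemma A_diff: "x \<in> D \<Longrightarrow> y \<in> D \<Longrightarrow> A (x - y) = A x - A y"
  using A_add[of x "(-1) *\<^sub>R y"] A_scaleR[of y "-1"] subspace_scale[OF subspace_D, of y "-1"] by simp

lemma A_symmetric: "x \<in> D \<Longrightarrow> y \<in> D \<Longrightarrow> inner (A x) y = inner x (A y)"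
  using A_char[of y "A y"] by (auto simp: cinner_def)

text \<open>Maximality with the real inner product alone: testing with \<open>J x\<close> in place
  of \<open>x\<close> recovers the imaginary part.\<close>

lemma A_maximal:
  assumes "\<And>x. x \<in> D \<Longrightarrow> inner (A x) y = inner x z"
  shows "y \<in> D" "A y = z"
proof -
  have "cinner J (A x) y = cinner J x z" if x: "x \<in> D" for x
    using assms[OF x] assms[OF J_D[OF x]] A_J[OF x] by (simp add: cinner_def inner_J_left)
  then have "y \<in> D \<and> z = A y" using A_char[of y z] by blast
  then show "y \<in> D" "A y = z" by auto
qed

text \<open>This makes \<open>A\<close> disappear from every real energy identity.\<close>

lemma A_skew: "y \<in> D \<Longrightarrow> inner y (J (A y)) = 0"
  using A_symmetric[OF J_D, of y y] A_J[of y] inner_J_left[of y "A y"] inner_commute[of "J (A y)" y] by simp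

lemma JA_shift_bound:
  assumes y: "y \<in> D"
  shows "\<bar>l\<bar> * norm y \<le> norm (J (A y) + l *\<^sub>R y)" and "norm (A y) \<le> norm (J (A y) + l *\<^sub>R y)"
proof -
  have "(norm (J (A y) + l *\<^sub>R y))\<^sup>2 = (norm (A y))\<^sup>2 + l * l * (norm y)\<^sup>2"
    using A_skew[OF y] inner_commute[of "J (A y)" y] unfolding power2_norm_eq_inner
    by (simp add: inner_add_left inner_add_right)
  then have "(\<bar>l\<bar> * norm y)\<^sup>2 \<le> (norm (J (A y) + l *\<^sub>R y))\<^sup>2" "(norm (A y))\<^sup>2 \<le> (norm (J (A y) + l *\<^sub>R y))\<^sup>2"
    by (simp_all add: power_mult_distrib flip: power2_eq_square)
  then show "\<bar>l\<bar> * norm y \<le> norm (J (A y) + l *\<^sub>R y)" "norm (A y) \<le> norm (J (A y) + l *\<^sub>R y)"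
    by (auto intro: power2_le_imp_le)
qed

text \<open>The range is closed: by \<open>JA_shift_bound\<close> convergence of images makes both
  the preimages and their images under \<open>A\<close> Cauchy, and \<open>A\<close> is closed by
  \<open>A_maximal\<close>. A vector z orthogonal to the range satisfies A (J z) = l z, and
  \<open>A_skew\<close> at J z then gives l |z|^2 = 0.\<close>

lemma JA_shift_surj:
  assumes l: "l > 0"
  shows "\<exists>y\<in>D. J (A y) + l *\<^sub>R y = x"
proof (rule ccontr)
  assume contra: "\<not> ?thesis"
  define S where "S = (\<lambda>y. J (A y) + l *\<^sub>R y) ` D"
  have sub: "subspace S"
    unfolding subspace_def
  proof (intro conjI ballI allI)
    show "0 \<in> S" unfolding S_def using subspace_0[OF subspace_D] A_scaleR[of 0 0] by (intro image_eqI[of _ _ 0]) auto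
    fix a b assume "a \<in> S" "b \<in> S"
    then obtain y z where "y \<in> D" "z \<in> D" "a = J (A y) + l *\<^sub>R y" "b = J (A z) + l *\<^sub>R z" by (auto simp: S_def)
    then show "a + b \<in> S" unfolding S_def
      by (intro image_eqI[of _ _ "y + z"]) (auto simp: A_add J.add algebra_simps intro: subspace_add[OF subspace_D])
  next
    fix c a assume "a \<in> S"
    then obtain y where "y \<in> D" "a = J (A y) + l *\<^sub>R y" by (auto simp: S_def)
    then show "c *\<^sub>R a \<in> S" unfolding S_def
      by (intro image_eqI[of _ _ "c *\<^sub>R y"]) (auto simp: A_scaleR J.scaleR algebra_simps intro: subspace_scale[OF subspace_D])
  qed
  have "closed S"
  proof (rule closed_sequential_limits[THEN iffD2], intro allI impI, elim conjE)
    fix X a assume X: "\<forall>n. X n \<in> S" "X \<longlonglongrightarrow> a"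
    then obtain Y where YD: "\<And>n. Y n \<in> D" and XY: "\<And>n. X n = J (A (Y n)) + l *\<^sub>R Y n"
    proof -
      have "\<forall>n. \<exists>y. y \<in> D \<and> X n = J (A y) + l *\<^sub>R y" using X(1) by (auto simp: S_def)
      then show ?thesis using that by metis
    qed
    have dXY: "X m - X n = J (A (Y m - Y n)) + l *\<^sub>R (Y m - Y n)" for m n
      by (simp add: XY A_diff YD J.diff algebra_simps)
    have DD: "Y m - Y n \<in> D" for m n by (intro subspace_diff subspace_D YD)
    have CX: "Cauchy X" using X(2) LIMSEQ_imp_Cauchy by blast
    have CY: "Cauchy Y"
    proof (rule CauchyI)
      fix e :: real assume "e > 0"
      then obtain M where M: "\<And>m n. m \<ge> M \<Longrightarrow> n \<ge> M \<Longrightarrow> norm (X m - X n) < l * e"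
        using CauchyD[OF CX, of "l * e"] l by auto
      have "norm (Y m - Y n) < e" if "m \<ge> M" "n \<ge> M" for m n
      proof -
        have "l * norm (Y m - Y n) \<le> norm (X m - X n)"
          using JA_shift_bound(1)[OF DD, of l m n] l by (simp add: dXY)
        also have "\<dots> < l * e" by (rule M[OF that])
        finally show ?thesis using l by simp
      qed
      then show "\<exists>M. \<forall>m\<ge>M. \<forall>n\<ge>M. norm (Y m - Y n) < e" by blast
    qed
    have CA: "Cauchy (\<lambda>n. A (Y n))"
    proof (rule CauchyI)
      fix e :: real assume "e > 0"
      then obtain M where M: "\<And>m n. m \<ge> M \<Longrightarrow> n \<ge> M \<Longrightarrow> norm (X m - X n) < e"
        using CauchyD[OF CX] by blast
      have "norm (A (Y m) - A (Y n)) < e" if "m \<ge> M" "n \<ge> M" for m n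
        using JA_shift_bound(2)[OF DD, of m n l] M[OF that] by (simp add: dXY A_diff YD)
      then show "\<exists>M. \<forall>m\<ge>M. \<forall>n\<ge>M. norm (A (Y m) - A (Y n)) < e" by blast
    qed
    obtain y b where y: "Y \<longlonglongrightarrow> y" and b: "(\<lambda>n. A (Y n)) \<longlonglongrightarrow> b"
      using CY CA Cauchy_convergent convergent_def by metis
    have "inner (A x) y = inner x b" if x: "x \<in> D" for x
    proof (rule LIMSEQ_unique)
      show "(\<lambda>n. inner (A x) (Y n)) \<longlonglongrightarrow> inner (A x) y" by (intro tendsto_intros y)
      show "(\<lambda>n. inner (A x) (Y n)) \<longlonglongrightarrow> inner x b"
        unfolding A_symmetric[OF x YD] by (intro tendsto_intros b)
    qed
    then have yD: "y \<in> D" "A y = b" using A_maximal by blast+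
    have "X \<longlonglongrightarrow> J b + l *\<^sub>R y" unfolding XY[abs_def] by (intro tendsto_intros J.tendsto b y)
    then have "a = J b + l *\<^sub>R y" using X(2) LIMSEQ_unique by blast
    then show "a \<in> S" using yD by (auto simp: S_def)
  qed
  moreover have "x \<notin> S" using contra by (auto simp: S_def)
  ultimately obtain z where z: "z \<noteq> 0" "\<And>y. y \<in> S \<Longrightarrow> inner z y = 0"
    using closed_subspace_orthogonal[OF sub] by blast
  have "inner (A y) (J z) = inner y (l *\<^sub>R z)" if "y \<in> D" for y
  proof -
    have "inner z (J (A y) + l *\<^sub>R y) = 0" using that by (intro z(2)) (auto simp: S_def)
    then show ?thesis
      using inner_commute[of z "J (A y)"] inner_J_left[of "A y" z] inner_commute[of z y] by (simp add: inner_add_right)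
  qed
  then have "J z \<in> D" "A (J z) = l *\<^sub>R z" using A_maximal by blast+
  then have "inner (J z) (J (l *\<^sub>R z)) = 0" using A_skew[of "J z"] by simp
  then show False using l z(1) by simp
qed

lemma JA_plus_bound:
  assumes c: "c > 0" "inner y (K y) \<ge> c * (norm y)\<^sup>2" and y: "y \<in> D"
  shows "c * norm y \<le> norm (J (A y) + K y)"
proof (cases "y = 0")
  case False
  have "c * (norm y)\<^sup>2 \<le> inner y (J (A y) + K y)"
    using c A_skew[OF y] by (simp add: inner_add_right)
  also have "\<dots> \<le> norm y * norm (J (A y) + K y)" by (rule norm_cauchy_schwarz)
  finally have "norm y * (c * norm y) \<le> norm y * norm (J (A y) + K y)" by (simp add: power2_eq_square mult_ac)
  then show ?thesis using False by simp
qed simp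

text \<open>With S the inverse of JA + l, the equation becomes the fixed point problem y = S (x - (K
  y - l y)). S has norm at most 1 / l, and for a suitable l the difference K - l has norm at most q
  l with q < 1, so Banach's theorem applies.\<close>

lemma JA_plus_ex1:
  assumes K: "bounded_linear K" and c: "c > 0" "\<And>y. inner y (K y) \<ge> c * (norm y)\<^sup>2"
  shows "\<exists>!y. y \<in> D \<and> J (A y) + K y = x"
proof -
  interpret K: bounded_linear K by fact
  obtain C0 where C0: "\<And>y. norm (K y) \<le> norm y * C0" using K.bounded by blast
  \<comment> \<open>The maximum ensures c \<le> C, so that the square root defining \<open>q\<close>
    is real and less than 1.\<close>
  define C where "C = max c C0"
  have C: "norm (K y) \<le> C * norm y" and Cc: "C \<ge> c" for y
    using C0[of y] mult_left_mono[of C0 C "norm y"] by (auto simp: C_def mult.commute)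
  have C0': "C > 0" using Cc c by simp
  \<comment> \<open>This l minimises (C^2 - 2 l c + l^2) / l^2, the bound for the squared
    contraction factor; the minimum is 1 - c^2 / C^2.\<close>
  define l where "l = C\<^sup>2 / c"
  have l: "l > 0" using C0' c by (simp add: l_def)
  define q where "q = sqrt (1 - c\<^sup>2 / C\<^sup>2)"
  have cC: "c\<^sup>2 / C\<^sup>2 \<le> 1" "c\<^sup>2 / C\<^sup>2 > 0" using Cc C0' c by (auto simp: power_mono)
  have q: "0 \<le> q" "q < 1" using cC by (auto simp: q_def)
  have q2: "q\<^sup>2 = 1 - c\<^sup>2 / C\<^sup>2" using cC by (simp add: q_def)
  have Kl: "norm (K y - l *\<^sub>R y) \<le> q * l * norm y" for y
  proof (rule power2_le_imp_le)
    have "(norm (K y - l *\<^sub>R y))\<^sup>2 = (norm (K y))\<^sup>2 - 2 * l * inner y (K y) + l * l * (norm y)\<^sup>2"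
      using inner_commute[of "K y" y] unfolding power2_norm_eq_inner
      by (simp add: inner_diff_left inner_diff_right algebra_simps)
    also have "\<dots> \<le> C\<^sup>2 * (norm y)\<^sup>2 - 2 * l * (c * (norm y)\<^sup>2) + l * l * (norm y)\<^sup>2"
    proof -
      have "2 * l * (c * (norm y)\<^sup>2) \<le> 2 * l * inner y (K y)" using l c by (intro mult_left_mono) auto
      moreover have "(norm (K y))\<^sup>2 \<le> C\<^sup>2 * (norm y)\<^sup>2" using power_mono[OF C[of y], of 2] by (simp add: power_mult_distrib)
      ultimately show ?thesis by linarith
    qed
    also have "\<dots> = (q * l * norm y)\<^sup>2"
      using c C0' by (simp add: power_mult_distrib q2) (simp add: l_def field_simps power2_eq_square)
    finally show "(norm (K y - l *\<^sub>R y))\<^sup>2 \<le> (q * l * norm y)\<^sup>2" .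
  qed (use q l in auto)
  obtain S where SD: "\<And>x. S x \<in> D" and S: "\<And>x. J (A (S x)) + l *\<^sub>R S x = x"
    using JA_shift_surj[OF l] by metis
  have Sd: "l * norm (S a - S b) \<le> norm (a - b)" for a b
  proof -
    have "S a - S b \<in> D" by (intro subspace_diff subspace_D SD)
    from JA_shift_bound(1)[OF this, of l] show ?thesis
      using l S[of a] S[of b] by (simp add: A_diff SD J.diff algebra_simps)
  qed
  have "\<exists>!y. S (x - (K y - l *\<^sub>R y)) = y"
  proof (rule banach_fix_type[OF q], intro allI)
    fix y z
    have "l * norm (S (x - (K y - l *\<^sub>R y)) - S (x - (K z - l *\<^sub>R z))) \<le> norm (K (z - y) - l *\<^sub>R (z - y))"
      using Sd[of "x - (K y - l *\<^sub>R y)" "x - (K z - l *\<^sub>R z)"] by (simp add: K.diff algebra_simps)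
    also have "\<dots> \<le> l * (q * norm (z - y))" using Kl[of "z - y"] by (simp add: mult_ac)
    finally show "dist (S (x - (K y - l *\<^sub>R y))) (S (x - (K z - l *\<^sub>R z))) \<le> q * dist y z"
      using l by (simp add: dist_norm norm_minus_commute)
  qed
  then obtain y where y: "S (x - (K y - l *\<^sub>R y)) = y" by blast
  have sol: "y \<in> D \<and> J (A y) + K y = x"
    using SD[of "x - (K y - l *\<^sub>R y)"] S[of "x - (K y - l *\<^sub>R y)"] unfolding y by (simp add: algebra_simps)
  have "z = y" if "z \<in> D \<and> J (A z) + K z = x" for z
  proof -
    have zy: "z - y \<in> D" using that sol by (intro subspace_diff subspace_D) auto
    have "J (A (z - y)) + K (z - y) = 0" using that sol by (simp add: A_diff J.diff K.diff) (metis add_diff_add diff_self)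
    then have "c * norm (z - y) \<le> 0" using JA_plus_bound[where K=K, OF c(1) c(2) zy] by simp
    then show ?thesis using c(1) by (simp add: mult_le_0_iff)
  qed
  with sol show ?thesis by blast
qed

end

section \<open>The energy estimate\<close>

context complex_hilbert
begin

lemma exp_cscale: "cscale J (exp (\<i> * \<zeta> * of_real t)) x = exp (- Im \<zeta> * t) *\<^sub>R cscale J (cis (Re \<zeta> * t)) x"
proof -
  have "exp (\<i> * \<zeta> * of_real t) = of_real (exp (- Im \<zeta> * t)) * cis (Re \<zeta> * t)"
    by (simp add: complex_eq_iff Re_exp Im_exp)
  then show ?thesis by (metis cscale_mult cscale_of_real)
qed

lemma laplace_int_eq_ft:
  "laplace_int J v \<zeta> = ft (\<lambda>t. exp (- Im \<zeta> * t) *\<^sub>R (indicat_real {0..} t *\<^sub>R v t)) (Re \<zeta>)"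
  unfolding laplace_int_def set_lebesgue_integral_def ft_def exp_cscale
  by (simp add: cscale.scaleR_right mult.commute)

end

lemma integrable_exp_decay:
  assumes "\<eta> > 0"
  shows "integrable lborel (\<lambda>r. indicat_real {0..} r * exp (- \<eta> * r))"
proof -
  have "(\<lambda>x. exp (- \<eta> * x)) integrable_on {0..}"
    using has_integral_exp_minus_to_infinity[OF assms, of 0] by blast
  then have "(\<lambda>x. exp (- \<eta> * x)) absolutely_integrable_on {0..}"
    by (intro nonnegative_absolutely_integrable_1) auto
  then have "integrable lebesgue (\<lambda>r. indicat_real {0..} r * exp (- \<eta> * r))"
    by (simp add: set_integrable_def)
  then show ?thesis by (subst (asm) integrable_completion) auto
qed

locale dispersive = self_adjoint J D A
  for J :: "'h::{real_inner, banach, second_countable_topology} \<Rightarrow> 'h" and D A +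
  fixes m ainf :: "'h \<Rightarrow> 'h" and \<alpha> :: "real \<Rightarrow> 'h \<Rightarrow> 'h" and \<delta> C :: real
  assumes m_bdd: "bounded_clinear_op J m"
    and \<delta>: "\<delta> > 0"
    and m_ge: "nonneg_op J (\<lambda>x. m x - \<delta> *\<^sub>R x)"
    and ainf_bdd: "bounded_clinear_op J ainf"
    and \<alpha>_op: "\<And>t. t \<ge> 0 \<Longrightarrow> bounded_clinear_op J (\<alpha> t)"
    and \<alpha>_cont: "\<And>x. continuous_on {0..} (\<lambda>t. \<alpha> t x)"
    and \<alpha>_bdd: "\<And>t. t \<ge> 0 \<Longrightarrow> onorm (\<alpha> t) \<le> C"
    and Re_ahat: "\<And>\<zeta> w. Im \<zeta> > 0 \<Longrightarrow> Re (cinner J w (ahat J ainf \<alpha> \<zeta> w)) \<ge> 0"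
begin

lemma bounded_linear_m: "bounded_linear m" and m_J: "m (J x) = J (m x)"
  using m_bdd by (auto simp: bounded_clinear_op_def)

sublocale m: bounded_linear m by (rule bounded_linear_m)

lemma bounded_linear_ainf: "bounded_linear ainf" and ainf_J: "ainf (J x) = J (ainf x)"
  using ainf_bdd by (auto simp: bounded_clinear_op_def)

sublocale ainf: bounded_linear ainf by (rule bounded_linear_ainf)

lemma m_skew: "inner x (J (m x)) = 0" and m_coercive: "inner x (m x) \<ge> \<delta> * (norm x)\<^sup>2"
proof -
  have *: "inner x (J (m x - \<delta> *\<^sub>R x)) = 0" "inner x (m x - \<delta> *\<^sub>R x) \<ge> 0"
    using m_ge by (auto simp: nonneg_op_def cinner_def)
  from *(1) show "inner x (J (m x)) = 0" by (simp add: J.diff J.scaleR inner_diff_right)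
  from *(2) show "inner x (m x) \<ge> \<delta> * (norm x)\<^sup>2" by (simp add: inner_diff_right power2_norm_eq_inner)
qed

text \<open>Polarisation of \<open>m_skew\<close> at x + J y: a complex quadratic form with real
  values comes from a symmetric operator.\<close>

lemma m_symmetric: "inner x (m y) = inner y (m x)"
proof -
  have "inner (x + J y) (J (m (x + J y))) = 0" by (rule m_skew)
  then have "inner x (J (m (J y))) + inner (J y) (J (m x)) = 0"
    using m_skew[of x] m_skew[of "J y"]
    by (simp only: m.add J.add inner_add_left inner_add_right)
  then show ?thesis by (simp add: m_J)
qed

lemma C_nonneg: "C \<ge> 0"
  using \<alpha>_bdd[of 0] onorm_pos_le[of "\<alpha> 0"] \<alpha>_op[of 0] by (auto simp: bounded_clinear_op_def)

lemma \<alpha>_norm: "t \<ge> 0 \<Longrightarrow> norm (\<alpha> t x) \<le> C * norm x"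
  using onorm[of "\<alpha> t" x] \<alpha>_bdd[of t] \<alpha>_op[of t]
  by (meson bounded_clinear_op_def mult_right_mono norm_ge_zero order_trans)

text \<open>Extension by zero puts causality into the kernel, so that \<open>conv mem u\<close> is
  an integral over the past of u.\<close>

definition mem :: "real \<Rightarrow> 'h \<Rightarrow> 'h" where
  "mem r x = (if r \<ge> 0 then \<alpha> r x else 0)"

text \<open>The exponential weight makes the merely bounded memory kernel integrable and corresponds to
  evaluating its Laplace transform on the line of imaginary part \<open>\<eta>\<close>.\<close>

definition wmem :: "real \<Rightarrow> real \<Rightarrow> 'h \<Rightarrow> 'h" where
  "wmem \<eta> r x = exp (- \<eta> * r) *\<^sub>R mem r x"

lemma mem_linear: "bounded_linear (mem r)"
  using \<alpha>_op[of r] by (cases "r \<ge> 0") (auto simp: mem_def[abs_def] bounded_clinear_op_def)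

lemma mem_J: "mem r (J x) = J (mem r x)"
  using \<alpha>_op[of r] by (auto simp: mem_def bounded_clinear_op_def J.zero)

lemma mem_norm: "norm (mem r x) \<le> C * norm x"
  using \<alpha>_norm C_nonneg by (auto simp: mem_def)

lemma mem_isCont: "r \<noteq> 0 \<Longrightarrow> isCont (\<lambda>r. mem r x) r"
proof (cases "r > 0")
  case True
  have "isCont (\<lambda>t. \<alpha> t x) r"
    using continuous_on_interior[OF \<alpha>_cont[of x], of r] True by (simp add: interior_real_atLeast)
  moreover have "eventually (\<lambda>t. mem t x = \<alpha> t x) (nhds r)"
    using eventually_nhds_in_open[of "{0<..}" r] True by (auto elim!: eventually_mono simp: mem_def)
  ultimately show ?thesis by (subst isCont_cong)
next
  case False
  moreover assume "r \<noteq> 0"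
  ultimately have "r < 0" by simp
  then have "eventually (\<lambda>t. mem t x = 0) (nhds r)"
    using eventually_nhds_in_open[of "{..<0}" r] by (auto elim!: eventually_mono simp: mem_def)
  then show ?thesis by (subst isCont_cong) auto
qed

text \<open>Strong continuity together with the uniform bound gives joint continuity in time and
  vector. Separability then identifies the Borel sets of the product with the product of the Borel
  sets.\<close>

lemma mem_measurable: "case_prod mem \<in> borel_measurable (borel \<Otimes>\<^sub>M borel)"
proof -
  have "continuous_on UNIV (\<lambda>p. \<alpha> (max 0 (fst p)) (snd p))"
    unfolding continuous_on_sequentially
  proof (intro allI ballI impI, elim conjE)
    fix X :: "nat \<Rightarrow> real \<times> 'h" and p assume X: "X \<longlonglongrightarrow> p"
    define r where "r n = max 0 (fst (X n))" for n
    define r0 where "r0 = max 0 (fst p)"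
    have r: "r \<longlonglongrightarrow> r0" unfolding r_def[abs_def] r0_def by (intro tendsto_intros X)
    have rp: "r n \<ge> 0" "r0 \<ge> 0" for n by (auto simp: r_def r0_def)
    have a: "(\<lambda>n. \<alpha> (r n) (snd p)) \<longlonglongrightarrow> \<alpha> r0 (snd p)"
      using \<alpha>_cont[of "snd p"] r rp unfolding continuous_on_sequentially by (auto simp: o_def)
    have b: "(\<lambda>n. \<alpha> (r n) (snd (X n) - snd p)) \<longlonglongrightarrow> 0"
    proof (rule Lim_null_comparison)
      show "eventually (\<lambda>n. norm (\<alpha> (r n) (snd (X n) - snd p)) \<le> C * norm (snd (X n) - snd p)) sequentially"
        using rp by (intro always_eventually allI \<alpha>_norm)
      have "(\<lambda>n. C * norm (snd (X n) - snd p)) \<longlonglongrightarrow> C * norm (snd p - snd p)" by (intro tendsto_intros X)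
      then show "(\<lambda>n. C * norm (snd (X n) - snd p)) \<longlonglongrightarrow> 0" by simp
    qed
    have "\<alpha> (r n) (snd (X n)) = \<alpha> (r n) (snd p) + \<alpha> (r n) (snd (X n) - snd p)" for n
      using \<alpha>_op[OF rp(1)[of n]] by (auto simp: bounded_clinear_op_def linear_simps)
    then have "(\<lambda>n. \<alpha> (r n) (snd (X n))) \<longlonglongrightarrow> \<alpha> r0 (snd p)"
      using tendsto_add[OF a b] by simp
    then show "((\<lambda>p. \<alpha> (max 0 (fst p)) (snd p)) \<circ> X) \<longlonglongrightarrow> \<alpha> (max 0 (fst p)) (snd p)"
      by (simp add: o_def r_def r0_def)
  qed
  then have "(\<lambda>p. \<alpha> (max 0 (fst p)) (snd p)) \<in> borel_measurable borel"
    by (rule borel_measurable_continuous_onI)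
  then have [measurable]: "(\<lambda>p. \<alpha> (max 0 (fst p)) (snd p)) \<in> borel_measurable (borel \<Otimes>\<^sub>M borel)"
    by (simp add: borel_prod)
  have "case_prod mem = (\<lambda>p. indicat_real {0..} (fst p) *\<^sub>R \<alpha> (max 0 (fst p)) (snd p))"
    by (auto simp: mem_def fun_eq_iff)
  then show ?thesis by simp
qed

lemma wmem_kernel:
  assumes "\<eta> > 0"
  shows "conv_kernel J (wmem \<eta>) (\<lambda>r. C * (indicat_real {0..} r * exp (- \<eta> * r))) C"
proof (intro conv_kernel.intro conv_kernel_axioms.intro)
  show "complex_hilbert J" by (rule complex_hilbert_axioms)
  show "case_prod (wmem \<eta>) \<in> borel_measurable (borel \<Otimes>\<^sub>M borel)"
  proof -
    have "case_prod (wmem \<eta>) = (\<lambda>p. exp (- \<eta> * fst p) *\<^sub>R case_prod mem p)"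
      by (auto simp: wmem_def fun_eq_iff)
    then show ?thesis using mem_measurable by simp
  qed
  show "bounded_linear (wmem \<eta> r)" for r
    unfolding wmem_def[abs_def] by (intro bounded_linear_scaleR_right[THEN bounded_linear_compose] mem_linear)
  show "wmem \<eta> r (J x) = J (wmem \<eta> r x)" for r x by (simp add: wmem_def mem_J J.scaleR)
  show "norm (wmem \<eta> r x) \<le> C * (indicat_real {0..} r * exp (- \<eta> * r)) * norm x" for r x
  proof (cases "r \<ge> 0")
    case True
    then show ?thesis using mult_left_mono[OF mem_norm[of r x], of "exp (- \<eta> * r)"] by (simp add: wmem_def mult_ac)
  qed (simp add: wmem_def mem_def)
  show "0 \<le> C * (indicat_real {0..} r * exp (- \<eta> * r))" for r using C_nonneg by simp
  show "C * (indicat_real {0..} r * exp (- \<eta> * r)) \<le> C" for r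
    using C_nonneg assms by (auto intro!: mult_left_le simp: indicator_def)
  show "integrable lborel (\<lambda>r. C * (indicat_real {0..} r * exp (- \<eta> * r)))"
    using integrable_exp_decay[OF assms] by (rule integrable_mult_right)
  show "isCont (\<lambda>r. wmem \<eta> r x) r" if "r \<noteq> 0" for r x
    unfolding wmem_def by (intro continuous_intros mem_isCont that)
qed

lemma ahat_eq:
  "ahat J ainf \<alpha> \<zeta> x = ainf x + (\<integral>r. cscale J (cis (Re \<zeta> * r)) (wmem (Im \<zeta>) r x) \<partial>lborel)"
  unfolding ahat_def laplace_int_eq_ft ft_def
  by (intro arg_cong2[where f="(+)"] Bochner_Integration.integral_cong refl)
     (auto simp: wmem_def mem_def indicator_def)

lemma ft_conv_wmem:
  assumes "integrable lborel w" "Im \<zeta> > 0"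
  shows "ft (\<lambda>t. ainf (w t) + conv (wmem (Im \<zeta>)) w t) (Re \<zeta>) = ahat J ainf \<alpha> \<zeta> (ft w (Re \<zeta>))"
proof -
  interpret k: conv_kernel J "wmem (Im \<zeta>)" "\<lambda>r. C * (indicat_real {0..} r * exp (- Im \<zeta> * r))" C
    by (rule wmem_kernel) fact
  have "integrable lborel (\<lambda>t. ainf (w t))" by (rule integrable_bounded_linear[OF bounded_linear_ainf assms(1)])
  then show ?thesis
    using assms by (simp add: ft_add k.conv_integrable ft_bounded_linear[OF _ bounded_linear_ainf] ainf_J k.ft_conv ahat_eq)
qed

lemma ahat_linear:
  assumes "Im \<zeta> > 0" shows "bounded_linear (ahat J ainf \<alpha> \<zeta>)"
proof -
  interpret k: conv_kernel J "wmem (Im \<zeta>)" "\<lambda>r. C * (indicat_real {0..} r * exp (- Im \<zeta> * r))" C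
    by (rule wmem_kernel) fact
  let ?F = "\<lambda>x r. cscale J (cis (Re \<zeta> * r)) (wmem (Im \<zeta>) r x)"
  let ?\<kappa> = "\<lambda>r. C * (indicat_real {0..} r * exp (- Im \<zeta> * r))"
  have i: "integrable lborel (?F x)" for x
    by (rule Bochner_Integration.integrable_bound[where f="\<lambda>r. ?\<kappa> r * norm x"])
       (use k.ki in \<open>auto intro!: AE_I2 order_trans[OF k.kb]\<close>)
  have F_add: "?F (x + y) r = ?F x r + ?F y r" and F_scale: "?F (c *\<^sub>R x) r = c *\<^sub>R ?F x r" for x y r c
    by (simp_all add: linear_simps[OF k.kl] cscale.add_right cscale.scaleR_right)
  have "bounded_linear (\<lambda>x. \<integral>r. ?F x r \<partial>lborel)"
  proof (rule bounded_linear_intro)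
    show "norm (\<integral>r. ?F x r \<partial>lborel) \<le> norm x * (\<integral>r. ?\<kappa> r \<partial>lborel)" for x
    proof -
      have "norm (\<integral>r. ?F x r \<partial>lborel) \<le> (\<integral>r. ?\<kappa> r * norm x \<partial>lborel)"
        by (rule norm_integral_le) (use k.ki k.kb in auto)
      also have "\<dots> = norm x * (\<integral>r. ?\<kappa> r \<partial>lborel)" by (simp add: mult.commute)
      finally show ?thesis .
    qed
  qed (simp_all only: F_add F_scale Bochner_Integration.integral_add[OF i i] integral_scaleR_right)
  then show ?thesis
    unfolding ahat_eq[abs_def] by (intro bounded_linear_add bounded_linear_ainf)
qed

text \<open>JA + \<open>Kop\<close> is -i times the operator \<open>Lop\<close>. In this form
  \<open>A\<close> contributes the skew part JA and the rest is bounded and accretive.\<close>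

definition Kop :: "complex \<Rightarrow> 'h \<Rightarrow> 'h" where
  "Kop \<zeta> y = cscale J (- \<i> * \<zeta>) (m y) + ahat J ainf \<alpha> \<zeta> y"

lemma Kop_linear: "Im \<zeta> > 0 \<Longrightarrow> bounded_linear (Kop \<zeta>)"
  unfolding Kop_def[abs_def]
  by (intro bounded_linear_add ahat_linear bounded_linear_compose[OF cscale.bounded_linear_right] bounded_linear_m)

lemma inner_Kop: "inner y (Kop \<zeta> y) = Im \<zeta> * inner y (m y) + inner y (ahat J ainf \<alpha> \<zeta> y)"
  by (simp add: Kop_def inner_add_right inner_diff_right cscale_def m_skew)

text \<open>Used with g = 0 for solvability, where the constant degenerates as Im \<zeta> tends to
  0, and with a friction lower bound for estimates that do not degenerate.\<close>

lemma Kop_coercive: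
  assumes "Im \<zeta> > 0" "g \<le> inner y (ahat J ainf \<alpha> \<zeta> y)"
  shows "Im \<zeta> * \<delta> * (norm y)\<^sup>2 + g \<le> inner y (Kop \<zeta> y)"
  using assms by (auto simp: inner_Kop mult.assoc intro!: add_mono mult_left_mono m_coercive)

lemma ahat_nonneg: "Im \<zeta> > 0 \<Longrightarrow> 0 \<le> inner y (ahat J ainf \<alpha> \<zeta> y)"
  using Re_ahat[of \<zeta> y] by (simp add: cinner_def)

lemma Lop_iff: "Lop J m A ainf \<alpha> \<zeta> y = cscale J \<i> x \<longleftrightarrow> J (A y) + Kop \<zeta> y = x"
proof -
  have "J (A y) + Kop \<zeta> y = - J (Lop J m A ainf \<alpha> \<zeta> y)"
    by (simp add: Lop_def Kop_def J.add J.diff cscale_def J.scaleR algebra_simps)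
  moreover have "- J (cscale J \<i> x) = x" by simp
  ultimately show ?thesis by (metis J_J minus_minus)
qed

lemma frakA_solution:
  assumes "Im \<zeta> > 0"
  shows "frakA J D m A ainf \<alpha> \<zeta> x \<in> D"
    and "J (A (frakA J D m A ainf \<alpha> \<zeta> x)) + Kop \<zeta> (frakA J D m A ainf \<alpha> \<zeta> x) = x"
proof -
  have "\<exists>!y. y \<in> D \<and> J (A y) + Kop \<zeta> y = x"
    by (rule JA_plus_ex1[OF Kop_linear[OF assms], of "Im \<zeta> * \<delta>"])
       (use assms \<delta> Kop_coercive[OF assms ahat_nonneg[OF assms]] in auto)
  from theI'[OF this] show "frakA J D m A ainf \<alpha> \<zeta> x \<in> D"
    and "J (A (frakA J D m A ainf \<alpha> \<zeta> x)) + Kop \<zeta> (frakA J D m A ainf \<alpha> \<zeta> x) = x"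
    unfolding frakA_def Lop_iff by auto
qed

text \<open>The term Im \<zeta> * \<delta> is discarded, so the bound is uniform up to the real
  axis.\<close>

lemma frakA_bound:
  assumes "Im \<zeta> > 0" "c > 0" "\<And>y. c * (norm y)\<^sup>2 \<le> inner y (ahat J ainf \<alpha> \<zeta> y)"
  shows "c * norm (frakA J D m A ainf \<alpha> \<zeta> x) \<le> norm x"
proof -
  have "c * (norm y)\<^sup>2 \<le> inner y (Kop \<zeta> y)" for y
  proof -
    have "0 \<le> Im \<zeta> * \<delta> * (norm y)\<^sup>2" using assms \<delta> by simp
    then show ?thesis using Kop_coercive[OF assms(1) assms(3)[of y]] by linarith
  qed
  from JA_plus_bound[where K="Kop \<zeta>", OF assms(2) this frakA_solution(1)[OF assms(1), of x]]
  show ?thesis by (simp add: frakA_solution(2)[OF assms(1)])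
qed

text \<open>Classical solutions with zero history, posed on the whole line so that time shifts stay
  in the same class. The equation is solved for JA u, which keeps all unbounded terms on one
  side.\<close>

definition solves :: "(real \<Rightarrow> 'h) \<Rightarrow> (real \<Rightarrow> 'h) \<Rightarrow> (real \<Rightarrow> 'h) \<Rightarrow> bool" where
  "solves u u' g \<longleftrightarrow> (\<forall>t. (u has_vector_derivative u' t) (at t)) \<and> continuous_on UNIV u' \<and>
     (\<forall>t\<le>0. u t = 0) \<and> continuous_on UNIV g \<and>
     (\<forall>t. u t \<in> D \<and> J (A (u t)) = g t - m (u' t) - ainf (u t) - conv mem u t)"

lemma solves_continuous: "solves u u' g \<Longrightarrow> continuous_on UNIV u"
  unfolding solves_def by (meson continuous_at_imp_continuous_on has_vector_derivative_continuous)

lemma integrable_truncated: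
  fixes u :: "real \<Rightarrow> 'h"
  assumes "continuous_on UNIV u" shows "integrable lborel (\<lambda>s. indicat_real {0..T} s *\<^sub>R u s)"
  using borel_integrable_compact[of "{0..T}" u] continuous_on_subset[OF assms] by auto

text \<open>The weight factors as exp(-\<eta> t) = exp(-\<eta> (t - s)) exp(-\<eta> s), one factor
  for the kernel and one for the function.\<close>

lemma conv_weighted:
  "exp (- \<eta> * t) *\<^sub>R conv mem u t = conv (wmem \<eta>) (\<lambda>s. exp (- \<eta> * s) *\<^sub>R u s) t"
proof -
  have "wmem \<eta> (t - s) (exp (- \<eta> * s) *\<^sub>R u s) = exp (- \<eta> * t) *\<^sub>R mem (t - s) (u s)" for s
    by (simp add: wmem_def linear_simps[OF mem_linear] algebra_simps flip: exp_add)
  then show ?thesis unfolding conv_def by simp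
qed

text \<open>Truncating u to [0,T] does not change the memory term on [0,T], by causality; this is what allows
  the frequency-domain condition to be used on a finite time interval.\<close>

lemma passivity:
  fixes T :: real
  assumes u: "continuous_on UNIV u" and u0: "\<And>t. t \<le> 0 \<Longrightarrow> u t = 0" and \<eta>: "\<eta> > 0"
  defines "w \<equiv> \<lambda>t. indicat_real {0..T} t *\<^sub>R (exp (- \<eta> * t) *\<^sub>R u t)"
  defines "z \<equiv> \<lambda>t. ainf (w t) + conv (wmem \<eta>) w t"
  shows "0 \<le> (\<integral>t. inner (w t) (z t) \<partial>lborel)"
    and "integrable lborel (\<lambda>t. inner (w t) (z t))"
    and "0 \<le> t \<Longrightarrow> t \<le> T \<Longrightarrow> z t = exp (- \<eta> * t) *\<^sub>R (ainf (u t) + conv mem u t)"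
proof -
  interpret k: conv_kernel J "wmem \<eta>" "\<lambda>r. C * (indicat_real {0..} r * exp (- \<eta> * r))" C
    by (rule wmem_kernel[OF \<eta>])
  have cont: "continuous_on UNIV (\<lambda>t. exp (- \<eta> * t) *\<^sub>R u t)" by (intro continuous_intros u)
  have w: "integrable lborel w" unfolding w_def by (rule integrable_truncated[OF cont])
  have wa: "integrable lborel (\<lambda>t. ainf (w t))" by (rule integrable_bounded_linear[OF bounded_linear_ainf w])
  have z: "integrable lborel z" unfolding z_def using wa k.conv_integrable[OF w] by simp
  have "bounded ((\<lambda>t. exp (- \<eta> * t) *\<^sub>R u t) ` {0..T})"
    by (intro compact_imp_bounded compact_continuous_image continuous_on_subset[OF cont]) auto
  then obtain B where B: "B > 0" "\<And>t. t \<in> {0..T} \<Longrightarrow> norm (exp (- \<eta> * t) *\<^sub>R u t) \<le> B"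
    by (auto simp: bounded_pos)
  have wB: "norm (w t) \<le> B" for t using B by (auto simp: w_def indicator_def)
  obtain a where a: "\<And>x. norm (ainf x) \<le> norm x * a" "a > 0" using ainf.pos_bounded by blast
  have zB: "norm (z t) \<le> B * a + C * (\<integral>s. norm (w s) \<partial>lborel)" for t
  proof -
    have "norm (ainf (w t)) \<le> B * a" using a(1)[of "w t"] wB[of t] a(2) by (meson mult_right_mono less_imp_le order_trans)
    then show ?thesis unfolding z_def using k.conv_bound[OF w, of t] by (intro norm_triangle_mono) auto
  qed
  \<comment> \<open>The truncation jumps at most at 0 and T, which is why \<open>ft_positive\<close>
    was stated with almost everywhere continuity.\<close>
  have wc: "isCont w t" if t: "t \<noteq> 0" "t \<noteq> T" for t
  proof -
    have "isCont (\<lambda>t. indicat_real {0..T} t) t"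
      using t by (simp add: isCont_indicator frontier_cbox[of 0 T, unfolded cbox_interval box_real])
    then show ?thesis unfolding w_def
      using u by (intro continuous_intros) (auto simp: continuous_on_eq_continuous_at)
  qed
  have zc: "AE t in lborel. isCont z t"
    using AE_lborel_singleton[of 0] AE_lborel_singleton[of T]
  proof eventually_elim
    case (elim t)
    show ?case unfolding z_def by (intro continuous_intros ainf.isCont wc k.conv_isCont w elim)
  qed
  show "0 \<le> (\<integral>t. inner (w t) (z t) \<partial>lborel)"
  proof (rule ft_positive[OF w z zB zc])
    fix \<omega>
    \<comment> \<open>The damping \<eta> moves the frequency condition to the line of height \<eta>,
      where it is assumed.\<close>
    have "ft z \<omega> = ahat J ainf \<alpha> (Complex \<omega> \<eta>) (ft w \<omega>)"
      unfolding z_def using ft_conv_wmem[OF w, of "Complex \<omega> \<eta>"] \<eta> by simp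
    then show "0 \<le> inner (ft w \<omega>) (ft z \<omega>)" using ahat_nonneg[of "Complex \<omega> \<eta>"] \<eta> by simp
  qed
  have [measurable]: "w \<in> borel_measurable borel" "z \<in> borel_measurable borel" using w z by auto
  show "integrable lborel (\<lambda>t. inner (w t) (z t))"
  proof (rule Bochner_Integration.integrable_bound[where f="\<lambda>t. B * norm (z t)"])
    show "AE t in lborel. norm (inner (w t) (z t)) \<le> norm (B * norm (z t))"
    proof (rule AE_I2)
      fix t
      have "\<bar>inner (w t) (z t)\<bar> \<le> norm (w t) * norm (z t)" by (rule Cauchy_Schwarz_ineq2)
      also have "\<dots> \<le> B * norm (z t)" by (intro mult_right_mono wB) auto
      finally show "norm (inner (w t) (z t)) \<le> norm (B * norm (z t))" using B by simp
    qed
  qed (use z in auto)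
  show "z t = exp (- \<eta> * t) *\<^sub>R (ainf (u t) + conv mem u t)" if t: "0 \<le> t" "t \<le> T"
  proof -
    have "conv (wmem \<eta>) w t = conv (wmem \<eta>) (\<lambda>s. exp (- \<eta> * s) *\<^sub>R u s) t"
      unfolding conv_def
    proof (rule Bochner_Integration.integral_cong[OF refl])
      fix s
      show "wmem \<eta> (t - s) (w s) = wmem \<eta> (t - s) (exp (- \<eta> * s) *\<^sub>R u s)"
        using t u0[of s] by (auto simp: w_def indicator_def wmem_def mem_def linear_simps[OF mem_linear, unfolded mem_def])
    qed
    moreover have "w t = exp (- \<eta> * t) *\<^sub>R u t" using t by (simp add: w_def)
    ultimately show ?thesis
      unfolding z_def conv_weighted[symmetric] by (simp only: scaleR_add_right ainf.scaleR)
  qed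
qed

text \<open>The derivative of the inner product of u and m u is twice that of u and m u', from which
  JA drops by skewness and the friction by passivity. This leaves the square of |u| against |u| |g|;
  one factor |u| is removed by working at the time where |u| is largest.\<close>

theorem energy_bound:
  assumes "solves u u' g" "T \<ge> 0"
  shows "\<delta> * norm (u T) \<le> 2 * (\<integral>t. indicat_real {0..T} t * norm (g t) \<partial>lborel)"
proof -
  have du: "(u has_vector_derivative u' t) (at t)" and cu': "continuous_on UNIV u'" and u0: "t \<le> 0 \<Longrightarrow> u t = 0"
    and cg: "continuous_on UNIV g" and uD: "u t \<in> D" and eq: "J (A (u t)) = g t - m (u' t) - ainf (u t) - conv mem u t" for t
    using assms by (auto simp: solves_def)
  have cu: "continuous_on UNIV u" by (rule solves_continuous[OF assms(1)])
  have ig: "integrable lborel (\<lambda>t. indicat_real {0..T} t * norm (g t))" for T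
    using borel_integrable_compact[of "{0..T}" "\<lambda>t. norm (g t)"] continuous_on_subset[OF cg] by (auto intro!: continuous_intros)
  have iug: "integrable lborel (\<lambda>t. indicat_real {0..T} t * (norm (u t) * norm (g t)))" for T
  proof -
    have "continuous_on {0..T} (\<lambda>t. norm (u t) * norm (g t))"
      by (intro continuous_intros continuous_on_subset[OF cg] continuous_on_subset[OF cu]) auto
    from borel_integrable_compact[OF compact_Icc this] show ?thesis by simp
  qed
  have weighted: "exp (- 2 * \<eta> * T) * inner (u T) (m (u T)) \<le> 2 * (\<integral>t. indicat_real {0..T} t * (norm (u t) * norm (g t)) \<partial>lborel)"
    if T: "T \<ge> 0" and \<eta>: "\<eta> > 0" for T \<eta>
  proof -
    define w where "w = (\<lambda>t. indicat_real {0..T} t *\<^sub>R (exp (- \<eta> * t) *\<^sub>R u t))"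
    define z where "z = (\<lambda>t. ainf (w t) + conv (wmem \<eta>) w t)"
    have pas1: "0 \<le> (\<integral>t. inner (w t) (z t) \<partial>lborel)" and pas2: "integrable lborel (\<lambda>t. inner (w t) (z t))"
      and pas3: "0 \<le> t \<Longrightarrow> t \<le> T \<Longrightarrow> z t = exp (- \<eta> * t) *\<^sub>R (ainf (u t) + conv mem u t)" for t
      unfolding w_def z_def using passivity[OF cu u0 \<eta>, where T=T] by blast+
    define E where "E t = exp (- 2 * \<eta> * t) * inner (u t) (m (u t))" for t
    define E' where "E' t = exp (- 2 * \<eta> * t) * (2 * inner (u t) (m (u' t)) - 2 * \<eta> * inner (u t) (m (u t)))" for t
    have dE: "(E has_real_derivative E' t) (at t)" for t
    proof -
      have dm: "((\<lambda>t. m (u t)) has_vector_derivative m (u' t)) (at t)"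
        by (rule m.has_vector_derivative[OF du])
      have "((\<lambda>t. inner (u t) (m (u t))) has_vector_derivative (inner (u t) (m (u' t)) + inner (u' t) (m (u t)))) (at t)"
        by (rule bounded_bilinear.has_vector_derivative[OF bounded_bilinear_inner du dm])
      then have di: "((\<lambda>t. inner (u t) (m (u t))) has_real_derivative (2 * inner (u t) (m (u' t)))) (at t)"
        using m_symmetric[of "u' t" "u t"] by (simp add: has_real_derivative_iff_has_vector_derivative)
      show ?thesis unfolding E_def E'_def
        by (auto intro!: derivative_eq_intros di simp: algebra_simps)
    qed
    have cE': "continuous_on {0..T} E'"
      unfolding E'_def
      by (intro continuous_intros m.continuous_on continuous_on_subset[OF cu] continuous_on_subset[OF cu']) auto
    have iE': "integrable lborel (\<lambda>t. indicat_real {0..T} t *\<^sub>R E' t)"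
      by (rule borel_integrable_compact[OF compact_Icc cE'])
    have FTC: "(\<integral>t. indicat_real {0..T} t *\<^sub>R E' t \<partial>lborel) = E T - E 0"
      using dE cE' T by (intro integral_FTC_atLeastAtMost) (auto simp: has_real_derivative_iff_has_vector_derivative intro: has_vector_derivative_at_within)
    have le: "indicat_real {0..T} t *\<^sub>R E' t \<le> 2 * (indicat_real {0..T} t * (norm (u t) * norm (g t))) - 2 * inner (w t) (z t)" for t
    proof (cases "t \<in> {0..T}")
      case True
      have "m (u' t) = g t - J (A (u t)) - (ainf (u t) + conv mem u t)" using eq[of t] by (simp add: algebra_simps)
      then have e1: "inner (u t) (m (u' t)) = inner (u t) (g t) - inner (u t) (ainf (u t) + conv mem u t)"
        using A_skew[OF uD[of t]] by (simp add: inner_diff_right)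
      have e2: "inner (w t) (z t) = exp (- 2 * \<eta> * t) * inner (u t) (ainf (u t) + conv mem u t)"
      proof -
        have zt: "z t = exp (- \<eta> * t) *\<^sub>R (ainf (u t) + conv mem u t)" using True by (intro pas3) auto
        have wt: "w t = exp (- \<eta> * t) *\<^sub>R u t" using True by (simp add: w_def)
        have "exp (- 2 * \<eta> * t) = exp (- \<eta> * t) * exp (- \<eta> * t)" by (simp flip: exp_add)
        then show ?thesis unfolding zt wt by simp
      qed
      \<comment> \<open>Differentiating the weight produces a term of favourable sign, which is
        dropped.\<close>
      have "0 \<le> inner (u t) (m (u t))" using m_coercive[of "u t"] \<delta> by (meson less_imp_le mult_nonneg_nonneg order_trans zero_le_power2)
      then have "E' t \<le> exp (- 2 * \<eta> * t) * (2 * inner (u t) (m (u' t)))"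
        unfolding E'_def using \<eta> by (intro mult_left_mono) auto
      also have "\<dots> = 2 * (exp (- 2 * \<eta> * t) * inner (u t) (g t)) - 2 * inner (w t) (z t)"
        unfolding e1 e2 by (simp add: algebra_simps)
      also have "exp (- 2 * \<eta> * t) * inner (u t) (g t) \<le> 1 * (norm (u t) * norm (g t))"
      proof -
        have "exp (- 2 * \<eta> * t) * inner (u t) (g t) \<le> exp (- 2 * \<eta> * t) * (norm (u t) * norm (g t))"
          by (intro mult_left_mono norm_cauchy_schwarz) auto
        also have "\<dots> \<le> 1 * (norm (u t) * norm (g t))" using True \<eta> by (intro mult_right_mono) auto
        finally show ?thesis .
      qed
      finally show ?thesis using True by simp
    qed (simp add: w_def)
    have "E T - E 0 \<le> (\<integral>t. 2 * (indicat_real {0..T} t * (norm (u t) * norm (g t))) - 2 * inner (w t) (z t) \<partial>lborel)"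
      unfolding FTC[symmetric] using iE' iug pas2 le by (intro integral_mono) auto
    also have "\<dots> = 2 * (\<integral>t. indicat_real {0..T} t * (norm (u t) * norm (g t)) \<partial>lborel) - 2 * (\<integral>t. inner (w t) (z t) \<partial>lborel)"
      using iug[of T] pas2 by simp
    also have "\<dots> \<le> 2 * (\<integral>t. indicat_real {0..T} t * (norm (u t) * norm (g t)) \<partial>lborel)" using pas1 by simp
    finally show ?thesis using u0[of 0] by (simp add: E_def)
  qed
  have unweighted: "inner (u T) (m (u T)) \<le> 2 * (\<integral>t. indicat_real {0..T} t * (norm (u t) * norm (g t)) \<partial>lborel)" if T: "T \<ge> 0" for T
  \<comment> \<open>The damping is removed through \<eta> = 1 / (n + 1); the right-hand side does
    not depend on it.\<close>
  proof (rule LIMSEQ_le_const2)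
    have "(\<lambda>n. exp (- 2 * inverse (real (Suc n)) * T) * inner (u T) (m (u T))) \<longlonglongrightarrow> exp (- 2 * 0 * T) * inner (u T) (m (u T))"
      by (intro tendsto_intros LIMSEQ_inverse_real_of_nat)
    then show "(\<lambda>n. exp (- 2 * inverse (real (Suc n)) * T) * inner (u T) (m (u T))) \<longlonglongrightarrow> inner (u T) (m (u T))" by simp
    show "\<exists>N. \<forall>n\<ge>N. exp (- 2 * inverse (real (Suc n)) * T) * inner (u T) (m (u T)) \<le> 2 * (\<integral>t. indicat_real {0..T} t * (norm (u t) * norm (g t)) \<partial>lborel)"
      using weighted[OF T, of "inverse (real (Suc n))" for n] by (intro exI allI impI weighted T) simp
  qed
  \<comment> \<open>At the maximum of |u| over [0,T], |u| can be pulled out of the integral and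
    cancelled.\<close>
  obtain s where s: "s \<in> {0..T}" "\<And>t. t \<in> {0..T} \<Longrightarrow> norm (u t) \<le> norm (u s)"
    using continuous_attains_sup[OF compact_Icc _ continuous_on_norm[OF continuous_on_subset[OF cu]], of 0 T] assms(2)
    by auto
  have "norm (u s) * (\<delta> * norm (u s)) \<le> inner (u s) (m (u s))"
    using m_coercive[of "u s"] by (simp add: power2_eq_square mult_ac)
  also have "\<dots> \<le> 2 * (\<integral>t. indicat_real {0..s} t * (norm (u t) * norm (g t)) \<partial>lborel)"
    using s by (intro unweighted) auto
  also have "\<dots> \<le> 2 * (\<integral>t. norm (u s) * (indicat_real {0..T} t * norm (g t)) \<partial>lborel)"
  proof (intro mult_left_mono integral_mono iug integrable_mult_right ig)
    fix t show "indicat_real {0..s} t * (norm (u t) * norm (g t)) \<le> norm (u s) * (indicat_real {0..T} t * norm (g t))"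
      using s s(2)[of t] by (auto simp: indicator_def intro!: mult_right_mono)
  qed simp
  also have "\<dots> = norm (u s) * (2 * (\<integral>t. indicat_real {0..T} t * norm (g t) \<partial>lborel))" by simp
  finally have "\<delta> * norm (u s) \<le> 2 * (\<integral>t. indicat_real {0..T} t * norm (g t) \<partial>lborel)"
  proof (cases "u s = 0")
    case True
    have "0 \<le> (\<integral>t. indicat_real {0..T} t * norm (g t) \<partial>lborel)" by (intro Bochner_Integration.integral_nonneg) simp
    then show ?thesis using True by simp
  qed simp
  then show ?thesis using s(2)[of T] assms(2) \<delta> by (meson atLeastAtMost_iff less_imp_le mult_left_mono order_refl order_trans)
qed

end

section \<open>Exponentially weighted kernels of integration\<close>

lemma (in complex_hilbert) scalar_conv_kernel:
  assumes [measurable]: "\<phi> \<in> borel_measurable borel" and \<phi>: "\<And>r. 0 \<le> \<phi> r" "\<And>r. \<phi> r \<le> M" "integrable lborel \<phi>"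
    and c: "\<And>r. r \<noteq> 0 \<Longrightarrow> isCont \<phi> r"
  shows "conv_kernel J (\<lambda>r x. \<phi> r *\<^sub>R x) \<phi> M"
proof (intro conv_kernel.intro conv_kernel_axioms.intro)
  show "complex_hilbert J" by (rule complex_hilbert_axioms)
  show "(\<lambda>(r, x::'h). \<phi> r *\<^sub>R x) \<in> borel_measurable (borel \<Otimes>\<^sub>M borel)" by measurable
  show "bounded_linear (\<lambda>x::'h. \<phi> r *\<^sub>R x)" for r by (rule bounded_linear_scaleR_right)
  show "isCont (\<lambda>r. \<phi> r *\<^sub>R x) r" if "r \<noteq> 0" for r and x :: 'h by (intro continuous_intros c that)
qed (use \<phi> in \<open>auto simp: J.scaleR\<close>)

text \<open>Kernel of the double primitive, damped by exp(-r) to become integrable;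
  \<open>step\<close> is the same for the single primitive. The rate 1 corresponds to the line Im
  \<zeta> = 1, on which the equation for the primitives is read off.\<close>

definition ramp :: "real \<Rightarrow> real" where "ramp r = max 0 r * exp (- r)"

definition step :: "real \<Rightarrow> real" where "step r = indicat_real {0..} r * exp (- r)"

lemma ramp_measurable [measurable]: "ramp \<in> borel_measurable borel"
  and step_measurable [measurable]: "step \<in> borel_measurable borel"
  unfolding ramp_def[abs_def] step_def[abs_def] by measurable

lemma ramp_bounds: "0 \<le> ramp r" "ramp r \<le> 2 * (indicat_real {0..} r * exp (- (1/2) * r))" "ramp r \<le> 2"
proof -
  show 1: "0 \<le> ramp r" by (simp add: ramp_def)
  show 2: "ramp r \<le> 2 * (indicat_real {0..} r * exp (- (1/2) * r))"
  proof (cases "r \<ge> 0")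
    case True
    \<comment> \<open>Half of the exponential decay absorbs the linear growth.\<close>
    have "1 + r / 2 \<le> exp (r / 2)" by (rule exp_ge_add_one_self)
    then have "r \<le> 2 * exp (r / 2)" by linarith
    then have "r * exp (- r) \<le> (2 * exp (r / 2)) * exp (- r)" by (intro mult_right_mono) auto
    also have "\<dots> = 2 * exp (- (1/2) * r)" by (simp flip: exp_add mult.assoc)
    finally show ?thesis using True by (simp add: ramp_def max_def)
  qed (simp add: ramp_def)
  have "indicat_real {0..} r * exp (- (1/2) * r) \<le> 1" by (auto simp: indicator_def)
  then show "ramp r \<le> 2" using 2 by linarith
qed

lemma step_bounds: "0 \<le> step r" "step r \<le> 1"
  by (auto simp: step_def indicator_def)

lemma step_integrable: "integrable lborel step"
  using integrable_exp_decay[of 1] by (simp add: step_def[abs_def])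

lemma ramp_integrable: "integrable lborel ramp"
proof (rule Bochner_Integration.integrable_bound)
  show "integrable lborel (\<lambda>r. 2 * (indicat_real {0..} r * exp (- (1/2) * r)))"
    using integrable_exp_decay[of "1/2"] by (intro integrable_mult_right) auto
  show "AE r in lborel. norm (ramp r) \<le> norm (2 * (indicat_real {0..} r * exp (- (1/2) * r)))"
    using ramp_bounds by (intro AE_I2) (auto intro: order_trans[OF _ abs_ge_self])
qed simp

text \<open>With \<zeta> = \<omega> + i, the function r exp(i \<zeta> r) vanishes at 0 and at
  infinity, so its derivative has integral 0 over the half-line. On the transform side this
  expresses that the single primitive is the derivative of the double one.\<close>

lemma ramp_step_fourier:
  "- \<i> * Complex \<omega> 1 * (\<integral>r. ramp r *\<^sub>R cis (\<omega> * r) \<partial>lborel) = (\<integral>r. step r *\<^sub>R cis (\<omega> * r) \<partial>lborel)"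
proof -
  define \<zeta> where "\<zeta> = Complex \<omega> 1"
  have e: "exp (\<i> * \<zeta> * of_real r) = exp (- r) *\<^sub>R cis (\<omega> * r)" for r
    by (simp add: \<zeta>_def complex_eq_iff Re_exp Im_exp)
  have iR: "integrable lborel (\<lambda>r. ramp r *\<^sub>R cis (\<omega> * r))" and iS: "integrable lborel (\<lambda>r. step r *\<^sub>R cis (\<omega> * r))"
    by (rule Bochner_Integration.integrable_bound[OF ramp_integrable]; auto)
       (rule Bochner_Integration.integrable_bound[OF step_integrable]; auto)
  define F where "F r = of_real r * exp (\<i> * \<zeta> * of_real r)" for r :: real
  define F' where "F' r = exp (\<i> * \<zeta> * of_real r) + of_real r * (\<i> * \<zeta> * exp (\<i> * \<zeta> * of_real r))" for r :: real
  have ae: "AE r in lborel. indicat_real (einterval 0 \<infinity>) r *\<^sub>R F' r = step r *\<^sub>R cis (\<omega> * r) + (\<i> * \<zeta>) * (ramp r *\<^sub>R cis (\<omega> * r))"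
    using AE_lborel_singleton[of 0]
  proof eventually_elim
    case (elim r)
    then show ?case
      unfolding F'_def e
      by (auto simp: einterval_def indicator_def step_def ramp_def max_def zero_ereal_def scaleR_conv_of_real algebra_simps)
  qed
  have rhs: "integrable lborel (\<lambda>r. step r *\<^sub>R cis (\<omega> * r) + (\<i> * \<zeta>) * (ramp r *\<^sub>R cis (\<omega> * r)))"
    using iR iS by (intro Bochner_Integration.integrable_add integrable_mult_right)
  have F'm [measurable]: "F' \<in> borel_measurable borel"
    unfolding F'_def by (intro borel_measurable_continuous_onI continuous_intros)
  have F'i: "set_integrable lborel (einterval 0 \<infinity>) F'"
    unfolding set_integrable_def
    by (rule integrable_cong_AE_imp[OF rhs]) (use ae in \<open>auto elim: eventually_mono\<close>)
  have "(LBINT r=0..\<infinity>. F' r) = 0 - 0"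
  proof (rule interval_integral_FTC_integrable[where F=F])
    show "(F has_vector_derivative F' x) (at x)" for x
      unfolding F_def[abs_def] F'_def
      by (rule has_vector_derivative_real_field) (auto intro!: derivative_eq_intros simp: algebra_simps)
    show "isCont F' x" for x unfolding F'_def by (intro continuous_intros)
    show "set_integrable lborel (einterval 0 \<infinity>) F'" by (rule F'i)
    have "(F \<longlongrightarrow> F 0) (at_right 0)" unfolding F_def by (intro tendsto_intros)
    then show "((F \<circ> real_of_ereal) \<longlongrightarrow> 0) (at_right 0)"
      by (simp add: F_def zero_ereal_def ereal_tendsto_simps)
    have "((\<lambda>r. norm (F r)) \<longlongrightarrow> 0) at_top"
    proof (rule Lim_transform_eventually)
      show "((\<lambda>r::real. r ^ 1 / exp r) \<longlongrightarrow> 0) at_top" by (rule tendsto_power_div_exp_0)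
      show "eventually (\<lambda>r. r ^ 1 / exp r = norm (F r)) at_top"
        using eventually_ge_at_top[of "0::real"]
        by eventually_elim (simp add: F_def e norm_mult exp_minus divide_inverse)
    qed
    then have "(F \<longlongrightarrow> 0) at_top" by (rule tendsto_norm_zero_cancel)
    then show "((F \<circ> real_of_ereal) \<longlongrightarrow> 0) (at_left \<infinity>)" by (simp add: ereal_tendsto_simps)
  qed simp
  moreover have "(LBINT r=0..\<infinity>. F' r) = (\<integral>r. step r *\<^sub>R cis (\<omega> * r) + (\<i> * \<zeta>) * (ramp r *\<^sub>R cis (\<omega> * r)) \<partial>lborel)"
    unfolding interval_lebesgue_integral_def set_lebesgue_integral_def
    using ae iR iS by (simp, intro integral_cong_AE) (auto simp: step_def[abs_def] ramp_def[abs_def])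
  moreover have "\<dots> = (\<integral>r. step r *\<^sub>R cis (\<omega> * r) \<partial>lborel) + (\<i> * \<zeta>) * (\<integral>r. ramp r *\<^sub>R cis (\<omega> * r) \<partial>lborel)"
    using iR iS by (simp add: Bochner_Integration.integral_add integrable_mult_right del: mult_scaleR_right)
  ultimately show ?thesis by (simp add: \<zeta>_def algebra_simps add_eq_0_iff2)
qed

text \<open>Scaled second differences of a double primitive are mollifications by a causal tent function;
  this is how estimates for the double primitives transfer to the original functions.\<close>

lemma tent_second_difference:
  fixes x :: "real \<Rightarrow> 'a::{banach, second_countable_topology}"
  assumes i: "\<And>t. integrable lborel (\<lambda>s. max 0 (t - s) *\<^sub>R x s)" and c: "c > 0"
  defines "W \<equiv> \<lambda>t. \<integral>s. max 0 (t - s) *\<^sub>R x s \<partial>lborel"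
  shows "c *\<^sub>R (c *\<^sub>R (W t - W (t - 1/c)) - c *\<^sub>R (W (t - 1/c) - W (t - 1/c - 1/c)))
    = (\<integral>s. (c * tri (c * (t - s) - 1)) *\<^sub>R x s \<partial>lborel)"
proof -
  \<comment> \<open>The second difference of the positive part with step 1 / c, times c^2, is the
    hat of height c on [0, 2/c].\<close>
  have tent: "c * c * (max 0 q - max 0 (q - 1/c)) - c * c * (max 0 (q - 1/c) - max 0 (q - 1/c - 1/c)) = c * tri (c * q - 1)" for q
  proof -
    have *: "c * max 0 y = max 0 (c * y)" for y using c by (auto simp: max_def zero_le_mult_iff mult_le_0_iff)
    have **: "c * (q - 1/c) = c * q - 1" "c * (q - 1/c - 1/c) = c * q - 2" using c by (auto simp: field_simps)
    have "c * c * (max 0 q - max 0 (q - 1/c)) - c * c * (max 0 (q - 1/c) - max 0 (q - 1/c - 1/c))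
      = c * (c * max 0 q - 2 * (c * max 0 (q - 1/c)) + c * max 0 (q - 1/c - 1/c))" by (simp add: algebra_simps)
    also have "\<dots> = c * tri (c * q - 1)" unfolding * ** by (auto simp: tri_def max_def)
    finally show ?thesis .
  qed
  have "c *\<^sub>R (c *\<^sub>R (W t - W (t - 1/c)) - c *\<^sub>R (W (t - 1/c) - W (t - 1/c - 1/c)))
    = (\<integral>s. (c * c) *\<^sub>R (max 0 (t - s) *\<^sub>R x s - max 0 (t - 1/c - s) *\<^sub>R x s) - (c * c) *\<^sub>R (max 0 (t - 1/c - s) *\<^sub>R x s - max 0 (t - 1/c - 1/c - s) *\<^sub>R x s) \<partial>lborel)"
    unfolding W_def
    by (subst Bochner_Integration.integral_diff Bochner_Integration.integral_scaleR_right;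
        (intro Bochner_Integration.integrable_diff integrable_scaleR_right i)?)+ (simp add: i scaleR_diff_right)
  also have "\<dots> = (\<integral>s. (c * c * (max 0 (t - s) - max 0 ((t - s) - 1/c)) - c * c * (max 0 ((t - s) - 1/c) - max 0 ((t - s) - 1/c - 1/c))) *\<^sub>R x s \<partial>lborel)"
  proof (intro Bochner_Integration.integral_cong refl)
    fix s
    have "t - 1/c - s = (t - s) - 1/c" "t - 1/c - 1/c - s = (t - s) - 1/c - 1/c" by simp_all
    then show "(c * c) *\<^sub>R (max 0 (t - s) *\<^sub>R x s - max 0 (t - 1/c - s) *\<^sub>R x s) - (c * c) *\<^sub>R (max 0 (t - 1/c - s) *\<^sub>R x s - max 0 (t - 1/c - 1/c - s) *\<^sub>R x s)
      = (c * c * (max 0 (t - s) - max 0 ((t - s) - 1/c)) - c * c * (max 0 ((t - s) - 1/c) - max 0 ((t - s) - 1/c - 1/c))) *\<^sub>R x s"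
      by (simp only: scaleR_diff_left scaleR_diff_right scaleR_scaleR right_diff_distrib)
  qed
  finally show ?thesis unfolding tent .
qed

section \<open>Time invariance and the resolvent of JA\<close>

context dispersive
begin

text \<open>Integrability for an undamped kernel and a possibly unbounded function: only s in [0,t]
  contributes, so the damped kernel may be used there and its weight undone.\<close>

lemma conv_mem_integrand:
  assumes u: "continuous_on UNIV u" and u0: "\<And>t. t \<le> 0 \<Longrightarrow> u t = 0"
  shows "integrable lborel (\<lambda>s. mem (t - s) (u s))"
proof -
  interpret k: conv_kernel J "wmem 1" "\<lambda>r. C * (indicat_real {0..} r * exp (- 1 * r))" C
    by (rule wmem_kernel) simp
  have "integrable lborel (\<lambda>s. indicat_real {0..t} s *\<^sub>R (exp (- 1 * s) *\<^sub>R u s))"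
    by (intro integrable_truncated continuous_intros u)
  from k.conv_integrand[OF this, of t]
  have "integrable lborel (\<lambda>s. exp t *\<^sub>R wmem 1 (t - s) (indicat_real {0..t} s *\<^sub>R (exp (- 1 * s) *\<^sub>R u s)))"
    by (rule integrable_scaleR_right)
  moreover have "exp t *\<^sub>R wmem 1 (t - s) (indicat_real {0..t} s *\<^sub>R (exp (- 1 * s) *\<^sub>R u s)) = mem (t - s) (u s)" for s
  proof (cases "s \<in> {0..t}")
    case True
    then show ?thesis by (simp add: wmem_def linear_simps[OF mem_linear] flip: exp_add)
  next
    case False
    then have "s < 0 \<or> t - s < 0" by auto
    then show ?thesis using u0[of s] False by (auto simp: wmem_def linear_simps[OF mem_linear]) (simp add: mem_def)
  qed
  ultimately show ?thesis by simp
qed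

text \<open>Linearity and time invariance; a forward shift keeps the history zero. The factor
  \<open>c\<close> yields difference quotients, and iterating gives the second differences behind
  the tent averages.\<close>

lemma solves_diff_shift:
  assumes s: "solves u u' g" and h: "h \<ge> 0"
  shows "solves (\<lambda>t. c *\<^sub>R (u t - u (t - h))) (\<lambda>t. c *\<^sub>R (u' t - u' (t - h))) (\<lambda>t. c *\<^sub>R (g t - g (t - h)))"
  unfolding solves_def
proof (intro conjI allI impI)
  have du: "\<And>t. (u has_vector_derivative u' t) (at t)" and cu': "continuous_on UNIV u'" and u0: "\<And>t. t \<le> 0 \<Longrightarrow> u t = 0"
    and cg: "continuous_on UNIV g" and uD: "\<And>t. u t \<in> D"
    and eq: "\<And>t. J (A (u t)) = g t - m (u' t) - ainf (u t) - conv mem u t"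
    using s by (auto simp: solves_def)
  have cu: "continuous_on UNIV u" by (rule solves_continuous[OF s])
  have dsh: "((\<lambda>t. u (t - h)) has_vector_derivative u' (t - h)) (at t)" for t
  proof -
    have "((\<lambda>t. t - h) has_vector_derivative 1) (at t)" by (auto intro!: derivative_eq_intros)
    from vector_diff_chain_at[OF this du[of "t - h"]] show ?thesis by (simp add: o_def)
  qed
  show "((\<lambda>t. c *\<^sub>R (u t - u (t - h))) has_vector_derivative c *\<^sub>R (u' t - u' (t - h))) (at t)" for t
    by (intro bounded_linear.has_vector_derivative[OF bounded_linear_scaleR_right] has_vector_derivative_diff du dsh)
  have csh: "continuous_on UNIV (\<lambda>t. F (t - h))" if "continuous_on UNIV F" for F :: "real \<Rightarrow> 'h"
    by (rule continuous_on_compose2[OF that]) (auto intro!: continuous_intros)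
  show "continuous_on UNIV (\<lambda>t. c *\<^sub>R (u' t - u' (t - h)))" "continuous_on UNIV (\<lambda>t. c *\<^sub>R (g t - g (t - h)))"
    by (intro continuous_intros csh cu' cg)+
  show "c *\<^sub>R (u t - u (t - h)) = 0" if "t \<le> 0" for t using that h u0[of t] u0[of "t - h"] by simp
  show "c *\<^sub>R (u t - u (t - h)) \<in> D" for t by (intro subspace_scale subspace_diff subspace_D uD)
  have conv_sh: "conv mem (\<lambda>s. u (s - h)) t = conv mem u (t - h)" for t
    using lborel_translate(1)[of "\<lambda>s. mem (t - h - s) (u s)" h] by (simp add: conv_def algebra_simps)
  have i1: "integrable lborel (\<lambda>s. mem (t - s) (u s))" for t by (rule conv_mem_integrand[OF cu u0])
  have i2: "integrable lborel (\<lambda>s. mem (t - s) (u (s - h)))" for t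
    by (rule conv_mem_integrand[OF csh[OF cu]]) (use h u0 in auto)
  have "conv mem (\<lambda>t. c *\<^sub>R (u t - u (t - h))) t = c *\<^sub>R (conv mem u t - conv mem (\<lambda>s. u (s - h)) t)" for t
    unfolding conv_def using i1 i2 by (simp add: linear_simps[OF mem_linear])
  moreover have "J (A (c *\<^sub>R (u t - u (t - h)))) = c *\<^sub>R (J (A (u t)) - J (A (u (t - h))))" for t
    by (simp add: A_scaleR A_diff uD subspace_diff[OF subspace_D uD uD] J.scaleR J.diff)
  ultimately show "J (A (c *\<^sub>R (u t - u (t - h)))) = c *\<^sub>R (g t - g (t - h)) - m (c *\<^sub>R (u' t - u' (t - h)))
      - ainf (c *\<^sub>R (u t - u (t - h))) - conv mem (\<lambda>t. c *\<^sub>R (u t - u (t - h))) t" for t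
    by (simp only: conv_sh eq m.scaleR m.diff ainf.scaleR ainf.diff) (simp add: algebra_simps)
qed

lemma ahat_J:
  assumes "Im \<zeta> > 0" shows "ahat J ainf \<alpha> \<zeta> (J x) = J (ahat J ainf \<alpha> \<zeta> x)"
proof -
  interpret k: conv_kernel J "wmem (Im \<zeta>)" "\<lambda>r. C * (indicat_real {0..} r * exp (- Im \<zeta> * r))" C
    by (rule wmem_kernel) fact
  have i: "integrable lborel (\<lambda>r. cscale J (cis (Re \<zeta> * r)) (wmem (Im \<zeta>) r x))"
    by (rule Bochner_Integration.integrable_bound[where f="\<lambda>r. C * (indicat_real {0..} r * exp (- Im \<zeta> * r)) * norm x"])
       (use k.ki in \<open>auto intro!: AE_I2 order_trans[OF k.kb]\<close>)
  have "cscale J c (J y) = J (cscale J c y)" for c y by (simp add: cscale_def J.add J.diff J.scaleR)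
  then show ?thesis
    by (simp add: ahat_eq ainf_J k.kJ J.add integral_bounded_linear[OF bounded_linear_J i])
qed

lemma clinear_cscale:
  assumes "bounded_linear T" "\<And>x. T (J x) = J (T x)"
  shows "T (cscale J c x) = cscale J c (T x)"
  using assms by (simp add: cscale_def linear_simps)

lemma A_cscale: "x \<in> D \<Longrightarrow> A (cscale J c x) = cscale J c (A x)" and cscale_D: "x \<in> D \<Longrightarrow> cscale J c x \<in> D"
  by (simp_all add: cscale_def A_add A_scaleR A_J J_D subspace_D subspace_add subspace_scale)

text \<open>\<open>JA_plus_ex1\<close> with the identity as perturbation. The left inverse property
  on \<open>D\<close> turns the transformed equation into an identity between bounded
  operators.\<close>

lemma resolvent:
  shows "\<exists>S. bounded_linear S \<and> (\<forall>x. S (J x) = J (S x)) \<and> (\<forall>x. S x \<in> D \<and> J (A (S x)) + S x = x) \<and>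
    (\<forall>y\<in>D. S (J (A y) + y) = y)"
proof -
  have ex1: "\<exists>!y. y \<in> D \<and> J (A y) + y = x" for x
    by (rule JA_plus_ex1[of "\<lambda>x. x" 1, OF bounded_linear_ident]) (auto simp: power2_norm_eq_inner)
  define S where "S x = (THE y. y \<in> D \<and> J (A y) + y = x)" for x
  have SD: "S x \<in> D" and Seq: "J (A (S x)) + S x = x" for x
    using theI'[OF ex1[of x]] by (auto simp: S_def)
  have Suniq: "S x = y" if "y \<in> D" "J (A y) + y = x" for x y
    using ex1[of x] SD[of x] Seq[of x] that by blast
  have "bounded_linear S"
  proof (rule bounded_linear_intro[where K=1])
    show "S (x + y) = S x + S y" for x y
    proof (intro Suniq subspace_add subspace_D SD)
      have "J (A (S x + S y)) + (S x + S y) = (J (A (S x)) + S x) + (J (A (S y)) + S y)" by (simp add: A_add SD J.add)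
      then show "J (A (S x + S y)) + (S x + S y) = x + y" by (simp only: Seq)
    qed
    show "S (c *\<^sub>R x) = c *\<^sub>R S x" for c x
      using arg_cong[OF Seq[of x], of "\<lambda>y. c *\<^sub>R y"] by (intro Suniq subspace_scale subspace_D SD) (simp add: A_scaleR SD J.scaleR algebra_simps)
    show "norm (S x) \<le> norm x * 1" for x
      using JA_shift_bound(1)[OF SD[of x], of 1] by (simp add: Seq)
  qed
  moreover have "S (J x) = J (S x)" for x
    using arg_cong[OF Seq[of x], of J] by (intro Suniq J_D SD) (simp add: A_J SD J.add)
  ultimately show ?thesis using SD Seq Suniq[OF _ refl] by (intro exI[of _ S] conjI allI ballI) auto
qed

end

section \<open>The causal solution\<close>

locale causal_solution = dispersive J D A m ainf \<alpha> \<delta> C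
  for J :: "'h::{real_inner, banach, second_countable_topology} \<Rightarrow> 'h" and D A m ainf \<alpha> \<delta> C +
  fixes f v :: "real \<Rightarrow> 'h"
  assumes f_int: "integrable lborel f"
    and v_cont: "continuous_on {0..} v"
    and v_lap: "\<And>\<zeta>. Im \<zeta> > 0 \<Longrightarrow> laplace_exists J v \<zeta> \<and>
                  laplace_int J v \<zeta> = frakA J D m A ainf \<alpha> \<zeta> (laplace_int J f \<zeta>)"
begin

text \<open>The extension by zero may jump at 0; hence the conditions t \<noteq> 0 and t \<noteq> h
  in the pointwise estimates for \<open>v0\<close>.\<close>

definition v0 :: "real \<Rightarrow> 'h" where "v0 t = indicat_real {0..} t *\<^sub>R v t"

definition f0 :: "real \<Rightarrow> 'h" where "f0 t = indicat_real {0..} t *\<^sub>R f t"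

lemma f0_integrable: "integrable lborel f0"
  by (rule Bochner_Integration.integrable_bound[OF f_int]) (use f_int in \<open>auto simp: f0_def[abs_def] indicator_def\<close>)

lemma f0_measurable [measurable]: "f0 \<in> borel_measurable borel"
  using f0_integrable by auto

lemma v0_measurable [measurable]: "v0 \<in> borel_measurable borel"
  unfolding v0_def[abs_def] by (intro borel_measurable_continuous_on_indicator v_cont) simp

lemma v0_neg: "t < 0 \<Longrightarrow> v0 t = 0" and f0_neg: "t < 0 \<Longrightarrow> f0 t = 0"
  by (auto simp: v0_def f0_def)

lemma v0_isCont: "t \<noteq> 0 \<Longrightarrow> isCont v0 t"
proof (cases "t > 0")
  case True
  have "isCont v t"
    using continuous_on_interior[OF v_cont, of t] True by (simp add: interior_real_atLeast)
  moreover have "eventually (\<lambda>t. v0 t = v t) (nhds t)"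
    using eventually_nhds_in_open[of "{0<..}" t] True by (auto elim!: eventually_mono simp: v0_def)
  ultimately show ?thesis by (subst isCont_cong)
next
  case False
  moreover assume "t \<noteq> 0"
  ultimately have "t < 0" by simp
  then have "eventually (\<lambda>t. v0 t = 0) (nhds t)"
    using eventually_nhds_in_open[of "{..<0}" t] by (auto elim!: eventually_mono simp: v0_def)
  then show ?thesis by (subst isCont_cong) auto
qed

lemma v0_truncated: "integrable lborel (\<lambda>s. indicat_real {0..T} s *\<^sub>R v0 s)"
proof -
  have "integrable lborel (\<lambda>s. indicat_real {0..T} s *\<^sub>R v s)"
    by (rule borel_integrable_compact[OF compact_Icc continuous_on_subset[OF v_cont]]) auto
  moreover have "indicat_real {0..T} s *\<^sub>R v s = indicat_real {0..T} s *\<^sub>R v0 s" for s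
    by (simp add: v0_def indicator_def)
  ultimately show ?thesis by simp
qed

lemma v0_bounded_above: "\<exists>B. \<forall>s\<le>T. norm (v0 s) \<le> B"
proof -
  have "bounded (v ` {0..T})"
    by (intro compact_imp_bounded compact_continuous_image continuous_on_subset[OF v_cont]) auto
  then obtain B where "B > 0" "\<And>s. s \<in> {0..T} \<Longrightarrow> norm (v s) \<le> B" by (auto simp: bounded_pos)
  then show ?thesis by (intro exI[of _ B]) (auto simp: v0_def indicator_def)
qed

lemma v0_weighted_integrable:
  assumes "\<eta> > 0" shows "integrable lborel (\<lambda>t. exp (- \<eta> * t) *\<^sub>R v0 t)"
proof -
  have "laplace_exists J v (Complex 0 \<eta>)" using v_lap[of "Complex 0 \<eta>"] assms by simp
  then have "integrable lborel (\<lambda>t. indicat_real {0..} t *\<^sub>R cscale J (exp (\<i> * Complex 0 \<eta> * of_real t)) (v t))"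
    by (simp add: laplace_exists_def set_integrable_def)
  then show ?thesis
  proof (rule Bochner_Integration.integrable_bound)
    show "(\<lambda>t. exp (- \<eta> * t) *\<^sub>R v0 t) \<in> borel_measurable lborel" by measurable
  qed (auto simp: v0_def norm_mult)
qed

lemma f0_weighted_bound: "\<eta> \<ge> 0 \<Longrightarrow> norm (exp (- \<eta> * t) *\<^sub>R f0 t) \<le> norm (f0 t)"
  by (cases "t < 0") (auto simp: f0_neg intro!: mult_right_le_one_le mult_left_le_one_le)

lemma f0_weighted_integrable: "\<eta> \<ge> 0 \<Longrightarrow> integrable lborel (\<lambda>t. exp (- \<eta> * t) *\<^sub>R f0 t)"
  by (rule Bochner_Integration.integrable_bound[OF f0_integrable]) (use f0_weighted_bound in auto)

definition vhat :: "real \<Rightarrow> real \<Rightarrow> 'h" where "vhat \<eta> = ft (\<lambda>t. exp (- \<eta> * t) *\<^sub>R v0 t)"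

definition fhat :: "real \<Rightarrow> real \<Rightarrow> 'h" where "fhat \<eta> = ft (\<lambda>t. exp (- \<eta> * t) *\<^sub>R f0 t)"

lemma vhat_eq: "\<eta> > 0 \<Longrightarrow> vhat \<eta> \<omega> = frakA J D m A ainf \<alpha> (Complex \<omega> \<eta>) (fhat \<eta> \<omega>)"
  using v_lap[of "Complex \<omega> \<eta>"] by (simp add: vhat_def fhat_def v0_def[abs_def] f0_def[abs_def] laplace_int_eq_ft)

lemma fhat_bound: "\<eta> \<ge> 0 \<Longrightarrow> norm (fhat \<eta> \<omega>) \<le> (\<integral>t. norm (f0 t) \<partial>lborel)"
proof -
  assume \<eta>: "\<eta> \<ge> 0"
  have "norm (fhat \<eta> \<omega>) \<le> (\<integral>t. norm (exp (- \<eta> * t) *\<^sub>R f0 t) \<partial>lborel)"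
    unfolding fhat_def by (rule ft_bound[OF f0_weighted_integrable[OF \<eta>]])
  also have "\<dots> \<le> (\<integral>t. norm (f0 t) \<partial>lborel)"
    using f0_weighted_integrable[OF \<eta>] f0_integrable f0_weighted_bound[OF \<eta>]
    by (intro integral_mono integrable_norm) auto
  finally show ?thesis .
qed

lemma vhat_solution:
  assumes "\<eta> > 0"
  shows "vhat \<eta> \<omega> \<in> D" "J (A (vhat \<eta> \<omega>)) + Kop (Complex \<omega> \<eta>) (vhat \<eta> \<omega>) = fhat \<eta> \<omega>"
  using frakA_solution[of "Complex \<omega> \<eta>" "fhat \<eta> \<omega>"] assms by (simp_all add: vhat_eq)

text \<open>The right-hand side does not involve \<eta>, since damping only decreases the L1 norm of
  a causal source.\<close>

lemma vhat_bound:
  assumes "\<eta> > 0" "c > 0" "\<And>y. c * (norm y)\<^sup>2 \<le> inner y (ahat J ainf \<alpha> (Complex \<omega> \<eta>) y)"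
  shows "c * norm (vhat \<eta> \<omega>) \<le> (\<integral>t. norm (f0 t) \<partial>lborel)"
  using frakA_bound[of "Complex \<omega> \<eta>" c "fhat \<eta> \<omega>"] fhat_bound[of \<eta> \<omega>] assms by (simp add: vhat_eq)

text \<open>\<open>V1\<close> and \<open>V2\<close> are the single and double primitives of
  \<open>v0\<close>, and \<open>F2\<close> is the double primitive of \<open>f0\<close>. Two
  integrations are needed: one to make the time derivative continuous, since \<open>v0\<close> may
  jump at 0.\<close>

definition V1 :: "real \<Rightarrow> 'h" where "V1 t = (\<integral>s. indicat_real {..t} s *\<^sub>R v0 s \<partial>lborel)"
definition V2 :: "real \<Rightarrow> 'h" where "V2 t = (\<integral>s. max 0 (t - s) *\<^sub>R v0 s \<partial>lborel)"
definition F2 :: "real \<Rightarrow> 'h" where "F2 t = (\<integral>s. max 0 (t - s) *\<^sub>R f0 s \<partial>lborel)"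

abbreviation (input) "vw \<equiv> \<lambda>t. exp (- 1 * t) *\<^sub>R v0 t"
abbreviation (input) "fw \<equiv> \<lambda>t. exp (- 1 * t) *\<^sub>R f0 t"

sublocale rampk: conv_kernel J "\<lambda>r x. ramp r *\<^sub>R x" ramp 2
proof (rule scalar_conv_kernel)
  show "isCont ramp r" for r unfolding ramp_def[abs_def] by (intro continuous_intros)
qed (auto simp: ramp_bounds ramp_integrable)

sublocale stepk: conv_kernel J "\<lambda>r x. step r *\<^sub>R x" step 1
proof (rule scalar_conv_kernel)
  show "isCont step r" if "r \<noteq> 0" for r
  proof -
    have "isCont (indicat_real {0..}) r" using that by (simp add: isCont_indicator)
    then show ?thesis unfolding step_def[abs_def] by (intro continuous_intros)
  qed
qed (auto simp: step_bounds step_integrable)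

sublocale memk: conv_kernel J "wmem 1" "\<lambda>r. C * (indicat_real {0..} r * exp (- 1 * r))" C
  by (rule wmem_kernel) simp

lemma vw_integrable: "integrable lborel vw" and fw_integrable: "integrable lborel fw"
  using v0_weighted_integrable[of 1] f0_weighted_integrable[of 1] by simp_all

lemma ramp_weight: "ramp (t - s) *\<^sub>R (exp (- 1 * s) *\<^sub>R x) = exp (- t) *\<^sub>R (max 0 (t - s) *\<^sub>R (x::'h))"
  by (simp add: ramp_def mult.commute mult.left_commute flip: exp_add)

lemma V2_weighted: "exp (- t) *\<^sub>R V2 t = conv (\<lambda>r x. ramp r *\<^sub>R x) vw t"
  unfolding V2_def conv_def ramp_weight by (simp only: integral_scaleR_right)

lemma F2_weighted: "exp (- t) *\<^sub>R F2 t = conv (\<lambda>r x. ramp r *\<^sub>R x) fw t"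
  unfolding F2_def conv_def ramp_weight by (simp only: integral_scaleR_right)

lemma V1_weighted: "exp (- t) *\<^sub>R V1 t = conv (\<lambda>r x. step r *\<^sub>R x) vw t"
proof -
  have "step (t - s) *\<^sub>R (exp (- 1 * s) *\<^sub>R x) = exp (- t) *\<^sub>R (indicat_real {..t} s *\<^sub>R (x::'h))" for s x
    by (simp add: step_def indicator_def flip: exp_add)
  then show ?thesis unfolding V1_def conv_def by (simp only: integral_scaleR_right)
qed

lemma max_v0_integrable: "integrable lborel (\<lambda>s. max 0 (t - s) *\<^sub>R v0 s)"
  and max_f0_integrable: "integrable lborel (\<lambda>s. max 0 (t - s) *\<^sub>R f0 s)"
  using integrable_scaleR_right[OF rampk.conv_integrand[OF vw_integrable, of t], of "exp t"]
    integrable_scaleR_right[OF rampk.conv_integrand[OF fw_integrable, of t], of "exp t"]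
  unfolding ramp_weight by (simp_all flip: exp_add mult.assoc)

lemma unweight: "(\<And>t. exp (- t) *\<^sub>R F t = G t) \<Longrightarrow> F = (\<lambda>t. exp t *\<^sub>R (G t :: 'h))"
  by (rule ext) (metis exp_add exp_zero add.right_inverse scaleR_one scaleR_scaleR)

lemma V1_continuous: "continuous_on UNIV V1" and F2_continuous: "continuous_on UNIV F2"
  unfolding unweight[OF V1_weighted] unweight[OF F2_weighted]
  by (intro continuous_on_scaleR continuous_at_imp_continuous_on ballI isCont_exp stepk.conv_isCont[OF vw_integrable]
      rampk.conv_isCont[OF fw_integrable])+

lemma ft_scalar_conv:
  assumes k: "conv_kernel J (\<lambda>r x. \<phi> r *\<^sub>R x) \<phi> M" and w: "integrable lborel w"
  shows "ft (conv (\<lambda>r x. \<phi> r *\<^sub>R x) w) \<omega> = cscale J (\<integral>r. \<phi> r *\<^sub>R cis (\<omega> * r) \<partial>lborel) (ft w \<omega>)"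
proof -
  interpret k: conv_kernel J "\<lambda>r x. \<phi> r *\<^sub>R x" \<phi> M by (rule k)
  have "integrable lborel (\<lambda>r. \<phi> r *\<^sub>R cis (\<omega> * r))"
    by (rule Bochner_Integration.integrable_bound[OF k.ki]) (use k.ki in auto)
  from integral_bounded_linear[OF cscale.bounded_linear_left this, of "ft w \<omega>"]
  show ?thesis by (simp add: k.ft_conv[OF w] cscale.scaleR_left cscale.scaleR_right)
qed

text \<open>The unbounded A is removed by applying the resolvent of JA to the Laplace-transformed equation;
  uniqueness is then needed for a bounded continuous integrable function only.\<close>

lemma V2_equation: "V2 t \<in> D \<and> J (A (V2 t)) = F2 t - m (V1 t) - ainf (V2 t) - conv mem V2 t"
proof -
  define W where "W = conv (\<lambda>r x. ramp r *\<^sub>R x) vw"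
  define V where "V = conv (\<lambda>r x. step r *\<^sub>R x) vw"
  define G where "G = conv (\<lambda>r x. ramp r *\<^sub>R x) fw"
  \<comment> \<open>The expected value of \<open>J (A (W t))\<close>: the equation for
    \<open>V2\<close>, multiplied by exp(-t).\<close>
  define p where "p t = G t - m (V t) - (ainf (W t) + conv (wmem 1) W t)" for t
  have Wi: "integrable lborel W" and Vi: "integrable lborel V" and Gi: "integrable lborel G"
    unfolding W_def V_def G_def
    by (intro rampk.conv_integrable stepk.conv_integrable vw_integrable fw_integrable)+
  have aWi: "integrable lborel (\<lambda>t. ainf (W t) + conv (wmem 1) W t)" and mVi: "integrable lborel (\<lambda>t. m (V t))"
    using Wi Vi by (auto intro!: memk.conv_integrable integrable_bounded_linear[OF bounded_linear_ainf] integrable_bounded_linear[OF bounded_linear_m])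
  have pi: "integrable lborel p" unfolding p_def using Gi aWi mVi by simp
  obtain S where S1: "bounded_linear S" and S': "\<forall>x. S (J x) = J (S x)" "\<forall>x. S x \<in> D \<and> J (A (S x)) + S x = x"
    "\<forall>y\<in>D. S (J (A y) + y) = y" using resolvent by (elim exE conjE) (rule that)
  then have S2: "S (J x) = J (S x)" and S3: "S x \<in> D" and S4: "J (A (S x)) + S x = x" and S5: "y \<in> D \<Longrightarrow> S (J (A y) + y) = y" for x y
    by auto
  interpret S: bounded_linear S by (rule S1)
  have ft_p: "ft W \<omega> \<in> D \<and> ft p \<omega> = J (A (ft W \<omega>))" for \<omega>
  proof -
    define cR where "cR = (\<integral>r. ramp r *\<^sub>R cis (\<omega> * r) \<partial>lborel)"
    define y where "y = vhat 1 \<omega>"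
    let ?\<zeta> = "Complex \<omega> 1"
    have yD: "y \<in> D" and yeq: "J (A y) + Kop ?\<zeta> y = fhat 1 \<omega>" unfolding y_def by (rule vhat_solution; simp)+
    have W: "ft W \<omega> = cscale J cR y"
      unfolding W_def cR_def y_def vhat_def by (rule ft_scalar_conv[OF rampk.conv_kernel_axioms vw_integrable])
    have G: "ft G \<omega> = cscale J cR (fhat 1 \<omega>)"
      unfolding G_def cR_def fhat_def by (rule ft_scalar_conv[OF rampk.conv_kernel_axioms fw_integrable])
    \<comment> \<open>By \<open>ramp_step_fourier\<close> passing from W to V multiplies the
      transform by -i \<zeta>, which matches the factor in \<open>Kop\<close>.\<close>
    have V: "ft V \<omega> = cscale J (- \<i> * ?\<zeta> * cR) y"
      unfolding V_def cR_def ramp_step_fourier y_def vhat_def by (rule ft_scalar_conv[OF stepk.conv_kernel_axioms vw_integrable])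
    have aW: "ft (\<lambda>t. ainf (W t) + conv (wmem 1) W t) \<omega> = cscale J cR (ahat J ainf \<alpha> ?\<zeta> y)"
      using ft_conv_wmem[OF Wi, of ?\<zeta>] clinear_cscale[OF ahat_linear ahat_J, of ?\<zeta> cR y] by (simp add: W)
    have "ft p \<omega> = ft G \<omega> - m (ft V \<omega>) - cscale J cR (ahat J ainf \<alpha> ?\<zeta> y)"
      unfolding p_def using Gi mVi aWi
      by (simp add: ft_diff aW ft_bounded_linear[OF Vi bounded_linear_m m_J])
    also have "m (ft V \<omega>) = cscale J cR (cscale J (- \<i> * ?\<zeta>) (m y))"
      by (simp only: V clinear_cscale[OF bounded_linear_m m_J] cscale_mult mult_ac)
    also have "ft G \<omega> = cscale J cR (J (A y) + Kop ?\<zeta> y)" by (simp only: G yeq)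
    finally have "ft p \<omega> = cscale J cR (J (A y))"
      by (simp add: Kop_def cscale.add_right)
    also have "\<dots> = J (A (ft W \<omega>))"
      unfolding W A_cscale[OF yD] by (rule clinear_cscale[OF bounded_linear_J refl, symmetric])
    finally show ?thesis using cscale_D[OF yD] by (simp add: W)
  qed
  \<comment> \<open>z vanishes exactly when W has values in D and JA W = p, yet it contains only
    bounded operators, so its transform can be computed.\<close>
  define z where "z t = S (p t + W t) - W t" for t
  have Spi: "integrable lborel (\<lambda>t. S (p t + W t))" by (rule integrable_bounded_linear[OF S1]) (use pi Wi in simp)
  have zi: "integrable lborel z" unfolding z_def using Spi Wi by simp
  have W_cont: "isCont W t" and V_cont: "isCont V t" and G_cont: "isCont G t" for t
    unfolding W_def V_def G_def
    by (intro rampk.conv_isCont stepk.conv_isCont vw_integrable fw_integrable)+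
  have z_cont: "isCont z t" for t
    unfolding z_def p_def
    by (intro continuous_intros S.isCont m.isCont ainf.isCont W_cont V_cont G_cont memk.conv_isCont[OF Wi])
  have z_bounded: "\<exists>B. \<forall>t. norm (z t) \<le> B"
  proof -
    have bW: "bounded (range W)" and bV: "bounded (range V)" and bG: "bounded (range G)" and bk: "bounded (range (conv (wmem 1) W))"
      unfolding bounded_iff W_def V_def G_def
      using rampk.conv_bound[OF vw_integrable] stepk.conv_bound[OF vw_integrable] rampk.conv_bound[OF fw_integrable] memk.conv_bound[OF Wi, unfolded W_def]
      by blast+
    have bl: "bounded (range (\<lambda>t. T (F t)))" if "bounded_linear T" "bounded (range F)" for T :: "'h \<Rightarrow> 'h" and F :: "real \<Rightarrow> 'h"
      using bounded_linear_image[OF that(2,1)] by (simp add: image_image)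
    have bp: "bounded (range (\<lambda>t. P t + Q t))" "bounded (range (\<lambda>t. P t - Q t))" if "bounded (range P)" "bounded (range Q)" for P Q :: "real \<Rightarrow> 'h"
      using bounded_plus_comp[OF that] bounded_minus_comp[OF that] by auto
    have "bounded (range z)" unfolding z_def p_def
      by (intro bp bl[OF S1] bl[OF bounded_linear_m] bl[OF bounded_linear_ainf] bW bV bG bk)
    then show ?thesis by (auto simp: bounded_iff)
  qed
  then obtain B where B: "\<And>t. norm (z t) \<le> B" by blast
  have ft_z: "ft z \<omega> = 0" for \<omega>
  proof -
    have "ft z \<omega> = S (ft p \<omega> + ft W \<omega>) - ft W \<omega>"
      unfolding z_def using pi Wi Spi by (simp add: ft_diff ft_add ft_bounded_linear[OF _ S1 S2])
    then show ?thesis using ft_p[of \<omega>] S5 by simp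
  qed
  have "z t = 0" by (rule ft_unique[OF zi B z_cont ft_z])
  then have Seq: "S (p t + W t) = W t" by (simp add: z_def)
  then have WD: "W t \<in> D" and WA: "J (A (W t)) = p t"
    using S3[of "p t + W t"] S4[of "p t + W t"] by (auto simp: algebra_simps)
  have We: "W = (\<lambda>t. exp (- 1 * t) *\<^sub>R V2 t)" and Ve: "V t = exp (- t) *\<^sub>R V1 t" and Ge: "G t = exp (- t) *\<^sub>R F2 t"
    unfolding W_def V_def G_def using V2_weighted V1_weighted F2_weighted by auto
  have Wt: "W t = exp (- t) *\<^sub>R V2 t" by (simp add: We)
  have conve: "conv (wmem 1) W t = exp (- t) *\<^sub>R conv mem V2 t"
    unfolding We using conv_weighted[of 1 t V2] by simp
  have V2W: "V2 t = exp t *\<^sub>R W t" by (simp add: We flip: exp_add)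
  have D2: "V2 t \<in> D" unfolding V2W by (rule subspace_scale[OF subspace_D WD])
  have "J (A (V2 t)) = exp t *\<^sub>R p t" unfolding V2W by (simp add: A_scaleR WD J.scaleR WA)
  also have "\<dots> = exp t *\<^sub>R (exp (- t) *\<^sub>R (F2 t - m (V1 t) - ainf (V2 t) - conv mem V2 t))"
    unfolding p_def Ge Ve conve Wt m.scaleR ainf.scaleR by (simp add: algebra_simps)
  also have "\<dots> = F2 t - m (V1 t) - ainf (V2 t) - conv mem V2 t" by (simp flip: exp_add)
  finally show ?thesis using D2 by blast
qed

lemma V2_solves: "solves V2 V1 F2"
  unfolding solves_def
proof (intro conjI allI impI V1_continuous F2_continuous)
  show "(V2 has_vector_derivative V1 t) (at t)" for t
    unfolding V2_def[abs_def] V1_def by (rule ramp_has_vector_derivative[OF v0_measurable v0_truncated v0_neg])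
  show "V2 t = 0" if "t \<le> 0" for t
  proof -
    have "max 0 (t - s) *\<^sub>R v0 s = 0" for s using that v0_neg[of s] by (cases "s < 0") auto
    then show ?thesis unfolding V2_def by (simp only: integral_zero)
  qed
qed (use V2_equation in blast)+

end

section \<open>From the primitives back to the solution\<close>

lemma tri_continuous: "continuous_on UNIV tri"
  unfolding tri_def[abs_def] by (intro continuous_intros)

lemma tri_integral_pos: "0 < (\<integral>q. tri (q - 1) \<partial>lborel)"
proof -
  have "(\<integral>q. (1/2) * indicat_real {-1/2..1/2::real} q \<partial>lborel) \<le> (\<integral>q. tri q \<partial>lborel)"
  proof (rule integral_mono[OF _ tri_integrable])
    show "integrable lborel (\<lambda>q. (1/2) * indicat_real {-1/2..1/2::real} q)" by (intro integrable_mult_right) simp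
  qed (auto simp: tri_def indicator_def)
  then show ?thesis by (simp add: lborel_translate(1))
qed

lemma tri_shifted_integrable: "integrable lborel (\<lambda>q. tri (q - 1))"
  by (rule lborel_translate(2)[OF tri_integrable])

context causal_solution
begin

text \<open>A mollifier supported on [0, 2/c], hence causal, whose mass is independent of
  \<open>c\<close>.\<close>

definition tent :: "real \<Rightarrow> real \<Rightarrow> real" where "tent c r = c * tri (c * r - 1)"

lemma tent_integral: "c > 0 \<Longrightarrow> (\<integral>r. tent c r \<partial>lborel) = (\<integral>q. tri (q - 1) \<partial>lborel)"
  and tent_integrable: "c > 0 \<Longrightarrow> integrable lborel (tent c)"
  using lborel_integral_real_affine[of c "\<lambda>q. tri (q - 1)" 0]
    lborel_integrable_real_affine[OF tri_shifted_integrable, of c 0]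
  by (auto simp: tent_def[abs_def])

lemma tent_kernel:
  assumes "c > 0"
  shows "conv_kernel J (\<lambda>r x. tent c r *\<^sub>R x) (tent c) c"
proof (rule scalar_conv_kernel)
  show "tent c \<in> borel_measurable borel" unfolding tent_def[abs_def] by measurable
  show "0 \<le> tent c r" "tent c r \<le> c" for r
    using assms tri_nonneg[of "c * r - 1"] by (auto simp: tent_def tri_def max_def)
  show "integrable lborel (tent c)" by (rule tent_integrable[OF assms])
  show "isCont (tent c) r" for r
  proof -
    have "isCont (\<lambda>r. c * r - 1) r" by (intro continuous_intros)
    moreover have "isCont tri (c * r - 1)" using tri_continuous by (simp add: continuous_on_eq_continuous_at)
    ultimately have "isCont (\<lambda>r. tri (c * r - 1)) r" by (rule isCont_o2)
    then show ?thesis unfolding tent_def[abs_def] by (intro continuous_mult continuous_const)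
  qed
qed

lemma tent_approx:
  assumes t: "isCont v0 t"
  shows "(\<lambda>n. \<integral>s. tent (real (Suc n)) (t - s) *\<^sub>R v0 s \<partial>lborel) \<longlonglongrightarrow> (\<integral>q. tri (q - 1) \<partial>lborel) *\<^sub>R v0 t"
proof -
  \<comment> \<open>No bound for \<open>v0\<close> is available yet, so it is cut off. The causal
    tent looks only at s \<le> t, and cutting at t + 1 leaves a neighbourhood of t
    untouched.\<close>
  define g where "g s = indicat_real {..t+1} s *\<^sub>R v0 s" for s
  obtain B where B: "\<And>s. s \<le> t + 1 \<Longrightarrow> norm (v0 s) \<le> B" using v0_bounded_above by blast
  have "norm (g s) \<le> max 0 B" for s using B[of s] by (auto simp: g_def indicator_def)
  moreover have "isCont g t"
  proof -
    have "eventually (\<lambda>s. g s = v0 s) (nhds t)"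
      using eventually_nhds_in_open[of "{..<t+1}" t] by (auto elim!: eventually_mono simp: g_def)
    then show ?thesis using t by (subst isCont_cong)
  qed
  moreover have "g \<in> borel_measurable borel" unfolding g_def by measurable
  ultimately have lim: "(\<lambda>n. \<integral>q. tri (q - 1) *\<^sub>R g (t - q / real (Suc n)) \<partial>lborel) \<longlonglongrightarrow> (\<integral>q. tri (q - 1) \<partial>lborel) *\<^sub>R g t"
    by (intro approx_identity tri_shifted_integrable)
  have "(\<integral>s. tent c (t - s) *\<^sub>R v0 s \<partial>lborel) = (\<integral>q. tri (q - 1) *\<^sub>R g (t - q / c) \<partial>lborel)" if c: "c > 0" for c
  proof -
    have "tent c (t - (t + (-1/c) * q)) *\<^sub>R v0 (t + (-1/c) * q) = c *\<^sub>R (tri (q - 1) *\<^sub>R g (t - q / c))" for q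
    proof (cases "q \<ge> 0")
      case True
      then have "t - q / c \<le> t + 1" using c by (simp add: add_increasing2 divide_nonneg_pos algebra_simps)
      then show ?thesis using c by (simp add: tent_def g_def)
    qed (use c in \<open>simp add: tent_def tri_def\<close>)
    then show ?thesis
      using c by (subst lborel_integral_real_affine[of "-1/c" _ t]) (simp_all flip: integral_scaleR_right)
  qed
  then show ?thesis using lim by (simp add: g_def)
qed

definition modulus :: "real \<Rightarrow> real" where "modulus h = (\<integral>s. norm (f0 s - f0 (s - h)) \<partial>lborel)"

lemma f0_diff_integrable: "integrable lborel (\<lambda>s. f0 s - f0 (s - h))"
  using f0_integrable lborel_translate(2)[OF f0_integrable] by simp

lemma modulus_minus: "modulus (- h) = modulus h"
  using lborel_translate(1)[of "\<lambda>s. norm (f0 s - f0 (s - - h))" h]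
  by (simp add: modulus_def norm_minus_commute)

lemma modulus_bound: "modulus h \<le> 2 * (\<integral>s. norm (f0 s) \<partial>lborel)"
proof -
  have "modulus h \<le> (\<integral>s. norm (f0 s) + norm (f0 (s - h)) \<partial>lborel)"
    unfolding modulus_def using f0_integrable lborel_translate(2)[OF f0_integrable] f0_diff_integrable
    by (intro integral_mono) (auto intro: norm_triangle_ineq4)
  also have "\<dots> = (\<integral>s. norm (f0 s) \<partial>lborel) + (\<integral>s. norm (f0 (s - h)) \<partial>lborel)"
    using f0_integrable lborel_translate(2)[OF f0_integrable] by simp
  finally show ?thesis using lborel_translate(1)[of "\<lambda>s. norm (f0 s)" h] by simp
qed

lemma modulus_nonneg: "0 \<le> modulus h"
  unfolding modulus_def by simp

text \<open>The energy bound applied to the shift difference of tent averages, whose source has L1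
  norm at most the tent mass times the modulus of \<open>f0\<close>. Letting the tents shrink and
  cancelling their mass gives the claim at continuity points.\<close>

lemma difference_bound:
  assumes t: "t > 0" and h: "h \<ge> 0" "t \<noteq> h"
  shows "\<delta> * norm (v0 t - v0 (t - h)) \<le> 2 * modulus h"
proof -
  define \<tau> where "\<tau> = (\<integral>q. tri (q - 1) \<partial>lborel)"
  have \<tau>: "\<tau> > 0" unfolding \<tau>_def by (rule tri_integral_pos)
  define T where "T c x t = (\<integral>s. tent c (t - s) *\<^sub>R x s \<partial>lborel)" for c and x :: "real \<Rightarrow> 'h" and t
  have step: "\<delta> * norm (T c v0 t - T c v0 (t - h)) \<le> 2 * (\<tau> * modulus h)" if c: "c > 0" for c
  proof -
    interpret k: conv_kernel J "\<lambda>r x. tent c r *\<^sub>R x" "tent c" c by (rule tent_kernel[OF c])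
    have c': "1 / c \<ge> 0" using c by simp
    have Tv: "T c v0 = (\<lambda>t. c *\<^sub>R (c *\<^sub>R (V2 t - V2 (t - 1/c)) - c *\<^sub>R (V2 (t - 1/c) - V2 (t - 1/c - 1/c))))"
      and Tf: "T c f0 = (\<lambda>t. c *\<^sub>R (c *\<^sub>R (F2 t - F2 (t - 1/c)) - c *\<^sub>R (F2 (t - 1/c) - F2 (t - 1/c - 1/c))))"
      unfolding V2_def F2_def T_def tent_def
      using tent_second_difference[OF max_v0_integrable c] tent_second_difference[OF max_f0_integrable c] by auto
    \<comment> \<open>Two difference quotients of the double primitive form the tent average; a
      third difference, with shift h, follows.\<close>
    obtain u' where "solves (T c v0) u' (T c f0)"
      unfolding Tv Tf using solves_diff_shift[OF solves_diff_shift[OF V2_solves c'] c'] by blast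
    from solves_diff_shift[OF this h(1), of 1]
    obtain u'' where sol: "solves (\<lambda>t. T c v0 t - T c v0 (t - h)) u'' (\<lambda>t. T c f0 t - T c f0 (t - h))" by auto
    have Tf_conv: "T c f0 t - T c f0 (t - h) = conv (\<lambda>r x. tent c r *\<^sub>R x) (\<lambda>s. f0 s - f0 (s - h)) t" for t
    proof -
      have "T c f0 (t - h) = (\<integral>s. tent c (t - s) *\<^sub>R f0 (s - h) \<partial>lborel)"
        using lborel_translate(1)[of "\<lambda>s. tent c (t - h - s) *\<^sub>R f0 s" h] by (simp add: T_def algebra_simps)
      then show ?thesis
        using k.conv_integrand[OF f0_integrable, of t] k.conv_integrand[OF lborel_translate(2)[OF f0_integrable, of h], of t]
        by (simp add: T_def conv_def scaleR_diff_right)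
    qed
    have ci: "integrable lborel (\<lambda>t. norm (T c f0 t - T c f0 (t - h)))"
      unfolding Tf_conv using k.conv_integrable[OF f0_diff_integrable] by simp
    have "\<delta> * norm (T c v0 t - T c v0 (t - h)) \<le> 2 * (\<integral>s. indicat_real {0..t} s * norm (T c f0 s - T c f0 (s - h)) \<partial>lborel)"
      using energy_bound[OF sol, of t] t by simp
    also have "\<dots> \<le> 2 * (\<integral>s. norm (T c f0 s - T c f0 (s - h)) \<partial>lborel)"
    proof (intro mult_left_mono integral_mono ci)
      show "integrable lborel (\<lambda>s. indicat_real {0..t} s * norm (T c f0 s - T c f0 (s - h)))"
        by (rule Bochner_Integration.integrable_bound[OF ci]) (use ci in \<open>auto simp: indicator_def\<close>)
    qed (auto simp: indicator_def)
    also have "\<dots> \<le> 2 * (\<tau> * modulus h)"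
      unfolding Tf_conv modulus_def \<tau>_def
      using k.conv_L1_bound[OF f0_diff_integrable, of h] tent_integral[OF c] by simp
    finally show ?thesis .
  qed
  have lim: "(\<lambda>n. \<delta> * norm (T (real (Suc n)) v0 t - T (real (Suc n)) v0 (t - h))) \<longlonglongrightarrow> \<delta> * norm (\<tau> *\<^sub>R v0 t - \<tau> *\<^sub>R v0 (t - h))"
    unfolding T_def \<tau>_def using t h by (intro tendsto_intros tent_approx v0_isCont) auto
  have "\<delta> * norm (\<tau> *\<^sub>R v0 t - \<tau> *\<^sub>R v0 (t - h)) \<le> 2 * (\<tau> * modulus h)"
    by (rule LIMSEQ_le_const2[OF lim]) (use step in auto)
  also have "norm (\<tau> *\<^sub>R v0 t - \<tau> *\<^sub>R v0 (t - h)) = \<tau> * norm (v0 t - v0 (t - h))"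
    using \<tau> by (simp flip: scaleR_diff_right)
  finally have "\<tau> * (\<delta> * norm (v0 t - v0 (t - h))) \<le> \<tau> * (2 * modulus h)" by (simp add: mult_ac)
  then show ?thesis using \<tau> by simp
qed

definition F1 :: real where "F1 = (\<integral>s. norm (f0 s) \<partial>lborel)"

lemma F1_nonneg: "0 \<le> F1" by (simp add: F1_def)

lemma v0_bound: "t \<noteq> 0 \<Longrightarrow> norm (v0 t) \<le> 4 * F1 / \<delta>"
proof (cases "t > 0")
  case True
  \<comment> \<open>Shifting by more than t reaches negative times, where \<open>v0\<close> is 0;
    the bound for \<open>v0\<close> itself is thus a case of the difference bound.\<close>
  have "\<delta> * norm (v0 t - v0 (t - (t + 1))) \<le> 2 * modulus (t + 1)"
    using True by (intro difference_bound) auto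
  then have "\<delta> * norm (v0 t) \<le> 4 * F1" using modulus_bound[of "t + 1"] by (simp add: v0_neg F1_def)
  then show ?thesis using \<delta> by (simp add: field_simps)
next
  case False
  moreover assume "t \<noteq> 0"
  ultimately show ?thesis using \<delta> F1_nonneg by (simp add: v0_neg)
qed

lemma two_sided_difference_bound:
  assumes t: "t > 0" "t \<noteq> h"
  shows "\<delta> * norm (v0 t - v0 (t - h)) \<le> 2 * modulus h"
proof (cases "h \<ge> 0")
  case True
  then show ?thesis using difference_bound t by blast
next
  case False
  \<comment> \<open>For negative h the later time is t - h, so the two points exchange
    roles.\<close>
  then have "\<delta> * norm (v0 (t - h) - v0 (t - h - - h)) \<le> 2 * modulus (- h)"
    using t by (intro difference_bound) auto
  then show ?thesis by (simp add: modulus_minus norm_minus_commute)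
qed

text \<open>The approximate identity at the point 0, where the modulus vanishes and is continuous;
  evenness of the modulus removes the sign of the shift.\<close>

lemma modulus_smoothing: "(\<lambda>n. \<integral>q. fejer q * modulus (q / real (Suc n)) \<partial>lborel) \<longlonglongrightarrow> 0"
proof -
  have "(\<lambda>n. \<integral>q. fejer q *\<^sub>R modulus (0 - q / real (Suc n)) \<partial>lborel) \<longlonglongrightarrow> (\<integral>q. fejer q \<partial>lborel) *\<^sub>R modulus 0"
  proof (rule approx_identity[OF fejer_integrable])
    show "modulus \<in> borel_measurable borel" unfolding modulus_def[abs_def] by measurable
    show "norm (modulus s) \<le> 2 * (\<integral>s. norm (f0 s) \<partial>lborel)" for s
      using modulus_bound modulus_nonneg by simp
    have "modulus = (\<lambda>h. \<integral>s. norm (f0 (s - h) - f0 s) \<partial>lborel)"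
      by (rule ext) (simp add: modulus_def norm_minus_commute)
    then have "(modulus \<longlongrightarrow> 0) (at 0)"
      using L1_translation_continuous[OF f0_integrable] by simp
    then show "isCont modulus 0" by (simp add: isCont_def modulus_def)
  qed
  then show ?thesis by (simp add: modulus_minus) (simp add: modulus_def)
qed

lemma fejer_v0_integrable: "R > 0 \<Longrightarrow> integrable lborel (\<lambda>q. fejer q *\<^sub>R v0 (t - q / R))"
proof (rule Bochner_Integration.integrable_bound)
  assume R: "R > 0"
  show "integrable lborel (\<lambda>q. fejer q * (4 * F1 / \<delta>))" using fejer_integrable by simp
  show "AE q in lborel. norm (fejer q *\<^sub>R v0 (t - q / R)) \<le> norm (fejer q * (4 * F1 / \<delta>))"
    using AE_lborel_singleton[of "t * R"]
  proof eventually_elim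
    case (elim q)
    then have "t - q / R \<noteq> 0" using R by (simp add: field_simps)
    from mult_left_mono[OF v0_bound[OF this] fejer_nonneg[of q]]
    show ?case using \<delta> F1_nonneg fejer_nonneg[of q] by simp
  qed
qed measurable

text \<open>The error bound does not depend on t: smoothing is uniformly harmless over all positive
  times.\<close>

lemma fejer_approx_v0:
  assumes t: "t > 0" and R: "R > 0"
  shows "norm (fejer_mass *\<^sub>R v0 t - (\<integral>q. fejer q *\<^sub>R v0 (t - q / R) \<partial>lborel)) \<le> 2 / \<delta> * (\<integral>q. fejer q * modulus (q / R) \<partial>lborel)"
proof -
  have mi: "integrable lborel (\<lambda>q. fejer q * modulus (q / R))"
  proof (rule Bochner_Integration.integrable_bound)
    show "integrable lborel (\<lambda>q. fejer q * (2 * (\<integral>s. norm (f0 s) \<partial>lborel)))" using fejer_integrable by simp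
    show "AE q in lborel. norm (fejer q * modulus (q / R)) \<le> norm (fejer q * (2 * (\<integral>s. norm (f0 s) \<partial>lborel)))"
      using modulus_bound modulus_nonneg fejer_nonneg by (intro AE_I2) (auto simp: abs_mult intro!: mult_left_mono)
    show "(\<lambda>q. fejer q * modulus (q / R)) \<in> borel_measurable lborel" unfolding modulus_def[abs_def] by measurable
  qed
  have i: "integrable lborel (\<lambda>q. fejer q *\<^sub>R v0 t - fejer q *\<^sub>R v0 (t - q / R))"
    using fejer_v0_integrable[OF R] fejer_integrable by (intro Bochner_Integration.integrable_diff) auto
  have "fejer_mass *\<^sub>R v0 t - (\<integral>q. fejer q *\<^sub>R v0 (t - q / R) \<partial>lborel) = (\<integral>q. fejer q *\<^sub>R v0 t - fejer q *\<^sub>R v0 (t - q / R) \<partial>lborel)"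
    using fejer_v0_integrable[OF R] fejer_integrable by (simp add: fejer_mass_def)
  also have "norm \<dots> \<le> (\<integral>q. norm (fejer q *\<^sub>R v0 t - fejer q *\<^sub>R v0 (t - q / R)) \<partial>lborel)"
    by (rule integral_norm_bound)
  also have "\<dots> \<le> (\<integral>q. 2 / \<delta> * (fejer q * modulus (q / R)) \<partial>lborel)"
  proof (rule integral_mono_AE)
    show "AE q in lborel. norm (fejer q *\<^sub>R v0 t - fejer q *\<^sub>R v0 (t - q / R)) \<le> 2 / \<delta> * (fejer q * modulus (q / R))"
      using AE_lborel_singleton[of "t * R"]
    proof eventually_elim
      case (elim q)
      have "t \<noteq> q / R" using elim R by (simp add: field_simps)
      from two_sided_difference_bound[OF t this]
      have "norm (v0 t - v0 (t - q / R)) \<le> 2 / \<delta> * modulus (q / R)" using \<delta> by (simp add: field_simps)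
      from mult_left_mono[OF this fejer_nonneg[of q]]
      show ?case using fejer_nonneg[of q] by (simp add: mult_ac flip: scaleR_diff_right)
    qed
  qed (use i mi in auto)
  finally show ?thesis by simp
qed

section \<open>Almost orthogonal exponentials and decay\<close>

lemma phase_sum_norm:
  fixes x :: "nat \<Rightarrow> 'h"
  shows "(norm (\<Sum>k<K. cscale J (cis (\<omega> * T k)) (x k)))\<^sup>2
    = (\<Sum>j<K. \<Sum>k<K. cos (\<omega> * (T k - T j)) * inner (x j) (x k) + sin (\<omega> * (T k - T j)) * inner (x j) (J (x k)))"
  by (simp add: power2_norm_eq_inner inner_sum_left inner_sum_right inner_cscale_cis right_diff_distrib)
    (rule sum.swap)

text \<open>Expansion into Gram entries: on the diagonal at most the mass of \<open>g\<close>, off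
  the diagonal at most \<open>e\<close> from the cosine plus \<open>e\<close> from the sine.\<close>

lemma phase_sum_bound:
  fixes x :: "nat \<Rightarrow> 'h"
  assumes g: "integrable lborel g" and x: "\<And>k. norm (x k) \<le> 1"
    and c: "\<And>j k. j < K \<Longrightarrow> k < K \<Longrightarrow> j \<noteq> k \<Longrightarrow> \<bar>\<integral>\<omega>. g \<omega> * cos (\<omega> * (T k - T j)) \<partial>lborel\<bar> \<le> e"
    and s: "\<And>j k. j < K \<Longrightarrow> k < K \<Longrightarrow> j \<noteq> k \<Longrightarrow> \<bar>\<integral>\<omega>. g \<omega> * sin (\<omega> * (T k - T j)) \<partial>lborel\<bar> \<le> e"
    and e: "e \<ge> 0" and gn: "0 \<le> (\<integral>\<omega>. g \<omega> \<partial>lborel)"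
  defines "P \<equiv> \<lambda>\<omega>. \<Sum>k<K. cscale J (cis (\<omega> * T k)) (x k)"
  shows "integrable lborel (\<lambda>\<omega>. g \<omega> * (norm (P \<omega>))\<^sup>2)"
    and "(\<integral>\<omega>. g \<omega> * (norm (P \<omega>))\<^sup>2 \<partial>lborel) \<le> real K * (\<integral>\<omega>. g \<omega> \<partial>lborel) + (real K)\<^sup>2 * (2 * e)"
proof -
  define G where "G = (\<integral>\<omega>. g \<omega> \<partial>lborel)"
  have [measurable]: "g \<in> borel_measurable borel" using g by auto
  have ic: "integrable lborel (\<lambda>\<omega>. g \<omega> * cos (\<omega> * a))" and isn: "integrable lborel (\<lambda>\<omega>. g \<omega> * sin (\<omega> * a))" for a
    by (rule Bochner_Integration.integrable_bound[OF g]; auto simp: abs_mult intro!: mult_left_le)+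
  define E where "E j k \<omega> = g \<omega> * cos (\<omega> * (T k - T j)) * inner (x j) (x k) + g \<omega> * sin (\<omega> * (T k - T j)) * inner (x j) (J (x k))" for j k \<omega>
  have iE: "integrable lborel (E j k)" for j k unfolding E_def using ic isn by (intro Bochner_Integration.integrable_add integrable_mult_left) auto
  have PE: "g \<omega> * (norm (P \<omega>))\<^sup>2 = (\<Sum>j<K. \<Sum>k<K. E j k \<omega>)" for \<omega>
    unfolding P_def phase_sum_norm E_def by (simp add: sum_distrib_left algebra_simps)
  show "integrable lborel (\<lambda>\<omega>. g \<omega> * (norm (P \<omega>))\<^sup>2)" unfolding PE using iE by auto
  have ip1: "\<bar>inner (x j) (x k)\<bar> \<le> 1" and ip2: "\<bar>inner (x j) (J (x k))\<bar> \<le> 1" for j k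
    using Cauchy_Schwarz_ineq2[of "x j" "x k"] Cauchy_Schwarz_ineq2[of "x j" "J (x k)"] mult_mono[OF x[of j] x[of k]]
    by simp_all
  \<comment> \<open>The summand 2 e is granted on the diagonal too, so the double sum is K times the
    mass plus K^2 times 2 e.\<close>
  have Ejk: "(\<integral>\<omega>. E j k \<omega> \<partial>lborel) \<le> (if j = k then G else 0) + 2 * e" if jk: "j < K" "k < K" for j k
  proof (cases "j = k")
    case True
    have "(\<integral>\<omega>. E j k \<omega> \<partial>lborel) = G * inner (x j) (x j)" by (simp add: True E_def G_def)
    also have "\<dots> \<le> G" using ip1[of j j] gn by (intro mult_left_le) (auto simp: G_def)
    finally show ?thesis using True e by simp
  next
    case False
    have "(\<integral>\<omega>. E j k \<omega> \<partial>lborel) = (\<integral>\<omega>. g \<omega> * cos (\<omega> * (T k - T j)) \<partial>lborel) * inner (x j) (x k) + (\<integral>\<omega>. g \<omega> * sin (\<omega> * (T k - T j)) \<partial>lborel) * inner (x j) (J (x k))"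
      unfolding E_def using ic isn by simp
    also have "\<dots> \<le> e * 1 + e * 1"
    proof (intro add_mono)
      show "(\<integral>\<omega>. g \<omega> * cos (\<omega> * (T k - T j)) \<partial>lborel) * inner (x j) (x k) \<le> e * 1"
        using mult_mono[OF c[OF jk False] ip1[of j k]] e by (auto simp flip: abs_mult)
      show "(\<integral>\<omega>. g \<omega> * sin (\<omega> * (T k - T j)) \<partial>lborel) * inner (x j) (J (x k)) \<le> e * 1"
        using mult_mono[OF s[OF jk False] ip2[of j k]] e by (auto simp flip: abs_mult)
    qed
    finally show ?thesis using False by simp
  qed
  have "(\<integral>\<omega>. g \<omega> * (norm (P \<omega>))\<^sup>2 \<partial>lborel) = (\<Sum>j<K. \<Sum>k<K. \<integral>\<omega>. E j k \<omega> \<partial>lborel)"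
    unfolding PE using iE by (simp add: Bochner_Integration.integral_sum)
  also have "\<dots> \<le> (\<Sum>j<K. \<Sum>k<K. (if j = k then G else 0) + 2 * e)"
    by (intro sum_mono Ejk) auto
  also have "\<dots> = real K * G + (real K)\<^sup>2 * (2 * e)"
    by (simp add: sum.distrib power2_eq_square algebra_simps)
  finally show "(\<integral>\<omega>. g \<omega> * (norm (P \<omega>))\<^sup>2 \<partial>lborel) \<le> real K * (\<integral>\<omega>. g \<omega> \<partial>lborel) + (real K)\<^sup>2 * (2 * e)"
    by (simp add: G_def)
qed

text \<open>If the smoothed solution had norm at least c at widely spaced times \<open>T 0, ..., T (K-1)\<close>, pairing with
  the unit vectors \<open>x k\<close> would give \<open>K c\<close> at most \<open>F1\<close> times the integral of g |P|, where P is the phase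
  sum; by almost orthogonality the integral of g |P|^2 is \<open>O(K)\<close> up to a small multiple of \<open>K^2\<close>, which is a
  contradiction for large K.\<close>

lemma smoothed_decay:
  assumes R: "R > 0" and g: "integrable lborel g" and g0: "\<And>\<omega>. 0 \<le> g \<omega>"
    and bd: "AE \<omega> in lborel. \<forall>\<eta>. 0 < \<eta> \<longrightarrow> \<eta> < 1 \<longrightarrow> \<bar>\<omega>\<bar> \<le> R \<longrightarrow> norm (vhat \<eta> \<omega>) \<le> g \<omega> * F1"
  shows "((\<lambda>t. \<integral>q. fejer q *\<^sub>R v0 (t - q / R) \<partial>lborel) \<longlongrightarrow> 0) at_top"
proof (rule ccontr)
  have [measurable]: "g \<in> borel_measurable borel" using g by auto
  define Jm where "Jm t = (\<integral>q. fejer q *\<^sub>R v0 (t - q / R) \<partial>lborel)" for t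
  define G where "G = (\<integral>\<omega>. g \<omega> \<partial>lborel)"
  have G0: "G \<ge> 0" unfolding G_def using g0 by simp
  assume "\<not> ?thesis"
  then obtain c where c: "c > 0" and freq: "\<And>T. \<exists>t\<ge>T. c \<le> norm (Jm t)"
    unfolding tendsto_iff eventually_at_top_linorder Jm_def by (auto simp: not_less)
  \<comment> \<open>The constants \<open>\<sigma>\<close>, \<open>e\<close> and \<open>K\<close> are
    chosen so that each of the three error terms at the end is at most c / 4, whose sum stays below
    c. The summands 1 in the denominators guard against F1 = 0 or G = 0.\<close>
  define \<sigma> where "\<sigma> = c / (2 * (F1 * G + 1))"
  have FG: "F1 * G \<ge> 0" using F1_nonneg G0 by simp
  have \<sigma>: "\<sigma> > 0" unfolding \<sigma>_def using c FG by (intro divide_pos_pos) auto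
  define e where "e = \<sigma> * c / (4 * (F1 + 1))"
  have e: "e > 0" unfolding e_def using \<sigma> c F1_nonneg by (intro divide_pos_pos mult_pos_pos) auto
  define K where "K = Suc (nat \<lceil>2 * F1 * G / (\<sigma> * c)\<rceil>)"
  have K: "real K > 0" "2 * F1 * G / (\<sigma> * c) \<le> real K" unfolding K_def by (auto, linarith)
  obtain T0 where T0: "T0 > 0" "\<And>t. \<bar>t\<bar> \<ge> T0 \<Longrightarrow> \<bar>\<integral>\<omega>. g \<omega> * cos (\<omega> * t) \<partial>lborel\<bar> \<le> e"
    "\<And>t. \<bar>t\<bar> \<ge> T0 \<Longrightarrow> \<bar>\<integral>\<omega>. g \<omega> * sin (\<omega> * t) \<partial>lborel\<bar> \<le> e"
    using Riemann_Lebesgue[OF g e] by blast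
  obtain pick where pick: "\<And>T. pick T \<ge> T" "\<And>T. c \<le> norm (Jm (pick T))" using freq by metis
  \<comment> \<open>Each new time lies at least T0 after the previous one and keeps the smoothed
    solution above c.\<close>
  define T where "T = rec_nat (pick 0) (\<lambda>_ s. pick (s + T0))"
  have T_Suc: "T (Suc k) = pick (T k + T0)" and T_0: "T 0 = pick 0" for k by (simp_all add: T_def)
  have Tc: "c \<le> norm (Jm (T k))" for k by (cases k) (simp_all add: T_Suc T_0 pick)
  have Tmono: "T j + T0 \<le> T k" if "j < k" for j k
    using that
  proof (induction k)
    case (Suc k)
    have "T k + T0 \<le> T (Suc k)" by (simp add: T_Suc pick)
    then show ?case using Suc T0(1) by (cases "j = k") auto
  qed simp
  have Tsep: "\<bar>T k - T j\<bar> \<ge> T0" if "j \<noteq> k" for j k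
    using that Tmono[of j k] Tmono[of k j] by (cases "j < k") auto
  define x where "x k = (1 / norm (Jm (T k))) *\<^sub>R Jm (T k)" for k
  have xn: "norm (x k) \<le> 1" for k by (simp add: x_def)
  have xJ: "inner (x k) (Jm (T k)) = norm (Jm (T k))" for k
    by (simp add: x_def dot_square_norm power2_eq_square)
  define P where "P \<omega> = (\<Sum>k<K. cscale J (cis (\<omega> * T k)) (x k))" for \<omega>
  have [measurable]: "P \<in> borel_measurable borel" unfolding P_def by measurable
  have iP2: "integrable lborel (\<lambda>\<omega>. g \<omega> * (norm (P \<omega>))\<^sup>2)"
    and P2: "(\<integral>\<omega>. g \<omega> * (norm (P \<omega>))\<^sup>2 \<partial>lborel) \<le> real K * G + (real K)\<^sup>2 * (2 * e)"
    unfolding P_def G_def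
    by (rule phase_sum_bound[where e=e]; use g xn T0(2,3) Tsep e G0 in \<open>auto simp: G_def\<close>)+
  have PK: "norm (P \<omega>) \<le> real K" for \<omega>
  proof -
    have "norm (P \<omega>) \<le> (\<Sum>k<K. 1)" unfolding P_def by (rule sum_norm_le) (simp add: xn)
    then show ?thesis by simp
  qed
  have iP: "integrable lborel (\<lambda>\<omega>. g \<omega> * norm (P \<omega>))"
    by (rule Bochner_Integration.integrable_bound[where f="\<lambda>\<omega>. real K * g \<omega>"])
       (use g g0 PK in \<open>auto simp: abs_mult mult.commute[of "g _"] intro!: AE_I2 mult_right_mono\<close>)
  have Plin: "(\<integral>\<omega>. g \<omega> * norm (P \<omega>) \<partial>lborel) \<le> real K * (\<sigma> * G / 2 + G / (2 * real K * \<sigma>) + e / \<sigma>)"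
  proof -
    \<comment> \<open>Weight for |P| \<le> \<tau> / 2 + |P|^2 / (2 \<tau>). Taking it proportional
      to K makes the diagonal part of the integral of |P|^2, of order K, negligible against K after
      division.\<close>
    define \<tau> where "\<tau> = real K * \<sigma>"
    have \<tau>: "\<tau> > 0" using K \<sigma> by (simp add: \<tau>_def)
    have "(\<integral>\<omega>. g \<omega> * norm (P \<omega>) \<partial>lborel) \<le> (\<integral>\<omega>. (\<tau> / 2) * g \<omega> + (1 / (2 * \<tau>)) * (g \<omega> * (norm (P \<omega>))\<^sup>2) \<partial>lborel)"
    proof (rule integral_mono[OF iP])
      fix \<omega>
      have "0 \<le> (norm (P \<omega>) - \<tau>)\<^sup>2" by simp
      then have "2 * \<tau> * norm (P \<omega>) \<le> \<tau> * \<tau> + (norm (P \<omega>))\<^sup>2" by (simp add: power2_eq_square algebra_simps)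
      then have "norm (P \<omega>) \<le> \<tau> / 2 + (norm (P \<omega>))\<^sup>2 / (2 * \<tau>)" using \<tau> by (simp add: field_simps)
      from mult_left_mono[OF this g0[of \<omega>]]
      show "g \<omega> * norm (P \<omega>) \<le> (\<tau> / 2) * g \<omega> + (1 / (2 * \<tau>)) * (g \<omega> * (norm (P \<omega>))\<^sup>2)" by (simp add: algebra_simps)
    qed (use g iP2 in auto)
    also have "\<dots> = (\<tau> / 2) * G + (1 / (2 * \<tau>)) * (\<integral>\<omega>. g \<omega> * (norm (P \<omega>))\<^sup>2 \<partial>lborel)"
      unfolding G_def using g iP2 by (simp del: times_divide_eq_left times_divide_eq_right)
    also have "\<dots> \<le> (\<tau> / 2) * G + (1 / (2 * \<tau>)) * (real K * G + (real K)\<^sup>2 * (2 * e))"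
      using \<tau> by (intro add_left_mono mult_left_mono P2) auto
    also have "\<dots> = real K * (\<sigma> * G / 2 + G / (2 * real K * \<sigma>) + e / \<sigma>)"
      using K \<sigma> unfolding \<tau>_def by (simp add: field_simps power2_eq_square)
    finally show ?thesis .
  qed
  \<comment> \<open>The damping 1 / (n + 2) lies in (0,1), as the hypothesis on \<open>vhat\<close>
    requires, and tends to 0.\<close>
  define z where "z n s = exp (- (1 / real (n + 2)) * s) *\<^sub>R v0 s" for n s
  define Jn where "Jn n t = (\<integral>s. (R * fejer (R * (t - s))) *\<^sub>R z n s \<partial>lborel)" for n t
  have zi: "integrable lborel (z n)" for n unfolding z_def[abs_def] by (intro v0_weighted_integrable) simp
  have vh: "ft (z n) = vhat (1 / real (n + 2))" for n by (simp add: z_def[abs_def] vhat_def)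
  have JnJ: "(\<lambda>n. Jn n t) \<longlonglongrightarrow> Jm t" for t
  proof -
    have "(\<lambda>n. \<integral>q. fejer q *\<^sub>R z n (t - q / R) \<partial>lborel) \<longlonglongrightarrow> Jm t"
      unfolding Jm_def
    proof (rule integral_dominated_convergence[where w="\<lambda>q. norm (fejer q *\<^sub>R v0 (t - q / R))"])
      show "AE q in lborel. (\<lambda>n. fejer q *\<^sub>R z n (t - q / R)) \<longlonglongrightarrow> fejer q *\<^sub>R v0 (t - q / R)"
      proof (rule AE_I2)
        fix q :: real
        have "(\<lambda>n. 1 / real (n + 2)) \<longlonglongrightarrow> 0"
          using LIMSEQ_ignore_initial_segment[OF lim_1_over_n, of 2] by simp
        then have "(\<lambda>n. fejer q *\<^sub>R z n (t - q / R)) \<longlonglongrightarrow> fejer q *\<^sub>R (exp (- 0 * (t - q / R)) *\<^sub>R v0 (t - q / R))"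
          unfolding z_def by (intro tendsto_intros)
        then show "(\<lambda>n. fejer q *\<^sub>R z n (t - q / R)) \<longlonglongrightarrow> fejer q *\<^sub>R v0 (t - q / R)" by simp
      qed
      show "AE q in lborel. norm (fejer q *\<^sub>R z n (t - q / R)) \<le> norm (fejer q *\<^sub>R v0 (t - q / R))" for n
      proof (rule AE_I2)
        fix q
        have "norm (z n s) \<le> norm (v0 s)" for s
          by (cases "s < 0") (auto simp: z_def v0_neg intro!: mult_left_le_one_le)
        then show "norm (fejer q *\<^sub>R z n (t - q / R)) \<le> norm (fejer q *\<^sub>R v0 (t - q / R))"
          by (simp add: mult_left_mono)
      qed
      show "integrable lborel (\<lambda>q. norm (fejer q *\<^sub>R v0 (t - q / R)))" by (intro integrable_norm fejer_v0_integrable R)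
    qed (simp_all add: z_def)
    then show ?thesis by (simp add: Jn_def fejer_subst[OF R])
  qed
  \<comment> \<open>The bound is the same for every damping, so the damping can be removed
    afterwards on the time side by \<open>JnJ\<close>.\<close>
  have Jn_bound: "(\<Sum>k<K. inner (x k) (Jn n (T k))) \<le> F1 * (\<integral>\<omega>. g \<omega> * norm (P \<omega>) \<partial>lborel)" for n
  proof -
    have zm: "z n \<in> borel_measurable borel" using zi[of n] by auto
    have i: "integrable lborel (\<lambda>\<omega>. tri (\<omega> / R) * inner (cscale J (cis (\<omega> * T k)) (x k)) (ft (z n) \<omega>))" for k
    proof (rule Bochner_Integration.integrable_bound[where f="\<lambda>\<omega>. tri (\<omega> / R) * (\<integral>s. norm (z n s) \<partial>lborel)"])
      show "AE \<omega> in lborel. norm (tri (\<omega> / R) * inner (cscale J (cis (\<omega> * T k)) (x k)) (ft (z n) \<omega>)) \<le> norm (tri (\<omega> / R) * (\<integral>s. norm (z n s) \<partial>lborel))"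
      proof (rule AE_I2)
        fix \<omega>
        have "\<bar>inner (cscale J (cis (\<omega> * T k)) (x k)) (ft (z n) \<omega>)\<bar> \<le> norm (x k) * norm (ft (z n) \<omega>)"
          using Cauchy_Schwarz_ineq2[of "cscale J (cis (\<omega> * T k)) (x k)" "ft (z n) \<omega>"] by simp
        also have "\<dots> \<le> 1 * (\<integral>s. norm (z n s) \<partial>lborel)" by (intro mult_mono xn ft_bound zi) auto
        finally show "norm (tri (\<omega> / R) * inner (cscale J (cis (\<omega> * T k)) (x k)) (ft (z n) \<omega>)) \<le> norm (tri (\<omega> / R) * (\<integral>s. norm (z n s) \<partial>lborel))"
          by (simp add: abs_mult mult_left_mono)
      qed
      show "integrable lborel (\<lambda>\<omega>. tri (\<omega> / R) * (\<integral>s. norm (z n s) \<partial>lborel))"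
        using tri_scaled_integrable[OF R] by simp
      show "(\<lambda>\<omega>. tri (\<omega> / R) * inner (cscale J (cis (\<omega> * T k)) (x k)) (ft (z n) \<omega>)) \<in> borel_measurable lborel"
        using ft_measurable[OF zm] by measurable
    qed
    have "(\<Sum>k<K. inner (x k) (Jn n (T k))) = (\<Sum>k<K. \<integral>\<omega>. tri (\<omega> / R) * inner (cscale J (cis (\<omega> * T k)) (x k)) (ft (z n) \<omega>) \<partial>lborel)"
      unfolding Jn_def by (simp only: fejer_representation[OF zi R])
    also have "\<dots> = (\<integral>\<omega>. (\<Sum>k<K. tri (\<omega> / R) * inner (cscale J (cis (\<omega> * T k)) (x k)) (ft (z n) \<omega>)) \<partial>lborel)"
      using i by (intro Bochner_Integration.integral_sum[symmetric])
    also have "\<dots> = (\<integral>\<omega>. tri (\<omega> / R) * inner (P \<omega>) (ft (z n) \<omega>) \<partial>lborel)"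
      by (simp add: P_def inner_sum_left sum_distrib_left)
    also have "\<dots> \<le> (\<integral>\<omega>. F1 * (g \<omega> * norm (P \<omega>)) \<partial>lborel)"
    proof (rule integral_mono_AE)
      have "integrable lborel (\<lambda>\<omega>. \<Sum>k<K. tri (\<omega> / R) * inner (cscale J (cis (\<omega> * T k)) (x k)) (ft (z n) \<omega>))"
        using i by (intro Bochner_Integration.integrable_sum)
      then show "integrable lborel (\<lambda>\<omega>. tri (\<omega> / R) * inner (P \<omega>) (ft (z n) \<omega>))"
        by (simp add: P_def inner_sum_left sum_distrib_left)
      show "integrable lborel (\<lambda>\<omega>. F1 * (g \<omega> * norm (P \<omega>)))" using iP by simp
      show "AE \<omega> in lborel. tri (\<omega> / R) * inner (P \<omega>) (ft (z n) \<omega>) \<le> F1 * (g \<omega> * norm (P \<omega>))"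
        using bd
      proof eventually_elim
        case (elim \<omega>)
        show ?case
        proof (cases "\<bar>\<omega>\<bar> \<le> R")
          case True
          have "norm (ft (z n) \<omega>) \<le> g \<omega> * F1" unfolding vh using elim True by auto
          then have "norm (P \<omega>) * norm (ft (z n) \<omega>) \<le> norm (P \<omega>) * (g \<omega> * F1)" by (intro mult_left_mono) auto
          then have "inner (P \<omega>) (ft (z n) \<omega>) \<le> F1 * (g \<omega> * norm (P \<omega>))"
            using norm_cauchy_schwarz[of "P \<omega>" "ft (z n) \<omega>"] by (simp add: mult_ac)
          then have "tri (\<omega> / R) * inner (P \<omega>) (ft (z n) \<omega>) \<le> tri (\<omega> / R) * (F1 * (g \<omega> * norm (P \<omega>)))"
            by (intro mult_left_mono tri_nonneg)
          also have "\<dots> \<le> F1 * (g \<omega> * norm (P \<omega>))"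
            using F1_nonneg g0 by (intro mult_left_le_one_le tri_nonneg) (auto simp: tri_def)
          finally show ?thesis .
        next
          case False
          \<comment> \<open>Frequencies beyond R, where no bound is available, are removed by the
            triangle.\<close>
          then have "tri (\<omega> / R) = 0" using R by (simp add: tri_def field_simps)
          then show ?thesis using F1_nonneg g0 by simp
        qed
      qed
    qed
    finally show ?thesis by simp
  qed
  have "(\<lambda>n. \<Sum>k<K. inner (x k) (Jn n (T k))) \<longlonglongrightarrow> (\<Sum>k<K. inner (x k) (Jm (T k)))"
    by (intro tendsto_intros JnJ)
  from LIMSEQ_le_const2[OF this] Jn_bound
  have "(\<Sum>k<K. inner (x k) (Jm (T k))) \<le> F1 * (\<integral>\<omega>. g \<omega> * norm (P \<omega>) \<partial>lborel)" by blast
  moreover have "(\<Sum>k<K. c) \<le> (\<Sum>k<K. inner (x k) (Jm (T k)))" by (intro sum_mono) (simp add: xJ Tc)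
  ultimately have "real K * c \<le> F1 * (\<integral>\<omega>. g \<omega> * norm (P \<omega>) \<partial>lborel)" by simp
  also have "\<dots> \<le> F1 * (real K * (\<sigma> * G / 2 + G / (2 * real K * \<sigma>) + e / \<sigma>))"
    by (intro mult_left_mono Plin F1_nonneg)
  also have "\<dots> = real K * (F1 * G * \<sigma> / 2 + F1 * G / (2 * real K * \<sigma>) + F1 * e / \<sigma>)" by (simp add: algebra_simps)
  finally have "c \<le> F1 * G * \<sigma> / 2 + F1 * G / (2 * real K * \<sigma>) + F1 * e / \<sigma>" using K by simp
  moreover have "F1 * G * \<sigma> / 2 \<le> c / 4"
  proof -
    have "F1 * G * \<sigma> = (F1 * G / (F1 * G + 1)) * (c / 2)" by (simp add: \<sigma>_def)
    also have "\<dots> \<le> 1 * (c / 2)" using FG c by (intro mult_right_mono) (auto simp: divide_simps)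
    finally show ?thesis by linarith
  qed
  moreover have "F1 * G / (2 * real K * \<sigma>) \<le> c / 4"
    using K \<sigma> c by (simp add: field_simps)
  moreover have "F1 * e / \<sigma> \<le> c / 4"
  proof -
    have "F1 * e / \<sigma> = (F1 / (F1 + 1)) * (c / 4)" using \<sigma> by (simp add: e_def)
    also have "\<dots> \<le> 1 * (c / 4)" using F1_nonneg c by (intro mult_right_mono) (auto simp: divide_simps)
    finally show ?thesis by simp
  qed
  ultimately show False using c by linarith
qed

theorem decay:
  assumes g0: "\<And>\<omega>. 0 < g \<omega>" and g: "\<And>a b. set_integrable lborel {a..b} g"
    and coerc: "AE \<omega> in lborel. \<forall>\<eta>. 0 < \<eta> \<longrightarrow> \<eta> < 1 \<longrightarrow> (\<forall>y. (norm y)\<^sup>2 / g \<omega> \<le> inner y (ahat J ainf \<alpha> (Complex \<omega> \<eta>) y))"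
  shows "((\<lambda>t. norm (v t)) \<longlongrightarrow> 0) at_top"
proof -
  have sm: "((\<lambda>t. \<integral>q. fejer q *\<^sub>R v0 (t - q / R) \<partial>lborel) \<longlongrightarrow> 0) at_top" if R: "R > 0" for R
  \<comment> \<open>Cutting \<open>g\<close> to [-R,R] turns local integrability into
    integrability.\<close>
  proof (rule smoothed_decay[OF R, where g="\<lambda>\<omega>. indicat_real {-R..R} \<omega> * g \<omega>"])
    show "integrable lborel (\<lambda>\<omega>. indicat_real {-R..R} \<omega> * g \<omega>)" using g[of "-R" R] by (simp add: set_integrable_def)
    show "0 \<le> indicat_real {-R..R} \<omega> * g \<omega>" for \<omega> using g0[of \<omega>] by simp
    show "AE \<omega> in lborel. \<forall>\<eta>. 0 < \<eta> \<longrightarrow> \<eta> < 1 \<longrightarrow> \<bar>\<omega>\<bar> \<le> R \<longrightarrow> norm (vhat \<eta> \<omega>) \<le> indicat_real {-R..R} \<omega> * g \<omega> * F1"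
      using coerc
    proof eventually_elim
      case (elim \<omega>)
      show ?case
      proof (intro allI impI)
        fix \<eta> :: real assume \<eta>: "0 < \<eta>" "\<eta> < 1" and \<omega>: "\<bar>\<omega>\<bar> \<le> R"
        have "(1 / g \<omega>) * norm (vhat \<eta> \<omega>) \<le> F1"
          unfolding F1_def using elim \<eta> g0[of \<omega>] by (intro vhat_bound) auto
        then show "norm (vhat \<eta> \<omega>) \<le> indicat_real {-R..R} \<omega> * g \<omega> * F1"
          using g0[of \<omega>] \<omega> by (simp add: field_simps abs_le_iff)
      qed
    qed
  qed
  have "((\<lambda>t. fejer_mass *\<^sub>R v0 t) \<longlongrightarrow> 0) at_top"
  proof (rule tendstoI)
    fix e :: real assume e: "e > 0"
    have "(\<lambda>n. 2 / \<delta> * (\<integral>q. fejer q * modulus (q / real (Suc n)) \<partial>lborel)) \<longlonglongrightarrow> 2 / \<delta> * 0"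
      by (intro tendsto_intros modulus_smoothing)
    then have "eventually (\<lambda>n. 2 / \<delta> * (\<integral>q. fejer q * modulus (q / real (Suc n)) \<partial>lborel) < e / 2) sequentially"
      using e by (intro order_tendstoD(2)) auto
    \<comment> \<open>The smoothing scale is fixed first, with an error uniform in t > 0; only then
      does t tend to infinity at that fixed scale.\<close>
    then obtain n where n: "2 / \<delta> * (\<integral>q. fejer q * modulus (q / real (Suc n)) \<partial>lborel) < e / 2"
      by (auto simp: eventually_sequentially)
    define R where "R = real (Suc n)"
    have R: "R > 0" by (simp add: R_def)
    have "eventually (\<lambda>t. dist (\<integral>q. fejer q *\<^sub>R v0 (t - q / R) \<partial>lborel) 0 < e / 2) at_top"
      using sm[OF R] e by (intro tendstoD) auto
    then show "eventually (\<lambda>t. dist (fejer_mass *\<^sub>R v0 t) 0 < e) at_top"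
      using eventually_gt_at_top[of "0::real"]
    proof eventually_elim
      case (elim t)
      have "norm (fejer_mass *\<^sub>R v0 t - (\<integral>q. fejer q *\<^sub>R v0 (t - q / R) \<partial>lborel)) < e / 2"
        using fejer_approx_v0[OF elim(2) R] n by (simp add: R_def)
      then show ?case
        using elim(1) norm_triangle_sub[of "fejer_mass *\<^sub>R v0 t" "\<integral>q. fejer q *\<^sub>R v0 (t - q / R) \<partial>lborel"]
        by (simp add: dist_norm)
    qed
  qed
  from tendsto_norm_zero[OF tendsto_scaleR[OF tendsto_const[of "inverse fejer_mass"] this, simplified]]
  have "((\<lambda>t. norm (v0 t)) \<longlongrightarrow> 0) at_top" using fejer_mass_pos by simp
  then show ?thesis
  proof (rule Lim_transform_eventually)
    show "eventually (\<lambda>t. norm (v0 t) = norm (v t)) at_top"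
      using eventually_ge_at_top[of "0::real"] by eventually_elim (simp add: v0_def)
  qed
qed

end

theorem theorem8:
  fixes J :: "'h::{real_inner,banach,second_countable_topology} \<Rightarrow> 'h"
    and m A ainf :: "'h \<Rightarrow> 'h" and D :: "'h set"
    and \<alpha> :: "real \<Rightarrow> 'h \<Rightarrow> 'h"
    and \<delta> :: real and \<theta> \<gamma> :: "real \<Rightarrow> real"
    and f v :: "real \<Rightarrow> 'h"
  assumes J: "complex_structure J"
    and m_bdd: "bounded_clinear_op J m"
    and \<delta>: "\<delta> > 0"
    and m_ge: "nonneg_op J (\<lambda>x. m x - \<delta> *\<^sub>R x)"
    and A: "self_adjoint_op J D A"
    and ainf_bdd: "bounded_clinear_op J ainf"
    and ainf_nonneg: "nonneg_op J ainf"
    and \<alpha>_op: "\<And>t. t \<ge> 0 \<Longrightarrow> bounded_clinear_op J (\<alpha> t)"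
    and \<alpha>_strong_cont: "\<And>x. continuous_on {0..} (\<lambda>t. \<alpha> t x)"
    and \<alpha>_bdd: "\<exists>C. \<forall>t\<ge>0. onorm (\<alpha> t) \<le> C"
    and Re_ahat: "\<And>\<zeta> w. Im \<zeta> > 0 \<Longrightarrow> Re (cinner J w (ahat J ainf \<alpha> \<zeta> w)) \<ge> 0"
    and \<theta>_meas: "\<theta> \<in> borel_measurable lborel"
    and \<theta>_range: "\<And>\<omega>. 0 < \<theta> \<omega> \<and> \<theta> \<omega> < pi"
    and \<gamma>_meas: "\<gamma> \<in> borel_measurable lborel"
    and \<gamma>_pos: "\<And>\<omega>. \<gamma> \<omega> > 0"
    and \<gamma>_loc: "\<And>a b. set_integrable lborel {a..b} \<gamma>"
    and coerc: "AE \<omega> in lborel. \<forall>\<zeta>\<in>Gamma_cone (\<theta> \<omega>) \<omega>. \<forall>w.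
                  Re (cinner J w (ahat J ainf \<alpha> \<zeta> w)) \<ge> norm w ^ 2 / \<gamma> \<omega>"
    and f_int: "integrable lborel f"
    and f_supp: "\<exists>T. AE t in lborel. t \<notin> {0..T} \<longrightarrow> f t = 0"
    and v_cont: "continuous_on {0..} v"
    and v_lap: "\<And>\<zeta>. Im \<zeta> > 0 \<Longrightarrow> laplace_exists J v \<zeta> \<and>
                  laplace_int J v \<zeta> = frakA J D m A ainf \<alpha> \<zeta> (laplace_int J f \<zeta>)"
  shows "((\<lambda>t. norm (v t)) \<longlongrightarrow> 0) at_top"
proof -
  obtain C where C: "\<And>t. t \<ge> 0 \<Longrightarrow> onorm (\<alpha> t) \<le> C" using \<alpha>_bdd by blast
  interpret causal_solution J D A m ainf \<alpha> \<delta> C f v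
    by unfold_locales (fact J A m_bdd \<delta> m_ge ainf_bdd \<alpha>_op \<alpha>_strong_cont C Re_ahat f_int v_cont v_lap)+
  show ?thesis
  proof (rule decay[OF \<gamma>_pos \<gamma>_loc])
    show "AE \<omega> in lborel. \<forall>\<eta>. 0 < \<eta> \<longrightarrow> \<eta> < 1 \<longrightarrow>
        (\<forall>y. (norm y)\<^sup>2 / \<gamma> \<omega> \<le> inner y (ahat J ainf \<alpha> (Complex \<omega> \<eta>) y))"
      using coerc
    proof eventually_elim
      case (elim \<omega>)
      \<comment> \<open>Positivity of the tangent places the axis of the cone, the open vertical
        segment above \<omega>, inside it.\<close>
      have "tan (\<theta> \<omega> / 2) > 0" using \<theta>_range[of \<omega>] by (intro tan_gt_zero) auto
      then have "Complex \<omega> \<eta> \<in> Gamma_cone (\<theta> \<omega>) \<omega>" if "0 < \<eta>" "\<eta> < 1" for \<eta>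
        using that by (simp add: Gamma_cone_def)
      then show ?case using elim by (auto simp: cinner_def)
    qed
  qed
qed

end
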